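(* There is a bijective correspondence in dimension $5$ between compatible subconformal contact structures (of type $\delta>0$, respectively $\delta<0$) and parabolic geometries of type $(A_3,P_{13})$ (namely Legendrian contact structures, respectively almost CR structures of split Levi signature).
   Context: Let $M$ be a $5$-manifold with contact distribution $\Delta=\ker\omega^0$ and conformal symplectic form $[\Omega]$, $\Omega=d\omega^0|_\Delta$. A subconformal contact structure is $(M,\Delta,[g])$ with $[g]$ the conformal class of a nondegenerate $g\in\Gamma(S^2\Delta^* )$ of signature $(2,2)$. In a null-diagonal coframe $\omega^1,\dots,\omega^4$ of $\Delta$ with $g=\omega^1\omega^3+\omega^2\omega^4$, the $\alpha$-planes are $\Pi_\lambda=\langle\partial_{\omega^1}+\lambda\partial_{\omega^2},\lambda\partial_{\omega^3}-\partial_{\omega^4}\rangle$, $\lambda\in\mathbb{R}\cup\{\infty\}$, one of the two $\mathbb{P}^1$-families of totally null $2$-planes (the two families are swapped by change of orientation). The structure is compatible if all $\alpha$-planes are Lagrangian for $[\Omega]$. Then $\Omega=p\,\omega^1\wedge\omega^2+q(\omega^1\wedge\omega^3+\omega^2\wedge\omega^4)+r\,\omega^3\wedge\omega^4$ and the type is the sign of $\delta=q^2-pr\neq0$. Parabolic geometries of type $(A_3,P_{13})$ are understood through their underlying geometric structures (equivalently, as regular normal Cartan geometries of that type), for the real forms $(SL(4,\mathbb{R}),P_{13})$ when $\delta>0$ and $(SU(2,2),P_{13})$ when $\delta<0$: (i) a Legendrian contact structure (almost para-CR structure) is a contact distribution $\Delta$ on a $5$-manifold with a splitting $\Delta=L_-\oplus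 L_+$ into two rank $2$ Lagrangian subbundles (no integrability of $L_\pm$ is required); (ii) an almost CR structure of split Levi signature is a contact distribution $\Delta$ on a $5$-manifold with an almost complex structure $J$ on $\Delta$, $J^2=-\mathrm{Id}$, compatible with the conformal symplectic structure ($\Omega(J\cdot,J\cdot)=\Omega$), with $\Omega(\cdot,J\cdot)$ of signature $(2,2)$ (no integrability of $J$ is required). *)

theory Defs
  imports "HOL-Analysis.Analysis"
begin

section \<open>Smooth maps on open subsets of Euclidean space\<close>

text \<open>On an open subset of a finite-dimensional space, \<open>C\<^sup>k\<^sup>+\<^sup>1\<close> means differentiable with all directional
  derivatives of class \<open>C\<^sup>k\<close>.\<close>

primrec Ck_on :: "nat \<Rightarrow> 'a::euclidean_space set \<Rightarrow> ('a \<Rightarrow> 'b::real_normed_vector) \<Rightarrow> bool" where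
  "Ck_on 0 S f \<longleftrightarrow> continuous_on S f"
| "Ck_on (Suc k) S f \<longleftrightarrow>
     (\<forall>x\<in>S. f differentiable (at x)) \<and> (\<forall>v. Ck_on k S (\<lambda>x. frechet_derivative f (at x) v))"

definition smooth_on :: "'a::euclidean_space set \<Rightarrow> ('a \<Rightarrow> 'b::real_normed_vector) \<Rightarrow> bool" where
  "smooth_on S f \<longleftrightarrow> (\<forall>k. Ck_on k S f)"


section \<open>Smooth 5-manifolds\<close>

text \<open>The manifold is the whole type \<open>'m\<close>, whose type class makes it Hausdorff and second countable.
  A chart is a pair \<open>(U, \<phi>)\<close>; the values of \<open>\<phi>\<close> off \<open>U\<close> are irrelevant.\<close>

type_synonym 'm chart = "'m set \<times> ('m \<Rightarrow> real ^ 5)"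

definition chart_inv :: "'m chart \<Rightarrow> real ^ 5 \<Rightarrow> 'm" where
  "chart_inv c = inv_into (fst c) (snd c)"

definition transition :: "'m chart \<Rightarrow> 'm chart \<Rightarrow> real ^ 5 \<Rightarrow> real ^ 5" where
  "transition c d = snd d \<circ> chart_inv c"

definition smooth_atlas :: "('m::topological_space) chart set \<Rightarrow> bool" where
  "smooth_atlas A \<longleftrightarrow>
     (\<forall>c\<in>A. open (fst c) \<and> open (snd c ` fst c) \<and>
            homeomorphism (fst c) (snd c ` fst c) (snd c) (chart_inv c)) \<and>
     (\<Union>c\<in>A. fst c) = UNIV \<and>
     (\<forall>c\<in>A. \<forall>d\<in>A. smooth_on (snd c ` (fst c \<inter> fst d)) (transition c d))"

text \<open>The tangent space at \<open>p\<close> is modelled on \<open>real ^ 5\<close>: a vector \<open>u\<close> at \<open>p\<close> stands for the tangent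
  vector whose components in the reference chart \<open>chart_at A p\<close> are \<open>u\<close>. The reference chart may vary
  arbitrarily with \<open>p\<close>. It serves only to label tangent vectors; smoothness is always tested on the
  components with respect to the charts of the atlas, which are given by \<open>to_chart\<close>. The map
  \<open>from_chart\<close> is its inverse.\<close>

definition chart_at :: "'m chart set \<Rightarrow> 'm \<Rightarrow> 'm chart" where
  "chart_at A p = (SOME c. c \<in> A \<and> p \<in> fst c)"

definition to_chart :: "'m chart set \<Rightarrow> 'm chart \<Rightarrow> 'm \<Rightarrow> real ^ 5 \<Rightarrow> real ^ 5" where
  "to_chart A c p =
     frechet_derivative (transition (chart_at A p) c) (at (snd (chart_at A p) p))"

definition from_chart :: "'m chart set \<Rightarrow> 'm chart \<Rightarrow> 'm \<Rightarrow> real ^ 5 \<Rightarrow> real ^ 5" where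
  "from_chart A c p = frechet_derivative (transition c (chart_at A p)) (at (snd c p))"

definition smooth_function_on :: "'m chart set \<Rightarrow> 'm set \<Rightarrow> ('m \<Rightarrow> real) \<Rightarrow> bool" where
  "smooth_function_on A W f \<longleftrightarrow> (\<forall>c\<in>A. smooth_on (snd c ` (fst c \<inter> W)) (f \<circ> chart_inv c))"

definition smooth_vector_field_on :: "'m chart set \<Rightarrow> 'm set \<Rightarrow> ('m \<Rightarrow> real ^ 5) \<Rightarrow> bool" where
  "smooth_vector_field_on A W X \<longleftrightarrow>
     (\<forall>c\<in>A. smooth_on (snd c ` (fst c \<inter> W)) (\<lambda>x. to_chart A c (chart_inv c x) (X (chart_inv c x))))"

definition form_component :: "'m chart set \<Rightarrow> 'm chart \<Rightarrow> ('m \<Rightarrow> real ^ 5 \<Rightarrow> real) \<Rightarrow>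
    real ^ 5 \<Rightarrow> real ^ 5 \<Rightarrow> real" where
  "form_component A c \<omega> a x = \<omega> (chart_inv c x) (from_chart A c (chart_inv c x) a)"

definition smooth_one_form :: "'m chart set \<Rightarrow> ('m \<Rightarrow> real ^ 5 \<Rightarrow> real) \<Rightarrow> bool" where
  "smooth_one_form A \<omega> \<longleftrightarrow>
     (\<forall>p. linear (\<omega> p)) \<and> (\<forall>c\<in>A. \<forall>a. smooth_on (snd c ` fst c) (form_component A c \<omega> a))"

text \<open>\<open>d\<omega>(u,v) = D\<^sub>u(\<omega>(v)) - D\<^sub>v(\<omega>(u))\<close> for constant coefficient fields \<open>u\<close>, \<open>v\<close> in a chart around \<open>p\<close>.
  The reference chart is used, in which tangent vectors at \<open>p\<close> are their own components.\<close>

definition ext_deriv :: "'m chart set \<Rightarrow> ('m \<Rightarrow> real ^ 5 \<Rightarrow> real) \<Rightarrow>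
    'm \<Rightarrow> real ^ 5 \<Rightarrow> real ^ 5 \<Rightarrow> real" where
  "ext_deriv A \<omega> p u v =
     (let c = chart_at A p; x = snd c p in
      frechet_derivative (form_component A c \<omega> v) (at x) u -
      frechet_derivative (form_component A c \<omega> u) (at x) v)"


section \<open>Distributions and tensors on them\<close>

definition smooth_subbundle :: "('m::topological_space) chart set \<Rightarrow> nat \<Rightarrow> ('m \<Rightarrow> (real ^ 5) set) \<Rightarrow> bool"
  where
  "smooth_subbundle A k L \<longleftrightarrow>
     (\<forall>p. subspace (L p) \<and> dim (L p) = k) \<and>
     (\<forall>p. \<exists>W X. open W \<and> p \<in> W \<and> (\<forall>i<k. smooth_vector_field_on A W (X i)) \<and>
        (\<forall>q\<in>W. L q = span ((\<lambda>i. X i q) ` {..<k})))"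

definition smooth_section_on ::
  "'m chart set \<Rightarrow> ('m \<Rightarrow> (real ^ 5) set) \<Rightarrow> 'm set \<Rightarrow> ('m \<Rightarrow> real ^ 5) \<Rightarrow> bool" where
  "smooth_section_on A D W X \<longleftrightarrow> smooth_vector_field_on A W X \<and> (\<forall>p\<in>W. X p \<in> D p)"

definition linear_within :: "(real ^ 5) set \<Rightarrow> (real ^ 5 \<Rightarrow> 'b::real_vector) \<Rightarrow> bool" where
  "linear_within V f \<longleftrightarrow>
     (\<forall>u\<in>V. \<forall>v\<in>V. f (u + v) = f u + f v) \<and> (\<forall>u\<in>V. \<forall>a. f (a *\<^sub>R u) = a *\<^sub>R f u)"

definition symmetric_bilinear_within :: "(real ^ 5) set \<Rightarrow> (real ^ 5 \<Rightarrow> real ^ 5 \<Rightarrow> real) \<Rightarrow> bool" where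
  "symmetric_bilinear_within V B \<longleftrightarrow>
     (\<forall>u\<in>V. linear_within V (B u)) \<and> (\<forall>u\<in>V. \<forall>v\<in>V. B u v = B v u)"

text \<open>\<open>B\<close> is nondegenerate on \<open>V\<close>, of signature \<open>(k, l)\<close>.\<close>

definition has_signature ::
  "(real ^ 5) set \<Rightarrow> (real ^ 5 \<Rightarrow> real ^ 5 \<Rightarrow> real) \<Rightarrow> nat \<Rightarrow> nat \<Rightarrow> bool" where
  "has_signature V B k l \<longleftrightarrow>
     (\<exists>P N. subspace P \<and> subspace N \<and> dim P = k \<and> dim N = l \<and>
        V = {x + y |x y. x \<in> P \<and> y \<in> N} \<and> P \<inter> N = {0} \<and>
        (\<forall>x\<in>P. x \<noteq> 0 \<longrightarrow> B x x > 0) \<and> (\<forall>y\<in>N. y \<noteq> 0 \<longrightarrow> B y y < 0) \<and>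
        (\<forall>x\<in>P. \<forall>y\<in>N. B x y = 0))"

definition lagrangian :: "(real ^ 5) set \<Rightarrow> (real ^ 5 \<Rightarrow> real ^ 5 \<Rightarrow> real) \<Rightarrow> (real ^ 5) set \<Rightarrow> bool" where
  "lagrangian V \<Omega> L \<longleftrightarrow>
     subspace L \<and> L \<subseteq> V \<and> dim L = 2 \<and> (\<forall>u\<in>L. \<forall>v\<in>L. \<Omega> u v = 0)"


section \<open>Contact forms\<close>

definition contact_distribution :: "('m \<Rightarrow> real ^ 5 \<Rightarrow> real) \<Rightarrow> 'm \<Rightarrow> (real ^ 5) set" where
  "contact_distribution \<omega> p = {v. \<omega> p v = 0}"

definition contact_form :: "'m chart set \<Rightarrow> ('m \<Rightarrow> real ^ 5 \<Rightarrow> real) \<Rightarrow> bool" where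
  "contact_form A \<omega> \<longleftrightarrow>
     smooth_one_form A \<omega> \<and> (\<forall>p. \<omega> p \<noteq> (\<lambda>_. 0)) \<and>
     (\<forall>p. \<forall>u\<in>contact_distribution \<omega> p.
        (\<forall>v\<in>contact_distribution \<omega> p. ext_deriv A \<omega> p u v = 0) \<longrightarrow> u = 0)"


section \<open>Subconformal contact structures\<close>

text \<open>A section of \<open>S\<^sup>2\<Delta>\<^sup>*\<close> is a family of functions on the tangent spaces of which only the
  restriction to \<open>\<Delta>\<close> matters. So that equality of such functions is equality of sections, they are
  required to vanish off \<open>\<Delta>\<close>; the same is done below for endomorphisms of \<open>\<Delta>\<close>.\<close>

definition subconformal_metric ::
  "('m::topological_space) chart set \<Rightarrow> ('m \<Rightarrow> real ^ 5 \<Rightarrow> real) \<Rightarrow>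
   ('m \<Rightarrow> real ^ 5 \<Rightarrow> real ^ 5 \<Rightarrow> real) \<Rightarrow> bool" where
  "subconformal_metric A \<omega> g \<longleftrightarrow>
     (\<forall>p. symmetric_bilinear_within (contact_distribution \<omega> p) (g p) \<and>
          has_signature (contact_distribution \<omega> p) (g p) 2 2 \<and>
          (\<forall>u v. u \<notin> contact_distribution \<omega> p \<or> v \<notin> contact_distribution \<omega> p \<longrightarrow> g p u v = 0)) \<and>
     (\<forall>W X Y. open W \<and> smooth_section_on A (contact_distribution \<omega>) W X \<and>
              smooth_section_on A (contact_distribution \<omega>) W Y \<longrightarrow>
              smooth_function_on A W (\<lambda>p. g p (X p) (Y p)))"

definition conformal_class ::
  "'m chart set \<Rightarrow> ('m \<Rightarrow> real ^ 5 \<Rightarrow> real ^ 5 \<Rightarrow> real) \<Rightarrow> ('m \<Rightarrow> real ^ 5 \<Rightarrow> real ^ 5 \<Rightarrow> real) set" where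
  "conformal_class A g =
     {h. \<exists>f. smooth_function_on A UNIV f \<and> (\<forall>p. f p > 0) \<and> (\<forall>p u v. h p u v = f p * g p u v)}"

definition subconformal_structure ::
  "('m::topological_space) chart set \<Rightarrow> ('m \<Rightarrow> real ^ 5 \<Rightarrow> real) \<Rightarrow>
   ('m \<Rightarrow> real ^ 5 \<Rightarrow> real ^ 5 \<Rightarrow> real) set \<Rightarrow> bool" where
  "subconformal_structure A \<omega> C \<longleftrightarrow>
     (\<exists>g. subconformal_metric A \<omega> g \<and> C = conformal_class A g)"

text \<open>\<open>w\<close> is a null-diagonal coframe of \<open>V\<close> for \<open>B\<close>, that is
  \<open>B = w\<^sup>1 w\<^sup>3 + w\<^sup>2 w\<^sup>4\<close>, with dual frame \<open>e\<close>; the product of 1-forms is the symmetrised tensor product.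
  The indices are \<open>1, 2, 3, 4\<close> in the type \<open>4\<close>.\<close>

definition null_diagonal_coframe ::
  "(real ^ 5) set \<Rightarrow> (real ^ 5 \<Rightarrow> real ^ 5 \<Rightarrow> real) \<Rightarrow>
   (4 \<Rightarrow> real ^ 5 \<Rightarrow> real) \<Rightarrow> (4 \<Rightarrow> real ^ 5) \<Rightarrow> bool" where
  "null_diagonal_coframe V B w e \<longleftrightarrow>
     (\<forall>i. linear_within V (w i)) \<and> span (range e) = V \<and>
     (\<forall>i j. w i (e j) = (if i = j then 1 else 0)) \<and>
     (\<forall>u\<in>V. \<forall>v\<in>V. B u v = (w 1 u * w 3 v + w 3 u * w 1 v) / 2 + (w 2 u * w 4 v + w 4 u * w 2 v) / 2)"

text \<open>The parameter \<open>\<lambda> = \<infinity>\<close> is \<open>None\<close>.\<close>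

fun alpha_plane :: "(4 \<Rightarrow> real ^ 5) \<Rightarrow> real option \<Rightarrow> (real ^ 5) set" where
  "alpha_plane e (Some t) = span {e 1 + t *\<^sub>R e 2, t *\<^sub>R e 3 - e 4}"
| "alpha_plane e None = span {e 2, e 3}"

text \<open>Null-diagonal coframes of both orientations are admitted, so that either of the two families of
  totally null planes may serve as the family of \<open>\<alpha>\<close>-planes. At most one of the two families
  can consist of Lagrangian planes.\<close>

definition adapted_coframe ::
  "'m chart set \<Rightarrow> ('m \<Rightarrow> real ^ 5 \<Rightarrow> real) \<Rightarrow> ('m \<Rightarrow> real ^ 5 \<Rightarrow> real ^ 5 \<Rightarrow> real) \<Rightarrow> 'm \<Rightarrow>
   (4 \<Rightarrow> real ^ 5 \<Rightarrow> real) \<Rightarrow> (4 \<Rightarrow> real ^ 5) \<Rightarrow> bool" where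
  "adapted_coframe A \<omega> g p w e \<longleftrightarrow>
     null_diagonal_coframe (contact_distribution \<omega> p) (g p) w e \<and>
     (\<forall>t. lagrangian (contact_distribution \<omega> p) (ext_deriv A \<omega> p) (alpha_plane e t))"

definition compatible ::
  "'m chart set \<Rightarrow> ('m \<Rightarrow> real ^ 5 \<Rightarrow> real) \<Rightarrow> ('m \<Rightarrow> real ^ 5 \<Rightarrow> real ^ 5 \<Rightarrow> real) set \<Rightarrow> bool" where
  "compatible A \<omega> C \<longleftrightarrow> (\<forall>g\<in>C. \<forall>p. \<exists>w e. adapted_coframe A \<omega> g p w e)"

definition wedge ::
  "(real ^ 5 \<Rightarrow> real) \<Rightarrow> (real ^ 5 \<Rightarrow> real) \<Rightarrow> real ^ 5 \<Rightarrow> real ^ 5 \<Rightarrow> real" where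
  "wedge \<alpha> \<beta> u v = \<alpha> u * \<beta> v - \<alpha> v * \<beta> u"

text \<open>The sign \<open>s\<close> of \<open>\<delta> = b\<^sup>2 - a c\<close>. This is meant for compatible structures, for which adapted
  coframes exist at every point.\<close>

definition of_type ::
  "'m chart set \<Rightarrow> ('m \<Rightarrow> real ^ 5 \<Rightarrow> real) \<Rightarrow> ('m \<Rightarrow> real ^ 5 \<Rightarrow> real ^ 5 \<Rightarrow> real) set \<Rightarrow> real \<Rightarrow> bool"
  where
  "of_type A \<omega> C s \<longleftrightarrow>
     (\<forall>g\<in>C. \<forall>p w e. adapted_coframe A \<omega> g p w e \<longrightarrow>
        (\<exists>a b c.
           (\<forall>u\<in>contact_distribution \<omega> p. \<forall>v\<in>contact_distribution \<omega> p.
              ext_deriv A \<omega> p u v =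
                a * wedge (w 1) (w 2) u v + b * (wedge (w 1) (w 3) u v + wedge (w 2) (w 4) u v) +
                c * wedge (w 3) (w 4) u v) \<and>
           sgn (b\<^sup>2 - a * c) = s))"


section \<open>Geometries of type \<open>(A\<^sub>3, P\<^sub>1\<^sub>3)\<close>\<close>

definition legendrian_contact_structure ::
  "('m::topological_space) chart set \<Rightarrow> ('m \<Rightarrow> real ^ 5 \<Rightarrow> real) \<Rightarrow>
   ('m \<Rightarrow> (real ^ 5) set) \<Rightarrow> ('m \<Rightarrow> (real ^ 5) set) \<Rightarrow> bool" where
  "legendrian_contact_structure A \<omega> Lm Lp \<longleftrightarrow>
     smooth_subbundle A 2 Lm \<and> smooth_subbundle A 2 Lp \<and>
     (\<forall>p. lagrangian (contact_distribution \<omega> p) (ext_deriv A \<omega> p) (Lm p) \<and>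
          lagrangian (contact_distribution \<omega> p) (ext_deriv A \<omega> p) (Lp p) \<and>
          contact_distribution \<omega> p = {x + y |x y. x \<in> Lm p \<and> y \<in> Lp p} \<and> Lm p \<inter> Lp p = {0})"

definition twisted_form ::
  "'m chart set \<Rightarrow> ('m \<Rightarrow> real ^ 5 \<Rightarrow> real) \<Rightarrow> ('m \<Rightarrow> real ^ 5 \<Rightarrow> real ^ 5) \<Rightarrow>
   'm \<Rightarrow> real ^ 5 \<Rightarrow> real ^ 5 \<Rightarrow> real" where
  "twisted_form A \<omega> J p u v =
     (if u \<in> contact_distribution \<omega> p \<and> v \<in> contact_distribution \<omega> p
      then ext_deriv A \<omega> p u (J p v) else 0)"

definition almost_CR_structure_split ::
  "('m::topological_space) chart set \<Rightarrow> ('m \<Rightarrow> real ^ 5 \<Rightarrow> real) \<Rightarrow>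
   ('m \<Rightarrow> real ^ 5 \<Rightarrow> real ^ 5) \<Rightarrow> bool" where
  "almost_CR_structure_split A \<omega> J \<longleftrightarrow>
     (\<forall>p. linear_within (contact_distribution \<omega> p) (J p) \<and>
          (\<forall>u. u \<notin> contact_distribution \<omega> p \<longrightarrow> J p u = 0) \<and>
          (\<forall>u\<in>contact_distribution \<omega> p. J p u \<in> contact_distribution \<omega> p \<and> J p (J p u) = - u) \<and>
          (\<forall>u\<in>contact_distribution \<omega> p. \<forall>v\<in>contact_distribution \<omega> p.
             ext_deriv A \<omega> p (J p u) (J p v) = ext_deriv A \<omega> p u v) \<and>
          has_signature (contact_distribution \<omega> p) (twisted_form A \<omega> J p) 2 2) \<and>
     (\<forall>W X. open W \<and> smooth_section_on A (contact_distribution \<omega>) W X \<longrightarrow>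
            smooth_vector_field_on A W (\<lambda>p. J p (X p)))"


section \<open>The correspondence\<close>

text \<open>The endomorphism of \<open>\<Delta>\<close> equal to \<open>-1\<close> on \<open>L\<^sub>-\<close> and to \<open>+1\<close> on \<open>L\<^sub>+\<close>.\<close>

definition para_complex ::
  "('m \<Rightarrow> (real ^ 5) set) \<Rightarrow> ('m \<Rightarrow> (real ^ 5) set) \<Rightarrow> 'm \<Rightarrow> real ^ 5 \<Rightarrow> real ^ 5" where
  "para_complex Lm Lp p v =
     (if \<exists>x\<in>Lm p. \<exists>y\<in>Lp p. v = x + y
      then THE z. \<exists>x\<in>Lm p. \<exists>y\<in>Lp p. v = x + y \<and> z = y - x else 0)"

text \<open>In both cases the conformal class is that of \<open>\<Omega>(\<cdot>, J \<cdot>)\<close>. For a Legendrian contact structure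
  it is thus represented by the metric for which \<open>L\<^sub>-\<close> and \<open>L\<^sub>+\<close> are null and
  \<open>g(x, y) = \<Omega>(x, y)\<close> for \<open>x\<close> in \<open>L\<^sub>-\<close> and \<open>y\<close> in \<open>L\<^sub>+\<close>.

  The conformal class is taken with respect to positive functions, so it depends on \<open>\<omega>\<close> only up to
  positive factors, that is, on the co-oriented contact distribution. The signs matter: \<open>J\<close> and \<open>-J\<close>
  (respectively the splittings with \<open>L\<^sub>-\<close> and \<open>L\<^sub>+\<close> interchanged) give \<open>g\<close> and \<open>-g\<close>, and replacing
  \<open>\<omega>\<close> by \<open>-\<omega>\<close> has the same effect.\<close>

definition subconformal_of_almost_CR ::
  "'m chart set \<Rightarrow> ('m \<Rightarrow> real ^ 5 \<Rightarrow> real) \<Rightarrow> ('m \<Rightarrow> real ^ 5 \<Rightarrow> real ^ 5) \<Rightarrow>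
   ('m \<Rightarrow> real ^ 5 \<Rightarrow> real ^ 5 \<Rightarrow> real) set" where
  "subconformal_of_almost_CR A \<omega> J = conformal_class A (twisted_form A \<omega> J)"

definition subconformal_of_legendrian ::
  "'m chart set \<Rightarrow> ('m \<Rightarrow> real ^ 5 \<Rightarrow> real) \<Rightarrow> ('m \<Rightarrow> (real ^ 5) set) \<Rightarrow> ('m \<Rightarrow> (real ^ 5) set) \<Rightarrow>
   ('m \<Rightarrow> real ^ 5 \<Rightarrow> real ^ 5 \<Rightarrow> real) set" where
  "subconformal_of_legendrian A \<omega> Lm Lp = conformal_class A (twisted_form A \<omega> (para_complex Lm Lp))"

end

theory Submission
  imports Defs
begin

text \<open>Both geometries are given by an endomorphism field \<open>J\<close> of the contact distribution \<open>\<Delta>\<close> with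
  \<open>J\<^sup>2 = s\<close> and \<open>\<Omega>(Ju, Jv) = - s \<Omega>(u, v)\<close>. For \<open>s = - 1\<close> this is an almost CR structure, required
  to have \<open>\<Omega>(\<cdot>, J \<cdot>)\<close> of signature \<open>(2, 2)\<close>. For \<open>s = 1\<close> the signature is automatic, and the
  eigenspaces of \<open>J\<close> are the two Lagrangian subbundles of a Legendrian contact structure. Given
  \<open>J\<^sup>2 = s\<close>, the second condition says that \<open>g = \<Omega>(\<cdot>, J \<cdot>)\<close> is symmetric. The theorem thus says, for both
  signs \<open>s\<close>, that \<open>J \<mapsto> [\<Omega>(\<cdot>, J \<cdot>)]\<close> is a bijection onto the compatible structures of type \<open>s\<close>.

  At a point this is linear algebra. In a null-diagonal coframe of \<open>g\<close> the \<open>\<alpha>\<close>-planes are Lagrangian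
  iff \<open>\<Omega>\<close> has the form \<open>p w\<^sup>1 \<and> w\<^sup>2 + q (w\<^sup>1 \<and> w\<^sup>3 + w\<^sup>2 \<and> w\<^sup>4) + r w\<^sup>3 \<and> w\<^sup>4\<close>, and then the endomorphism \<open>S\<close>
  with \<open>\<Omega>(u, v) = g(u, Sv)\<close> satisfies \<open>S\<^sup>2 = 4 \<delta>\<close>, where \<open>\<delta> = q\<^sup>2 - p r\<close> (\<open>coframe_operator\<close>). If \<open>\<delta>\<close> has sign
  \<open>s\<close>, then \<open>J = s S / (2 \<surd>\<bar>\<delta>\<bar>)\<close> has the required properties and \<open>\<Omega>(\<cdot>, J \<cdot>)\<close> is the positive multiple
  \<open>2 \<surd>\<bar>\<delta>\<bar> g\<close> of \<open>g\<close> (\<open>exists_twisting_operator\<close>). Conversely, if \<open>g = h \<Omega>(\<cdot>, J \<cdot>)\<close> with \<open>h > 0\<close>, then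
  \<open>S = s J / h\<close>, so that \<open>\<delta>\<close> has sign \<open>s\<close> (\<open>type_of_twisted\<close>), and a null-diagonal coframe with
  Lagrangian \<open>\<alpha>\<close>-planes is built from dual bases of the two eigenspaces if \<open>s = 1\<close>, from \<open>J\<close>-invariant null
  planes if \<open>s = - 1\<close> (\<open>adapted_coframe_para\<close>, \<open>adapted_coframe_hermitian\<close>). Finally, \<open>J\<close> is determined by
  the conformal class: replacing \<open>g\<close> by \<open>f g\<close> with \<open>f > 0\<close> replaces \<open>J\<close> by \<open>f J\<close>, whose square is \<open>s\<close>
  only for \<open>f = 1\<close> (\<open>conformal_operator_unique\<close>).

  What remains is smoothness. The form \<open>\<Omega>\<close> is smooth on smooth fields because the exterior
  derivative may be computed in any chart (\<open>ext_deriv_chart\<close>), which rests on the symmetry of second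
  derivatives. A section of \<open>\<Delta>\<close> is smooth as soon as its pairings with a local frame are
  (\<open>smooth_section_test\<close>). So the endomorphism \<open>T\<close> with \<open>\<Omega>(u, Tv) = g(u, v)\<close> is smooth, and \<open>J = f T\<close>
  for a positive function \<open>f\<close> with \<open>T\<^sup>2 = s / f\<^sup>2\<close>. Hence \<open>f\<^sup>2 = s \<Omega>(X, Y) / g(X, TY)\<close> for local sections
  \<open>X\<close>, \<open>Y\<close> with \<open>\<Omega>(X, Y) \<noteq> 0\<close>, and \<open>f\<close> and \<open>J\<close> are smooth (\<open>twisting_field_exists\<close>).\<close>

section \<open>Calculus of smooth maps\<close>

lemma linear_expansion:
  fixes f :: "'a::euclidean_space \<Rightarrow> 'b::real_vector"
  assumes "linear f"
  shows "f v = (\<Sum>i\<in>Basis. (v \<bullet> i) *\<^sub>R f i)"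
proof -
  have "f v = f (\<Sum>i\<in>Basis. (v \<bullet> i) *\<^sub>R i)" by (simp add: euclidean_representation)
  then show ?thesis by (simp add: linear_sum[OF assms] linear_scale[OF assms])
qed

lemma Ck_on_cong:
  assumes "open S" "\<And>x. x \<in> S \<Longrightarrow> f x = g x" "Ck_on k S f"
  shows "Ck_on k S g"
  using assms(2,3)
proof (induction k arbitrary: f g)
  case 0
  then show ?case by (auto cong: continuous_on_cong)
next
  case (Suc k)
  have d: "g differentiable (at x)" and
    e: "frechet_derivative f (at x) = frechet_derivative g (at x)" if "x \<in> S" for x
  proof -
    have fx: "f differentiable (at x)" using Suc.prems that by simp
    show "g differentiable (at x)"
      using fx assms(1) that Suc.prems(1) unfolding differentiable_def
      by (metis has_derivative_transform_within_open)
    show "frechet_derivative f (at x) = frechet_derivative g (at x)"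
      using frechet_derivative_transform_within_open[OF fx assms(1) that] Suc.prems(1) by blast
  qed
  have "Ck_on k S (\<lambda>x. frechet_derivative g (at x) v)" for v
  proof (rule Suc.IH)
    show "Ck_on k S (\<lambda>x. frechet_derivative f (at x) v)" using Suc.prems by simp
  qed (simp add: e)
  then show ?case using d by simp
qed

lemma Ck_on_SucD: "Ck_on (Suc k) S f \<Longrightarrow> Ck_on k S f"
proof (induction k arbitrary: f)
  case 0
  then show ?case
    by (auto intro!: continuous_at_imp_continuous_on differentiable_imp_continuous_within)
next
  case (Suc k)
  have "f differentiable (at x)" if "x \<in> S" for x using Suc.prems that by simp
  moreover have "Ck_on k S (\<lambda>x. frechet_derivative f (at x) v)" for v
    by (rule Suc.IH) (use Suc.prems in simp)
  ultimately show ?case by simp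
qed

lemma Ck_on_subset: "Ck_on k S f \<Longrightarrow> T \<subseteq> S \<Longrightarrow> Ck_on k T f"
  by (induction k arbitrary: f) (auto intro: continuous_on_subset)

lemma Ck_on_local:
  assumes "\<And>x. x \<in> S \<Longrightarrow> \<exists>T. open T \<and> x \<in> T \<and> Ck_on k T f"
  shows "Ck_on k S f"
  using assms
proof (induction k arbitrary: f)
  case 0
  show ?case unfolding Ck_on.simps
  proof (rule continuous_at_imp_continuous_on, rule)
    fix x assume "x \<in> S"
    then obtain T where "open T" "x \<in> T" "continuous_on T f" using 0 by auto
    then show "isCont f x" by (simp add: continuous_on_eq_continuous_at)
  qed
next
  case (Suc k)
  have "f differentiable (at x)" if "x \<in> S" for x using Suc.prems[OF that] by auto
  moreover have "Ck_on k S (\<lambda>x. frechet_derivative f (at x) v)" for v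
    by (rule Suc.IH) (use Suc.prems in force)
  ultimately show ?case by simp
qed

lemma Ck_on_const: "Ck_on k S (\<lambda>_. c)"
  by (induction k arbitrary: c) auto

text \<open>Closure properties are proved by induction on the order: the derivative is exhibited in terms of
  the given maps and their derivatives, and the induction hypothesis applies to it.\<close>

lemma Ck_on_SucI:
  assumes "open S" "\<And>x. x \<in> S \<Longrightarrow> (f has_derivative f' x) (at x)" "\<And>v. Ck_on k S (\<lambda>x. f' x v)"
  shows "Ck_on (Suc k) S f"
proof -
  have "f differentiable (at x)" if "x \<in> S" for x
    using assms(2)[OF that] by (auto simp: differentiable_def)
  moreover have "Ck_on k S (\<lambda>x. frechet_derivative f (at x) v)" for v
    by (rule Ck_on_cong[OF assms(1) fun_cong[OF frechet_derivative_at[OF assms(2)]] assms(3)])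
  ultimately show ?thesis by simp
qed

lemma Ck_on_has_derivative:
  "Ck_on (Suc k) S f \<Longrightarrow> x \<in> S \<Longrightarrow> (f has_derivative frechet_derivative f (at x)) (at x)"
  using frechet_derivative_works by auto

lemma Ck_on_bounded_linear:
  assumes "open S" "bounded_linear L" "Ck_on k S f"
  shows "Ck_on k S (\<lambda>x. L (f x))"
  using assms(3)
proof (induction k arbitrary: f)
  case 0
  then show ?case using bounded_linear.continuous_on[OF assms(2)] by simp
next
  case (Suc k)
  show ?case
  proof (rule Ck_on_SucI[OF assms(1) bounded_linear.has_derivative[OF assms(2) Ck_on_has_derivative[OF Suc.prems]]])
    fix v
    show "Ck_on k S (\<lambda>x. L (frechet_derivative f (at x) v))"
      by (rule Suc.IH) (use Suc.prems in simp)
  qed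
qed

lemma Ck_on_add:
  assumes "open S" "Ck_on k S f" "Ck_on k S g"
  shows "Ck_on k S (\<lambda>x. f x + g x)"
  using assms(2,3)
proof (induction k arbitrary: f g)
  case 0
  then show ?case by (simp add: continuous_on_add)
next
  case (Suc k)
  show ?case
  proof (rule Ck_on_SucI[OF assms(1) has_derivative_add[OF Ck_on_has_derivative[OF Suc.prems(1)]
        Ck_on_has_derivative[OF Suc.prems(2)]]])
    fix v
    show "Ck_on k S (\<lambda>x. frechet_derivative f (at x) v + frechet_derivative g (at x) v)"
      by (rule Suc.IH) (use Suc.prems in simp_all)
  qed
qed

lemma Ck_on_sum:
  assumes "open S" "\<And>i. i \<in> I \<Longrightarrow> Ck_on k S (f i)"
  shows "Ck_on k S (\<lambda>x. \<Sum>i\<in>I. f i x)"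
  using assms(2)
  by (induction I rule: infinite_finite_induct) (auto intro: Ck_on_add Ck_on_const assms(1))

lemma Ck_on_bilinear:
  assumes "open S" "bounded_bilinear h" "Ck_on k S f" "Ck_on k S g"
  shows "Ck_on k S (\<lambda>x. h (f x) (g x))"
  using assms(3,4)
proof (induction k arbitrary: f g)
  case 0
  then show ?case using bounded_bilinear.continuous_on[OF assms(2)] by simp
next
  case (Suc k)
  show ?case
  proof (rule Ck_on_SucI[OF assms(1) bounded_bilinear.FDERIV[OF assms(2) Ck_on_has_derivative[OF Suc.prems(1)]
        Ck_on_has_derivative[OF Suc.prems(2)]]])
    fix v
    show "Ck_on k S (\<lambda>x. h (f x) (frechet_derivative g (at x) v) + h (frechet_derivative f (at x) v) (g x))"
      by (intro Ck_on_add assms(1) Suc.IH Ck_on_SucD[OF Suc.prems(1)] Ck_on_SucD[OF Suc.prems(2)])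
        (use Suc.prems in simp_all)
  qed
qed

text \<open>The chain rule gives a derivative in which the base point and the direction are entangled.
  Expanding the direction in a basis turns it into a sum of products of \<open>C\<^sup>k\<close> maps.\<close>

lemma Ck_on_compose:
  assumes "open S" "open T" "f ` S \<subseteq> T" "Ck_on k S f" "Ck_on k T g"
  shows "Ck_on k S (\<lambda>x. g (f x))"
  using assms(4,5)
proof (induction k arbitrary: g)
  case 0
  then show ?case using continuous_on_compose2 assms(3) by auto
next
  case (Suc k)
  show ?case
  proof (rule Ck_on_SucI[OF assms(1)])
    fix x assume x: "x \<in> S"
    show "((\<lambda>x. g (f x)) has_derivative
        (\<lambda>v. \<Sum>b\<in>Basis. (frechet_derivative f (at x) v \<bullet> b) *\<^sub>R frechet_derivative g (at (f x)) b)) (at x)"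
    proof -
      have g: "(g has_derivative frechet_derivative g (at (f x))) (at (f x))"
        using Ck_on_has_derivative[OF Suc.prems(2)] assms(3) x by blast
      have "((\<lambda>x. g (f x)) has_derivative
          (\<lambda>v. frechet_derivative g (at (f x)) (frechet_derivative f (at x) v))) (at x)"
        using has_derivative_compose[OF Ck_on_has_derivative[OF Suc.prems(1) x] g] .
      then show ?thesis
        by (rule has_derivative_eq_rhs) (rule ext, rule linear_expansion[OF has_derivative_linear[OF g]])
    qed
  next
    fix v
    show "Ck_on k S (\<lambda>x. \<Sum>b\<in>Basis. (frechet_derivative f (at x) v \<bullet> b) *\<^sub>R frechet_derivative g (at (f x)) b)"
    proof (intro Ck_on_sum assms(1) Ck_on_bilinear[OF assms(1) bounded_bilinear_scaleR])
      fix b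
      show "Ck_on k S (\<lambda>x. frechet_derivative f (at x) v \<bullet> b)"
        by (intro Ck_on_bilinear[OF assms(1) bounded_bilinear_inner] Ck_on_const) (use Suc.prems in simp)
      show "Ck_on k S (\<lambda>x. frechet_derivative g (at (f x)) b)"
        by (rule Suc.IH[where g = "\<lambda>y. frechet_derivative g (at y) b"])
          (use Ck_on_SucD[OF Suc.prems(1)] Suc.prems(2) in simp_all)
    qed
  qed
qed

lemma Ck_on_inverse:
  fixes f :: "'a::euclidean_space \<Rightarrow> real"
  assumes "open S" "\<And>x. x \<in> S \<Longrightarrow> f x \<noteq> 0" "Ck_on k S f"
  shows "Ck_on k S (\<lambda>x. inverse (f x))"
  using assms(3)
proof (induction k)
  case 0
  then show ?case using assms(2) by (simp add: continuous_on_inverse)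
next
  case (Suc k)
  have i: "Ck_on k S (\<lambda>x. inverse (f x))" using Suc Ck_on_SucD by blast
  show ?case
  proof (rule Ck_on_SucI[OF assms(1) Deriv.has_derivative_inverse[OF assms(2) Ck_on_has_derivative[OF Suc.prems]]])
    fix v
    show "Ck_on k S (\<lambda>x. - (inverse (f x) * frechet_derivative f (at x) v * inverse (f x)))"
      by (intro Ck_on_bounded_linear[OF assms(1) bounded_linear_minus[OF bounded_linear_ident]]
          Ck_on_bilinear[OF assms(1) bounded_bilinear_mult] i) (use Suc.prems in simp)
  qed
qed

lemma Ck_on_sqrt:
  assumes "open S" "\<And>x. x \<in> S \<Longrightarrow> f x > 0" "Ck_on k S f"
  shows "Ck_on k S (\<lambda>x. sqrt (f x))"
  using assms(3)
proof (induction k)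
  case 0
  then show ?case by (simp add: continuous_on_real_sqrt)
next
  case (Suc k)
  have i: "Ck_on k S (\<lambda>x. inverse (sqrt (f x)))"
    by (intro Ck_on_inverse assms(1) Suc.IH Ck_on_SucD[OF Suc.prems]) (use assms(2) in force)
  show ?case
  proof (rule Ck_on_SucI[OF assms(1)])
    fix x assume "x \<in> S"
    then show "((\<lambda>x. sqrt (f x)) has_derivative
        (\<lambda>v. (inverse (sqrt (f x)) * (1/2)) * frechet_derivative f (at x) v)) (at x)"
      using has_derivative_real_sqrt[OF assms(2) Ck_on_has_derivative[OF Suc.prems]]
      by (simp add: field_simps)
  next
    fix v
    show "Ck_on k S (\<lambda>x. (inverse (sqrt (f x)) * (1/2)) * frechet_derivative f (at x) v)"
      by (intro Ck_on_bilinear[OF assms(1) bounded_bilinear_mult] i Ck_on_const) (use Suc.prems in simp)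
  qed
qed

lemma smooth_on_cong: "open S \<Longrightarrow> (\<And>x. x \<in> S \<Longrightarrow> f x = g x) \<Longrightarrow> smooth_on S f \<Longrightarrow> smooth_on S g"
  unfolding smooth_on_def using Ck_on_cong by blast

lemma smooth_on_subset: "smooth_on S f \<Longrightarrow> T \<subseteq> S \<Longrightarrow> smooth_on T f"
  unfolding smooth_on_def using Ck_on_subset by blast

lemma smooth_on_local: 
  assumes "\<And>x. x \<in> S \<Longrightarrow> \<exists>T. open T \<and> x \<in> T \<and> smooth_on T f"
  shows "smooth_on S f"
  unfolding smooth_on_def by (meson Ck_on_local assms smooth_on_def)

lemma smooth_on_const: "smooth_on S (\<lambda>_. c)"
  unfolding smooth_on_def by (simp add: Ck_on_const)

lemma smooth_on_add:
  "open S \<Longrightarrow> smooth_on S f \<Longrightarrow> smooth_on S g \<Longrightarrow> smooth_on S (\<lambda>x. f x + g x)"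
  unfolding smooth_on_def using Ck_on_add by blast

lemma smooth_on_bounded_linear:
  "open S \<Longrightarrow> bounded_linear L \<Longrightarrow> smooth_on S f \<Longrightarrow> smooth_on S (\<lambda>x. L (f x))"
  unfolding smooth_on_def using Ck_on_bounded_linear by blast

lemma smooth_on_minus: "open S \<Longrightarrow> smooth_on S f \<Longrightarrow> smooth_on S (\<lambda>x. - f x)"
  using smooth_on_bounded_linear[OF _ bounded_linear_minus[OF bounded_linear_ident]] by blast

lemma smooth_on_diff:
  "open S \<Longrightarrow> smooth_on S f \<Longrightarrow> smooth_on S g \<Longrightarrow> smooth_on S (\<lambda>x. f x - g x)"
  using smooth_on_add[OF _ _ smooth_on_minus] by auto

lemma smooth_on_sum:
  "open S \<Longrightarrow> (\<And>i. i \<in> I \<Longrightarrow> smooth_on S (f i)) \<Longrightarrow> smooth_on S (\<lambda>x. \<Sum>i\<in>I. f i x)"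
  unfolding smooth_on_def by (simp add: Ck_on_sum)

lemma smooth_on_bilinear:
  "open S \<Longrightarrow> bounded_bilinear h \<Longrightarrow> smooth_on S f \<Longrightarrow> smooth_on S g \<Longrightarrow> smooth_on S (\<lambda>x. h (f x) (g x))"
  unfolding smooth_on_def using Ck_on_bilinear by blast

lemmas smooth_on_mult = smooth_on_bilinear[OF _ bounded_bilinear_mult]
lemmas smooth_on_scaleR = smooth_on_bilinear[OF _ bounded_bilinear_scaleR]

lemma smooth_on_prod:
  fixes f :: "'i \<Rightarrow> 'a::euclidean_space \<Rightarrow> real"
  assumes "open S" "\<And>i. i \<in> I \<Longrightarrow> smooth_on S (f i)"
  shows "smooth_on S (\<lambda>x. \<Prod>i\<in>I. f i x)"
  using assms(2)
  by (induction I rule: infinite_finite_induct) (auto intro: smooth_on_mult smooth_on_const assms(1))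

lemma smooth_on_compose:
  "open S \<Longrightarrow> open T \<Longrightarrow> f ` S \<subseteq> T \<Longrightarrow> smooth_on S f \<Longrightarrow> smooth_on T g \<Longrightarrow> smooth_on S (\<lambda>x. g (f x))"
  unfolding smooth_on_def by (simp add: Ck_on_compose)

lemma smooth_on_inverse:
  fixes f :: "'a::euclidean_space \<Rightarrow> real"
  shows "open S \<Longrightarrow> (\<And>x. x \<in> S \<Longrightarrow> f x \<noteq> 0) \<Longrightarrow> smooth_on S f \<Longrightarrow> smooth_on S (\<lambda>x. inverse (f x))"
  unfolding smooth_on_def by (simp add: Ck_on_inverse)

lemma smooth_on_sqrt:
  "open S \<Longrightarrow> (\<And>x. x \<in> S \<Longrightarrow> f x > 0) \<Longrightarrow> smooth_on S f \<Longrightarrow> smooth_on S (\<lambda>x. sqrt (f x))"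
  unfolding smooth_on_def by (simp add: Ck_on_sqrt)

lemma smooth_on_differentiable: "smooth_on S f \<Longrightarrow> x \<in> S \<Longrightarrow> f differentiable (at x)"
  unfolding smooth_on_def by (metis Ck_on.simps(2))

lemma smooth_on_has_derivative:
  "smooth_on S f \<Longrightarrow> x \<in> S \<Longrightarrow> (f has_derivative frechet_derivative f (at x)) (at x)"
  using smooth_on_differentiable frechet_derivative_works by blast

lemma smooth_on_frechet_derivative: "smooth_on S f \<Longrightarrow> smooth_on S (\<lambda>x. frechet_derivative f (at x) v)"
  unfolding smooth_on_def by (metis Ck_on.simps(2))

lemma smooth_on_imp_continuous_on: "smooth_on S f \<Longrightarrow> continuous_on S f"
  unfolding smooth_on_def by (metis Ck_on.simps(1))

text \<open>The second difference \<open>f(x + ha + hb) - f(x + ha) - f(x + hb) + f x\<close> does not depend on the order of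
  its two differences; the mean value theorem in either order turns it into a mixed second
  derivative at a point close to \<open>x\<close>.\<close>

lemma second_difference_mean_value:
  fixes f :: "'a::euclidean_space \<Rightarrow> real"
  assumes d1: "\<And>y. y \<in> S \<Longrightarrow> (f has_derivative D y) (at y)"
    and d2: "\<And>y. y \<in> S \<Longrightarrow> ((\<lambda>y. D y a) has_derivative E y) (at y)"
    and h: "h > 0"
    and S: "\<And>s t. 0 \<le> s \<Longrightarrow> s \<le> h \<Longrightarrow> 0 \<le> t \<Longrightarrow> t \<le> h \<Longrightarrow> x + s *\<^sub>R a + t *\<^sub>R b \<in> S"
  shows "\<exists>s t. 0 \<le> s \<and> s \<le> h \<and> 0 \<le> t \<and> t \<le> h \<and>
    f (x + h *\<^sub>R a + h *\<^sub>R b) - f (x + h *\<^sub>R a) - f (x + h *\<^sub>R b) + f x = h * h * E (x + s *\<^sub>R a + t *\<^sub>R b) b"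
proof -
  have D1: "DERIV (\<lambda>s. f (x + s *\<^sub>R a + t *\<^sub>R b)) s :> D (x + s *\<^sub>R a + t *\<^sub>R b) a"
    if "0 \<le> s" "s \<le> h" "0 \<le> t" "t \<le> h" for s t
  proof -
    have "((\<lambda>s. f (x + s *\<^sub>R a + t *\<^sub>R b)) has_derivative (\<lambda>r. D (x + s *\<^sub>R a + t *\<^sub>R b) (r *\<^sub>R a))) (at s)"
      by (rule has_derivative_compose[where f = "\<lambda>s. x + s *\<^sub>R a + t *\<^sub>R b", OF _ d1[OF S[OF that]]])
        (auto intro!: derivative_eq_intros)
    moreover have "linear (D (x + s *\<^sub>R a + t *\<^sub>R b))" using d1[OF S[OF that]] has_derivative_linear by blast
    ultimately show ?thesis
      unfolding has_field_derivative_def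
      by (elim has_derivative_eq_rhs) (simp add: fun_eq_iff linear_scale mult.commute)
  qed
  have D2: "DERIV (\<lambda>t. D (x + s *\<^sub>R a + t *\<^sub>R b) a) t :> E (x + s *\<^sub>R a + t *\<^sub>R b) b"
    if "0 \<le> s" "s \<le> h" "0 \<le> t" "t \<le> h" for s t
  proof -
    have "((\<lambda>t. D (x + s *\<^sub>R a + t *\<^sub>R b) a) has_derivative (\<lambda>r. E (x + s *\<^sub>R a + t *\<^sub>R b) (r *\<^sub>R b))) (at t)"
      by (rule has_derivative_compose[where f = "\<lambda>t. x + s *\<^sub>R a + t *\<^sub>R b", OF _ d2[OF S[OF that]]])
        (auto intro!: derivative_eq_intros)
    moreover have "linear (E (x + s *\<^sub>R a + t *\<^sub>R b))" using d2[OF S[OF that]] has_derivative_linear by blast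
    ultimately show ?thesis
      unfolding has_field_derivative_def
      by (elim has_derivative_eq_rhs) (simp add: fun_eq_iff linear_scale mult.commute)
  qed
  have "\<exists>s>0. s < h \<and> (\<lambda>s. f (x + s *\<^sub>R a + h *\<^sub>R b) - f (x + s *\<^sub>R a + 0 *\<^sub>R b)) h
      - (\<lambda>s. f (x + s *\<^sub>R a + h *\<^sub>R b) - f (x + s *\<^sub>R a + 0 *\<^sub>R b)) 0
      = (h - 0) * (D (x + s *\<^sub>R a + h *\<^sub>R b) a - D (x + s *\<^sub>R a + 0 *\<^sub>R b) a)"
    by (rule MVT2) (use h D1 in \<open>auto intro!: DERIV_diff simp del: scaleR_zero_left\<close>)
  then obtain s where s: "0 < s" "s < h"
    "f (x + h *\<^sub>R a + h *\<^sub>R b) - f (x + h *\<^sub>R a) - f (x + h *\<^sub>R b) + f x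
      = h * (D (x + s *\<^sub>R a + h *\<^sub>R b) a - D (x + s *\<^sub>R a) a)"
    by (auto simp: algebra_simps)
  have "\<exists>t>0. t < h \<and> (\<lambda>t. D (x + s *\<^sub>R a + t *\<^sub>R b) a) h - (\<lambda>t. D (x + s *\<^sub>R a + t *\<^sub>R b) a) 0
      = (h - 0) * E (x + s *\<^sub>R a + t *\<^sub>R b) b"
    by (rule MVT2) (use h s D2 in auto)
  then obtain t where t: "0 < t" "t < h"
    "D (x + s *\<^sub>R a + h *\<^sub>R b) a - D (x + s *\<^sub>R a) a = h * E (x + s *\<^sub>R a + t *\<^sub>R b) b" by auto
  show ?thesis using s t by (intro exI[of _ s] exI[of _ t]) auto
qed

text \<open>The two mixed derivatives take a common value at two points arbitrarily close to \<open>x\<close>, so they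
  agree at \<open>x\<close> by continuity.\<close>

lemma symmetric_second_derivative_real:
  fixes f :: "'a::euclidean_space \<Rightarrow> real"
  assumes S: "open S" "x \<in> S" and f: "smooth_on S f"
  shows "frechet_derivative (\<lambda>y. frechet_derivative f (at y) a) (at x) b =
         frechet_derivative (\<lambda>y. frechet_derivative f (at y) b) (at x) a"
proof -
  define F where "F u v y = frechet_derivative (\<lambda>y. frechet_derivative f (at y) u) (at y) v" for u v y
  have cont: "continuous_on S (F u v)" for u v
    unfolding F_def by (intro smooth_on_imp_continuous_on smooth_on_frechet_derivative f)
  have iso: "isCont (F u v) x" for u v
    using cont S continuous_on_eq_continuous_at by blast
  have "\<bar>F a b x - F b a x\<bar> \<le> e" if e: "e > 0" for e
  proof -
    obtain d1 where d1: "d1 > 0" "\<And>y. dist y x < d1 \<Longrightarrow> dist (F a b y) (F a b x) < e/2"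
      using iso[of a b] half_gt_zero[OF e] unfolding continuous_at_eps_delta by blast
    obtain d2 where d2: "d2 > 0" "\<And>y. dist y x < d2 \<Longrightarrow> dist (F b a y) (F b a x) < e/2"
      using iso[of b a] half_gt_zero[OF e] unfolding continuous_at_eps_delta by blast
    obtain d3 where d3: "d3 > 0" "\<And>y. dist y x < d3 \<Longrightarrow> y \<in> S"
      using S unfolding open_dist by blast
    define d where "d = min d1 (min d2 d3)"
    \<comment> \<open>The parallelogram spanned by \<open>h a\<close> and \<open>h b\<close> at \<open>x\<close> stays in the ball of radius \<open>d\<close>.\<close>
    define h where "h = d / (2 * (norm a + norm b + 1))"
    have d: "d > 0" using d1 d2 d3 by (simp add: d_def)
    have p: "0 < 2 * (norm a + norm b + 1)"
      by (simp add: add_nonneg_pos)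
    have h: "h > 0" unfolding h_def using d p by (rule divide_pos_pos)
    have near: "dist (x + s *\<^sub>R u + t *\<^sub>R v) x < d"
      if "0 \<le> s" "s \<le> h" "0 \<le> t" "t \<le> h" "{u, v} = {a, b}" for s t u v
    proof -
      have "dist (x + s *\<^sub>R u + t *\<^sub>R v) x \<le> norm (s *\<^sub>R u) + norm (t *\<^sub>R v)"
        unfolding dist_norm using norm_triangle_ineq[of "s *\<^sub>R u" "t *\<^sub>R v"] by (simp add: algebra_simps)
      also have "\<dots> = s * norm u + t * norm v"
        using that by simp
      also have "\<dots> \<le> h * norm u + h * norm v"
        using that by (intro add_mono mult_right_mono) auto
      also have "\<dots> \<le> h * (2 * (norm a + norm b + 1)) - h"
      proof -
        have "norm u + norm v \<le> 2 * (norm a + norm b)"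
          using that(5) by (auto simp: doubleton_eq_iff)
        then have "h * (norm u + norm v) \<le> h * (2 * (norm a + norm b))" using h by simp
        then show ?thesis using h by (simp add: algebra_simps)
      qed
      also have "h * (2 * (norm a + norm b + 1)) = d"
        unfolding h_def using p by simp
      finally show ?thesis using h by linarith
    qed
    have mv: "\<exists>s t. 0 \<le> s \<and> s \<le> h \<and> 0 \<le> t \<and> t \<le> h \<and>
       f (x + h *\<^sub>R u + h *\<^sub>R v) - f (x + h *\<^sub>R u) - f (x + h *\<^sub>R v) + f x = h * h * F u v (x + s *\<^sub>R u + t *\<^sub>R v)"
      if uv: "{u, v} = {a, b}" for u v
      unfolding F_def
    proof (rule second_difference_mean_value[where S = S])
      show "(f has_derivative frechet_derivative f (at y)) (at y)" if "y \<in> S" for y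
        using smooth_on_has_derivative[OF f that] .
      show "((\<lambda>y. frechet_derivative f (at y) u) has_derivative
          frechet_derivative (\<lambda>y. frechet_derivative f (at y) u) (at y)) (at y)" if "y \<in> S" for y
        using smooth_on_has_derivative[OF smooth_on_frechet_derivative[OF f] that] .
      show "x + s *\<^sub>R u + t *\<^sub>R v \<in> S" if "0 \<le> s" "s \<le> h" "0 \<le> t" "t \<le> h" for s t
        by (rule d3(2)) (use near[OF that uv] in \<open>simp add: d_def\<close>)
    qed (rule h)
    obtain s t where st: "0 \<le> s" "s \<le> h" "0 \<le> t" "t \<le> h"
      "f (x + h *\<^sub>R a + h *\<^sub>R b) - f (x + h *\<^sub>R a) - f (x + h *\<^sub>R b) + f x = h * h * F a b (x + s *\<^sub>R a + t *\<^sub>R b)"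
      using mv[of a b] by blast
    obtain s' t' where st': "0 \<le> s'" "s' \<le> h" "0 \<le> t'" "t' \<le> h"
      "f (x + h *\<^sub>R b + h *\<^sub>R a) - f (x + h *\<^sub>R b) - f (x + h *\<^sub>R a) + f x = h * h * F b a (x + s' *\<^sub>R b + t' *\<^sub>R a)"
      using mv[of b a] by blast
    have "h * h * F a b (x + s *\<^sub>R a + t *\<^sub>R b) = h * h * F b a (x + s' *\<^sub>R b + t' *\<^sub>R a)"
      using st(5) st'(5) by (simp add: algebra_simps)
    then have "F a b (x + s *\<^sub>R a + t *\<^sub>R b) = F b a (x + s' *\<^sub>R b + t' *\<^sub>R a)" using h by simp
    moreover have "dist (F a b (x + s *\<^sub>R a + t *\<^sub>R b)) (F a b x) < e/2"
      by (rule d1(2)) (use near[OF st(1-4)] in \<open>simp add: d_def\<close>)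
    moreover have "dist (F b a (x + s' *\<^sub>R b + t' *\<^sub>R a)) (F b a x) < e/2"
      by (rule d2(2)) (use near[OF st'(1-4)] in \<open>simp add: d_def insert_commute\<close>)
    ultimately show ?thesis unfolding dist_real_def by linarith
  qed
  then have "\<bar>F a b x - F b a x\<bar> \<le> 0" by (rule field_le_epsilon) simp
  then have "F a b x = F b a x" by simp
  then show ?thesis by (simp add: F_def)
qed

lemma symmetric_second_derivative:
  fixes f :: "'a::euclidean_space \<Rightarrow> 'b::euclidean_space"
  assumes S: "open S" "x \<in> S" and f: "smooth_on S f"
  shows "frechet_derivative (\<lambda>y. frechet_derivative f (at y) a) (at x) b =
         frechet_derivative (\<lambda>y. frechet_derivative f (at y) b) (at x) a"
proof (rule euclidean_eqI)
  fix i :: 'b assume "i \<in> Basis"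
  have comp: "frechet_derivative (\<lambda>y. g y \<bullet> i) (at y) w = frechet_derivative g (at y) w \<bullet> i"
    if "smooth_on S g" "y \<in> S" for g :: "'a \<Rightarrow> 'b" and y w
  proof -
    have "((\<lambda>y. g y \<bullet> i) has_derivative (\<lambda>w. frechet_derivative g (at y) w \<bullet> i)) (at y)"
      using bounded_linear.has_derivative[OF bounded_linear_inner_left smooth_on_has_derivative[OF that]] .
    then show ?thesis by (metis frechet_derivative_at)
  qed
  have fi: "smooth_on S (\<lambda>y. f y \<bullet> i)"
    by (rule smooth_on_bounded_linear[OF S(1) bounded_linear_inner_left f])
  have two: "frechet_derivative (\<lambda>y. frechet_derivative (\<lambda>y. f y \<bullet> i) (at y) u) (at x) v
      = frechet_derivative (\<lambda>y. frechet_derivative f (at y) u) (at x) v \<bullet> i" for u v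
  proof -
    have "frechet_derivative (\<lambda>y. frechet_derivative (\<lambda>y. f y \<bullet> i) (at y) u) (at x)
      = frechet_derivative (\<lambda>y. frechet_derivative f (at y) u \<bullet> i) (at x)"
      by (rule frechet_derivative_transform_within_open[OF
          smooth_on_differentiable[OF smooth_on_frechet_derivative[OF fi] S(2)] S comp[OF f]])
    then show ?thesis using comp[OF smooth_on_frechet_derivative[OF f] S(2)] by simp
  qed
  show "frechet_derivative (\<lambda>y. frechet_derivative f (at y) a) (at x) b \<bullet> i =
         frechet_derivative (\<lambda>y. frechet_derivative f (at y) b) (at x) a \<bullet> i"
    using symmetric_second_derivative_real[OF S fi, of a b] two by simp
qed

section \<open>Spans of finite families\<close>

lemma span_range_sum:
  fixes f :: "'n::finite \<Rightarrow> 'b::real_vector"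
  assumes "z \<in> span (range f)"
  shows "\<exists>x. z = (\<Sum>i\<in>UNIV. x i *\<^sub>R f i)"
proof -
  let ?S = "{z. \<exists>x. z = (\<Sum>i\<in>UNIV. x i *\<^sub>R f i)}"
  have "subspace ?S"
    unfolding subspace_def
  proof (intro conjI ballI allI)
    show "0 \<in> ?S" by (auto intro!: exI[of _ "\<lambda>_. 0"])
  next
    fix u v assume "u \<in> ?S" "v \<in> ?S"
    then obtain x y where "u = (\<Sum>i\<in>UNIV. x i *\<^sub>R f i)" "v = (\<Sum>i\<in>UNIV. y i *\<^sub>R f i)" by blast
    then have "u + v = (\<Sum>i\<in>UNIV. (x i + y i) *\<^sub>R f i)" by (simp add: scaleR_add_left sum.distrib)
    then show "u + v \<in> ?S" by (intro CollectI exI[of _ "\<lambda>i. x i + y i"])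
  next
    fix c u assume "u \<in> ?S"
    then obtain x where "u = (\<Sum>i\<in>UNIV. x i *\<^sub>R f i)" by blast
    then have "c *\<^sub>R u = (\<Sum>i\<in>UNIV. (c * x i) *\<^sub>R f i)" by (simp add: scaleR_sum_right)
    then show "c *\<^sub>R u \<in> ?S" by (intro CollectI exI[of _ "\<lambda>i. c * x i"])
  qed
  moreover have "f j \<in> ?S" for j
    by (intro CollectI exI[of _ "\<lambda>i. if i = j then 1 else 0"]) (simp add: if_distrib[of "\<lambda>c. c *\<^sub>R _"] cong: if_cong)
  ultimately have "span (range f) \<subseteq> ?S" by (intro span_minimal) auto
  then show ?thesis using assms by blast
qed

lemma dim_span_pair:
  fixes x y :: "'a::euclidean_space"
  assumes "\<And>a b. a *\<^sub>R x + b *\<^sub>R y = 0 \<Longrightarrow> a = 0 \<and> b = 0"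
  shows "dim (span {x, y}) = 2"
proof -
  have xy: "x \<noteq> y" using assms[of 1 "-1"] by auto
  have "y \<noteq> 0" using assms[of 0 1] by auto
  moreover have "x \<notin> span {y}"
  proof
    assume "x \<in> span {y}"
    then obtain k where "x = k *\<^sub>R y" by (auto simp: span_singleton)
    then show False using assms[of 1 "- k"] by simp
  qed
  ultimately have "independent {x, y}" using xy by (simp add: independent_insert)
  then show ?thesis using xy by (simp add: dim_eq_card_independent)
qed

lemma mem_span_pair: "v \<in> span {x, y} \<longleftrightarrow> (\<exists>a b. v = a *\<^sub>R x + b *\<^sub>R y)"
  by (auto simp: span_insert span_singleton algebra_simps)

text \<open>Frames of a hyperplane are indexed by the type \<open>4\<close>, in which \<open>4 = 0\<close>; the last branch is the index \<open>4\<close>.\<close>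

definition four_frame :: "real ^ 5 \<Rightarrow> real ^ 5 \<Rightarrow> real ^ 5 \<Rightarrow> real ^ 5 \<Rightarrow> 4 \<Rightarrow> real ^ 5" where
  "four_frame a b c d i = (if i = 1 then a else if i = 2 then b else if i = 3 then c else d)"

lemma span_four_frame:
  "span (range (four_frame a b c d)) = {x + y |x y. x \<in> span {a, b} \<and> y \<in> span {c, d}}"
proof -
  have "range (four_frame a b c d) = {a, b} \<union> {c, d}"
    unfolding UNIV_4 image_insert image_empty four_frame_def by (simp add: insert_commute)
  then show ?thesis by (simp only: span_Un)
qed

lemma lessThan_2_image: "f ` {..<2::nat} = {f 0, f 1}"
  by (auto simp: numeral_2_eq_2 less_Suc_eq)

section \<open>Null-diagonal coframes\<close>

lemma linear_within_add: "linear_within V f \<Longrightarrow> u \<in> V \<Longrightarrow> v \<in> V \<Longrightarrow> f (u + v) = f u + f v"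
  and linear_within_scale: "linear_within V f \<Longrightarrow> u \<in> V \<Longrightarrow> f (a *\<^sub>R u) = a *\<^sub>R f u"
  by (auto simp: linear_within_def)

lemma linear_within_zero: "linear_within V f \<Longrightarrow> u \<in> V \<Longrightarrow> f 0 = 0"
  using linear_within_scale[of V f u 0] by simp

lemma linear_within_minus: "linear_within V f \<Longrightarrow> u \<in> V \<Longrightarrow> f (- u) = - f u"
  using linear_within_scale[of V f u "-1"] by simp

lemma linear_within_diff:
  "linear_within V f \<Longrightarrow> subspace V \<Longrightarrow> u \<in> V \<Longrightarrow> v \<in> V \<Longrightarrow> f (u - v) = f u - f v"
  using linear_within_add[of V f u "- v"] linear_within_minus[of V f v] subspace_neg[of V v] by simp

text \<open>A family with a dual family of functionals is independent, since each vector is separated from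
  the span of the others by its functional. Four independent vectors span.\<close>

lemma dual_family_span:
  assumes V: "subspace V" "dim V = 4" and e: "\<And>i::4. e i \<in> V"
    and w: "\<And>i. linear_within V (w i :: real ^ 5 \<Rightarrow> real)"
    and dual: "\<And>i j. w i (e j) = (if i = j then 1 else 0)"
  shows "span (range e) = V"
proof
  show "span (range e) \<subseteq> V" using V(1) e by (simp add: image_subsetI span_minimal)
  have inj: "inj e"
  proof (rule injI)
    fix i j assume "e i = e j"
    then show "i = j" using dual[of i i] dual[of i j] by (metis zero_neq_one)
  qed
  have "independent (range e)"
    unfolding dependent_def
  proof
    assume "\<exists>a\<in>range e. a \<in> span (range e - {a})"
    then obtain i where i: "e i \<in> span (range e - {e i})" by blast
    have sub: "subspace {v \<in> V. w i v = 0}"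
      unfolding subspace_def
    proof (intro conjI ballI allI)
      show "0 \<in> {v \<in> V. w i v = 0}"
        using linear_within_zero[OF w e] subspace_0[OF V(1)] by simp
    qed (auto simp: V(1) subspace_add subspace_scale linear_within_add[OF w] linear_within_scale[OF w])
    have "range e - {e i} \<subseteq> {v \<in> V. w i v = 0}" using e dual by auto
    then have "e i \<in> {v \<in> V. w i v = 0}" using i span_minimal[OF _ sub] by blast
    then show False using dual[of i i] by simp
  qed
  moreover have "card (range e) = 4" using card_image[OF inj] by simp
  ultimately show "V \<subseteq> span (range e)"
    using card_ge_dim_independent[of "range e" V] V(2) e by auto
qed

lemma coframe_expansion:
  fixes e :: "4 \<Rightarrow> real ^ 5"
  assumes span: "span (range e) = V" 
    and w: "\<And>i. linear_within V (w i :: real ^ 5 \<Rightarrow> real)"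
    and dual: "\<And>i j. w i (e j) = (if i = j then 1 else 0)"
    and v: "v \<in> V"
  shows "v = w 1 v *\<^sub>R e 1 + w 2 v *\<^sub>R e 2 + w 3 v *\<^sub>R e 3 + w 4 v *\<^sub>R e 4"
proof -
  let ?S = "{v \<in> V. v = (\<Sum>i\<in>UNIV. w i v *\<^sub>R e i)}"
  have V: "subspace V" using subspace_span[of "range e"] span by simp
  have e: "e i \<in> V" for i using span_base[of "e i" "range e"] span by simp
  have z: "w i 0 = 0" for i using linear_within_zero[OF w e] .
  have sub: "subspace ?S"
    unfolding subspace_def
  proof (intro conjI ballI allI)
    show "0 \<in> ?S" using z subspace_0[OF V] by simp
  next
    fix x y assume "x \<in> ?S" "y \<in> ?S"
    then have xy: "x \<in> V" "y \<in> V" "x = (\<Sum>i\<in>UNIV. w i x *\<^sub>R e i)" "y = (\<Sum>i\<in>UNIV. w i y *\<^sub>R e i)" by auto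
    have "(\<Sum>i\<in>UNIV. w i (x + y) *\<^sub>R e i) = (\<Sum>i\<in>UNIV. w i x *\<^sub>R e i) + (\<Sum>i\<in>UNIV. w i y *\<^sub>R e i)"
      using xy(1,2) by (simp add: linear_within_add[OF w] scaleR_add_left sum.distrib)
    then show "x + y \<in> ?S" using xy subspace_add[OF V] by simp
  next
    fix c x assume "x \<in> ?S"
    then have x: "x \<in> V" "x = (\<Sum>i\<in>UNIV. w i x *\<^sub>R e i)" by auto
    have "(\<Sum>i\<in>UNIV. w i (c *\<^sub>R x) *\<^sub>R e i) = c *\<^sub>R (\<Sum>i\<in>UNIV. w i x *\<^sub>R e i)"
      using x(1) by (simp add: linear_within_scale[OF w] scaleR_sum_right)
    then show "c *\<^sub>R x \<in> ?S" using x subspace_scale[OF V] by simp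
  qed
  have "e j \<in> ?S" for j
    using e dual by (simp add: if_distrib[of "\<lambda>c. c *\<^sub>R _"] cong: if_cong)
  then have "V \<subseteq> ?S" using span_minimal[OF _ sub, of "range e"] span by blast
  then have "v = (\<Sum>i\<in>UNIV. w i v *\<^sub>R e i)" using v by blast
  then show ?thesis by (simp add: sum_4)
qed

lemma symmetric_bilinear_withinD:
  assumes "symmetric_bilinear_within V B" "u \<in> V"
  shows "v \<in> V \<Longrightarrow> x \<in> V \<Longrightarrow> B u (v + x) = B u v + B u x" "v \<in> V \<Longrightarrow> B u (a *\<^sub>R v) = a * B u v"
  using assms linear_within_add[of V "B u"] linear_within_scale[of V "B u"]
  by (auto simp: symmetric_bilinear_within_def)

text \<open>If the Gram matrix of four vectors has the null-diagonal shape, then lowering the index of the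
  partner of \<open>e i\<close> yields the dual coframe. In the type \<open>4\<close> the shift by \<open>2\<close> exchanges \<open>1\<close> with \<open>3\<close> and
  \<open>2\<close> with \<open>4\<close>.\<close>

lemma null_diagonal_coframeI:
  fixes e :: "4 \<Rightarrow> real ^ 5"
  assumes V: "subspace V" "dim V = 4" and B: "symmetric_bilinear_within V B"
    and e: "\<And>i. e i \<in> V"
    and pair: "B (e 1) (e 3) = 1 / 2" "B (e 2) (e 4) = 1 / 2"
    and null: "B (e 1) (e 1) = 0" "B (e 1) (e 2) = 0" "B (e 1) (e 4) = 0" "B (e 2) (e 2) = 0"
      "B (e 2) (e 3) = 0" "B (e 3) (e 3) = 0" "B (e 3) (e 4) = 0" "B (e 4) (e 4) = 0"
  shows "null_diagonal_coframe V B (\<lambda>i v. 2 * B (e (i + 2)) v) e"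
proof -
  let ?w = "\<lambda>i v. 2 * B (e (i + 2)) v"
  have shift: "(1::4) + 2 = 3" "(2::4) + 2 = 4" "(3::4) + 2 = 1" "(4::4) + 2 = 2" by simp_all
  have sym: "B x y = B y x" if "x \<in> V" "y \<in> V" for x y
    using B that by (simp add: symmetric_bilinear_within_def)
  have sym_e: "B (e i) (e j) = B (e j) (e i)" for i j using sym e by blast
  have lin: "linear_within V (?w i)" for i
    using symmetric_bilinear_withinD(1,2)[OF B e]
    by (auto simp: linear_within_def algebra_simps)
  have "\<forall>i j. ?w i (e j) = (if i = j then 1 else 0)"
    unfolding forall_4 shift
    using pair null sym_e[of 2 1] sym_e[of 3 1] sym_e[of 4 1] sym_e[of 3 2] sym_e[of 4 2] sym_e[of 4 3]
    by simp
  then have dual: "?w i (e j) = (if i = j then 1 else 0)" for i j by blast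
  have span: "span (range e) = V" by (rule dual_family_span[OF V e lin dual])
  have "B u v = (?w 1 u * ?w 3 v + ?w 3 u * ?w 1 v) / 2 + (?w 2 u * ?w 4 v + ?w 4 u * ?w 2 v) / 2"
    if uv: "u \<in> V" "v \<in> V" for u v
  proof -
    note in_V = subspace_add[OF V(1)] subspace_scale[OF V(1) e]
    note a = symmetric_bilinear_withinD(1)[OF B uv(2)] symmetric_bilinear_withinD(2)[OF B uv(2) e]
    have "B u v = B v u" using sym uv by blast
    also have "\<dots> = B v (?w 1 u *\<^sub>R e 1 + ?w 2 u *\<^sub>R e 2 + ?w 3 u *\<^sub>R e 3 + ?w 4 u *\<^sub>R e 4)"
      using coframe_expansion[OF span lin dual uv(1)] by metis
    also have "\<dots> = ?w 1 u * B v (e 1) + ?w 2 u * B v (e 2) + ?w 3 u * B v (e 3) + ?w 4 u * B v (e 4)"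
      by (simp only: a in_V)
    also have "\<dots> = (?w 1 u * ?w 3 v + ?w 3 u * ?w 1 v) / 2 + (?w 2 u * ?w 4 v + ?w 4 u * ?w 2 v) / 2"
      unfolding shift using sym[OF uv(2) e] by (simp add: field_simps)
    finally show ?thesis .
  qed
  then show ?thesis unfolding null_diagonal_coframe_def using lin span dual by blast
qed

lemma null_diagonal_coframeD:
  assumes "null_diagonal_coframe V B w e"
  shows "subspace V" "e i \<in> V" "linear_within V (w i)" "w i (e j) = (if i = j then 1 else 0)"
    "v \<in> V \<Longrightarrow> v = w 1 v *\<^sub>R e 1 + w 2 v *\<^sub>R e 2 + w 3 v *\<^sub>R e 3 + w 4 v *\<^sub>R e 4"
    "u \<in> V \<Longrightarrow> v \<in> V \<Longrightarrow>
      B u v = (w 1 u * w 3 v + w 3 u * w 1 v) / 2 + (w 2 u * w 4 v + w 4 u * w 2 v) / 2"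
proof -
  have c: "linear_within V (w i)" "span (range e) = V" "w i (e j) = (if i = j then 1 else 0)" for i j
    using assms by (auto simp: null_diagonal_coframe_def)
  show "subspace V" using subspace_span[of "range e"] c(2) by simp
  show "e i \<in> V" using span_base[of "e i" "range e"] c(2) by simp
  show "linear_within V (w i)" "w i (e j) = (if i = j then 1 else 0)" by fact+
  show "v = w 1 v *\<^sub>R e 1 + w 2 v *\<^sub>R e 2 + w 3 v *\<^sub>R e 3 + w 4 v *\<^sub>R e 4" if "v \<in> V"
    by (rule coframe_expansion[OF c(2,1,3) that])
  show "B u v = (w 1 u * w 3 v + w 3 u * w 1 v) / 2 + (w 2 u * w 4 v + w 4 u * w 2 v) / 2"
    if "u \<in> V" "v \<in> V" using assms that by (simp add: null_diagonal_coframe_def)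
qed

text \<open>The form is positive on \<open>e\<^sub>1 + e\<^sub>3, e\<^sub>2 + e\<^sub>4\<close> and negative on \<open>e\<^sub>1 - e\<^sub>3, e\<^sub>2 - e\<^sub>4\<close>.\<close>

lemma null_diagonal_coframe_signature:
  assumes c: "null_diagonal_coframe V B w e"
  shows "has_signature V B 2 2"
proof -
  note d = null_diagonal_coframeD[OF c]
  define P where "P = span {e 1 + e 3, e 2 + e 4}"
  define N where "N = span {e 1 - e 3, e 2 - e 4}"
  have mP: "x \<in> P \<longleftrightarrow> (\<exists>a b. x = a *\<^sub>R (e 1 + e 3) + b *\<^sub>R (e 2 + e 4))" for x
    by (simp add: P_def mem_span_pair)
  have mN: "x \<in> N \<longleftrightarrow> (\<exists>a b. x = a *\<^sub>R (e 1 - e 3) + b *\<^sub>R (e 2 - e 4))" for x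
    by (simp add: N_def mem_span_pair)
  note in_V = subspace_add[OF d(1)] subspace_scale[OF d(1)] subspace_diff[OF d(1)]
  note simps = linear_within_add[OF d(3)] linear_within_scale[OF d(3)] linear_within_diff[OF d(3,1)]
    in_V d(2,4)
  have wP: "w 1 x = a \<and> w 2 x = b \<and> w 3 x = a \<and> w 4 x = b \<and> x \<in> V"
    if "x = a *\<^sub>R (e 1 + e 3) + b *\<^sub>R (e 2 + e 4)" for x a b
    by (simp add: that simps)
  have wN: "w 1 x = a \<and> w 2 x = b \<and> w 3 x = - a \<and> w 4 x = - b \<and> x \<in> V"
    if "x = a *\<^sub>R (e 1 - e 3) + b *\<^sub>R (e 2 - e 4)" for x a b
    by (simp add: that simps)
  have w0: "w i 0 = 0" for i using linear_within_zero[OF d(3,2)] .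
  have pos: "0 < a * a + b * b" if "a *\<^sub>R x + b *\<^sub>R y \<noteq> (0::real^5)" for a b x y
    using that by (auto simp: sum_squares_gt_zero_iff)
  show ?thesis
    unfolding has_signature_def
  proof (rule exI[of _ P], rule exI[of _ N], intro conjI ballI impI)
    show "subspace P" "subspace N" by (simp_all add: P_def N_def)
    show "dim P = 2" unfolding P_def by (rule dim_span_pair) (metis wP w0)
    show "dim N = 2" unfolding N_def by (rule dim_span_pair) (metis wN w0)
    show "V = {x + y |x y. x \<in> P \<and> y \<in> N}"
    proof (rule set_eqI, rule iffI)
      fix v assume v: "v \<in> V"
      define x where "x = ((w 1 v + w 3 v) / 2) *\<^sub>R (e 1 + e 3) + ((w 2 v + w 4 v) / 2) *\<^sub>R (e 2 + e 4)"
      define y where "y = ((w 1 v - w 3 v) / 2) *\<^sub>R (e 1 - e 3) + ((w 2 v - w 4 v) / 2) *\<^sub>R (e 2 - e 4)"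
      have "x + y = w 1 v *\<^sub>R e 1 + w 2 v *\<^sub>R e 2 + w 3 v *\<^sub>R e 3 + w 4 v *\<^sub>R e 4"
        by (simp add: x_def y_def vec_eq_iff field_simps)
      then have "v = x + y" using d(5)[OF v] by simp
      moreover have "x \<in> P" "y \<in> N" unfolding mP mN x_def y_def by blast+
      ultimately show "v \<in> {x + y |x y. x \<in> P \<and> y \<in> N}" by blast
    next
      fix v assume "v \<in> {x + y |x y. x \<in> P \<and> y \<in> N}"
      then show "v \<in> V" using mP mN wP wN in_V(1) by blast
    qed
    show "P \<inter> N = {0}"
    proof (intro equalityI subsetI)
      fix x assume "x \<in> P \<inter> N"
      then have "x \<in> P" "x \<in> N" by auto
      then obtain a b a' b' where ab: "x = a *\<^sub>R (e 1 + e 3) + b *\<^sub>R (e 2 + e 4)"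
        and ab': "x = a' *\<^sub>R (e 1 - e 3) + b' *\<^sub>R (e 2 - e 4)" unfolding mP mN by blast
      have "a = 0" "b = 0" using wP[OF ab] wN[OF ab'] by linarith+
      then show "x \<in> {0}" using ab by simp
    qed (simp add: P_def N_def span_0)
    fix x
    assume "x \<in> P" 
    then obtain a b where ab: "x = a *\<^sub>R (e 1 + e 3) + b *\<^sub>R (e 2 + e 4)" using mP by auto
    {
      assume "x \<noteq> 0"
      then show "0 < B x x" using d(6)[of x x] wP[OF ab] pos[of a _ b] ab by simp
    next
      fix y assume "y \<in> N"
      then obtain a' b' where ab': "y = a' *\<^sub>R (e 1 - e 3) + b' *\<^sub>R (e 2 - e 4)" using mN by auto
      show "B x y = 0" using d(6)[of x y] wP[OF ab] wN[OF ab'] by simp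
    }
  next
    fix y assume "y \<in> N" and 0: "y \<noteq> 0"
    then obtain a b where ab: "y = a *\<^sub>R (e 1 - e 3) + b *\<^sub>R (e 2 - e 4)" using mN by auto
    have "0 < a * a + b * b" by (rule pos) (use 0 ab in blast)
    then show "B y y < 0" using d(6)[of y y] wN[OF ab] by simp
  qed
qed

lemma has_signature_scale:
  assumes "has_signature V B k l" "h > 0" "\<And>u v. B' u v = h * B u v"
  shows "has_signature V B' k l"
proof -
  from assms(1) obtain P N where "subspace P" "subspace N" "dim P = k" "dim N = l"
    "V = {x + y |x y. x \<in> P \<and> y \<in> N}" "P \<inter> N = {0}"
    "\<forall>x\<in>P. x \<noteq> 0 \<longrightarrow> B x x > 0" "\<forall>y\<in>N. y \<noteq> 0 \<longrightarrow> B y y < 0" "\<forall>x\<in>P. \<forall>y\<in>N. B x y = 0"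
    unfolding has_signature_def by blast
  then show ?thesis
    unfolding has_signature_def assms(3)
    using assms(2) by - (rule exI[of _ P], rule exI[of _ N], simp add: mult_pos_neg)
qed

section \<open>Symplectic linear algebra in dimension four\<close>

locale symplectic_space =
  fixes V :: "(real ^ 5) set" and Om :: "real ^ 5 \<Rightarrow> real ^ 5 \<Rightarrow> real"
  assumes V: "subspace V" "dim V = 4"
    and bil: "bilinear Om"
    and alt: "Om u u = 0"
    and nondeg: "u \<in> V \<Longrightarrow> (\<And>v. v \<in> V \<Longrightarrow> Om u v = 0) \<Longrightarrow> u = 0"
begin

lemmas Om_simps = bilinear_ladd[OF bil] bilinear_radd[OF bil] bilinear_lmul[OF bil] bilinear_rmul[OF bil]
  bilinear_lneg[OF bil] bilinear_rneg[OF bil] bilinear_lsub[OF bil] bilinear_rsub[OF bil]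
  bilinear_lzero[OF bil] bilinear_rzero[OF bil]

lemmas in_V = subspace_0[OF V(1)] subspace_add[OF V(1)] subspace_scale[OF V(1)] subspace_diff[OF V(1)]
  subspace_neg[OF V(1)]

lemma skew: "Om u v = - Om v u"
  using alt[of "u + v"] alt[of u] alt[of v] by (simp add: Om_simps)

lemma nondegenerate_right: "v \<in> V \<Longrightarrow> (\<And>u. u \<in> V \<Longrightarrow> Om u v = 0) \<Longrightarrow> v = 0"
  using nondeg[of v] skew[of v] by simp

lemma nondegenerate_cancel:
  assumes "u \<in> V" "v \<in> V" "\<And>x. x \<in> V \<Longrightarrow> Om x u = Om x v"
  shows "u = v"
  using nondegenerate_right[of "u - v"] assms in_V(4) by (simp add: Om_simps)

lemma exists_nonzero_vector: "\<exists>v\<in>V. v \<noteq> 0"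
  using V by (metis dim_eq_0 subsetI singletonI zero_neq_numeral)

text \<open>The pointwise model of both geometries, and the object called \<open>J\<close> in the introduction: a
  para-complex structure that is anti-symplectic for \<open>s = 1\<close>, a symplectic complex structure for
  \<open>s = - 1\<close>.\<close>

definition conformal_operator :: "real \<Rightarrow> (real ^ 5 \<Rightarrow> real ^ 5) \<Rightarrow> bool" where
  "conformal_operator s K \<longleftrightarrow> linear_within V K \<and>
     (\<forall>u\<in>V. K u \<in> V \<and> K (K u) = s *\<^sub>R u) \<and> (\<forall>u\<in>V. \<forall>v\<in>V. Om (K u) (K v) = - s * Om u v)"

lemma conformal_operatorD:
  assumes "conformal_operator s K"
  shows "u \<in> V \<Longrightarrow> v \<in> V \<Longrightarrow> K (u + v) = K u + K v" "u \<in> V \<Longrightarrow> K (a *\<^sub>R u) = a *\<^sub>R K u"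
    "u \<in> V \<Longrightarrow> K u \<in> V" "u \<in> V \<Longrightarrow> K (K u) = s *\<^sub>R u"
    "u \<in> V \<Longrightarrow> v \<in> V \<Longrightarrow> Om (K u) (K v) = - s * Om u v"
    "u \<in> V \<Longrightarrow> v \<in> V \<Longrightarrow> K (u - v) = K u - K v"
proof -
  have l: "linear_within V K" using assms by (simp add: conformal_operator_def)
  show "u \<in> V \<Longrightarrow> v \<in> V \<Longrightarrow> K (u + v) = K u + K v" "u \<in> V \<Longrightarrow> K (a *\<^sub>R u) = a *\<^sub>R K u"
    "u \<in> V \<Longrightarrow> v \<in> V \<Longrightarrow> K (u - v) = K u - K v"
    using linear_within_add[OF l] linear_within_scale[OF l] linear_within_diff[OF l V(1)] by blast+
qed (use assms in \<open>auto simp: conformal_operator_def\<close>)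

lemma conformal_operator_skew:
  assumes K: "conformal_operator s K" and s: "s\<^sup>2 = 1" and uv: "u \<in> V" "v \<in> V"
  shows "Om (K u) v = - Om u (K v)"
proof -
  note d = conformal_operatorD[OF K]
  have "s * Om (K u) v = Om (K u) (K (K v))" using d(3,4) uv by (simp add: Om_simps)
  also have "\<dots> = - s * Om u (K v)" using d(3,5) uv by simp
  finally have "s * Om (K u) v = s * - Om u (K v)" by simp
  moreover have "s \<noteq> 0" using s by auto
  ultimately show ?thesis by (metis mult_left_cancel)
qed

lemma twisted_symmetric_bilinear:
  assumes K: "conformal_operator s K" and s: "s\<^sup>2 = 1" and B: "\<And>u v. u \<in> V \<Longrightarrow> v \<in> V \<Longrightarrow> B u v = h * Om u (K v)"
  shows "symmetric_bilinear_within V B"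
proof -
  note d = conformal_operatorD[OF K]
  have "Om u (K v) = Om v (K u)" if "u \<in> V" "v \<in> V" for u v
    using conformal_operator_skew[OF K s that] skew[of v "K u"] by simp
  then show ?thesis
    unfolding symmetric_bilinear_within_def linear_within_def
    using d(1,2) B in_V by (simp add: Om_simps algebra_simps)
qed

text \<open>Nondegeneracy gives \<open>K' = f K\<close>; comparing squares gives \<open>f\<^sup>2 = 1\<close>.\<close>

lemma conformal_operator_unique:
  assumes K: "conformal_operator s K" and K': "conformal_operator s K'" and s: "s\<^sup>2 = 1" and f: "f > 0"
    and eq: "\<And>u v. u \<in> V \<Longrightarrow> v \<in> V \<Longrightarrow> Om u (K' v) = f * Om u (K v)"
  shows "v \<in> V \<Longrightarrow> K' v = K v"
proof -
  note d = conformal_operatorD[OF K]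
  note d' = conformal_operatorD[OF K']
  have fK: "K' v = f *\<^sub>R K v" if v: "v \<in> V" for v
    by (rule nondegenerate_cancel) (use v d d' in_V eq in \<open>auto simp: Om_simps\<close>)
  obtain y where v: "y \<in> V" "y \<noteq> 0" using exists_nonzero_vector by blast
  have "s *\<^sub>R y = K' (K' y)" using d'(4) v by simp
  also have "\<dots> = f *\<^sub>R K (f *\<^sub>R K y)" using fK d' v by simp
  also have "\<dots> = (f * f * s) *\<^sub>R y" using d v by simp
  finally have "s = f * f * s" using v by simp
  then have "f * f = 1" using s by auto
  then have "f = 1" using f by (auto simp: square_eq_1_iff)
  then show "v \<in> V \<Longrightarrow> K' v = K v" using fK by simp
qed

text \<open>The pointwise content of \<^const>\<open>adapted_coframe\<close>.\<close>

definition adapted :: "(real ^ 5 \<Rightarrow> real ^ 5 \<Rightarrow> real) \<Rightarrow> (4 \<Rightarrow> real ^ 5 \<Rightarrow> real) \<Rightarrow> (4 \<Rightarrow> real ^ 5) \<Rightarrow> bool" where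
  "adapted B w e \<longleftrightarrow> null_diagonal_coframe V B w e \<and> (\<forall>t. lagrangian V Om (alpha_plane e t))"

lemma lagrangian_span_pair:
  assumes "x \<in> V" "y \<in> V" "Om x y = 0" "\<And>a b. a *\<^sub>R x + b *\<^sub>R y = 0 \<Longrightarrow> a = 0 \<and> b = 0"
  shows "lagrangian V Om (span {x, y})"
  unfolding lagrangian_def
proof (intro conjI ballI)
  show "span {x, y} \<subseteq> V" using assms V(1) span_minimal by (metis empty_subsetI insert_subset)
  show "dim (span {x, y}) = 2" using dim_span_pair assms(4) by blast
  fix u v assume "u \<in> span {x, y}" "v \<in> span {x, y}"
  then obtain a b c d where "u = a *\<^sub>R x + b *\<^sub>R y" "v = c *\<^sub>R x + d *\<^sub>R y"
    by (auto simp: mem_span_pair)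
  then show "Om u v = 0" using assms(3) skew[of y x] by (simp add: Om_simps alt)
qed simp

lemma adaptedI:
  assumes c: "null_diagonal_coframe V B w e"
    and Om: "Om (e 1) (e 4) = 0" "Om (e 2) (e 3) = 0" "Om (e 1) (e 3) = Om (e 2) (e 4)"
  shows "adapted B w e"
proof -
  note d = null_diagonal_coframeD[OF c]
  note simps = linear_within_add[OF d(3)] linear_within_scale[OF d(3)] linear_within_diff[OF d(3,1)]
    in_V d(2,4)
  have w0: "w i 0 = 0" for i using linear_within_zero[OF d(3,2)] .
  have "lagrangian V Om (alpha_plane e t)" for t
  proof (cases t)
    case None
    have "a = 0 \<and> b = 0" if "a *\<^sub>R e 2 + b *\<^sub>R e 3 = 0" for a b
    proof -
      have "w i (a *\<^sub>R e 2 + b *\<^sub>R e 3) = 0" for i using that w0 by simp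
      from this[of 2] this[of 3] show ?thesis by (simp add: simps)
    qed
    then show ?thesis using lagrangian_span_pair[of "e 2" "e 3"] d(2) Om None by simp
  next
    case (Some r)
    have "a = 0 \<and> b = 0" if "a *\<^sub>R (e 1 + r *\<^sub>R e 2) + b *\<^sub>R (r *\<^sub>R e 3 - e 4) = 0" for a b
    proof -
      have "w i (a *\<^sub>R (e 1 + r *\<^sub>R e 2) + b *\<^sub>R (r *\<^sub>R e 3 - e 4)) = 0" for i using that w0 by simp
      from this[of 1] this[of 4] show ?thesis by (simp add: simps)
    qed
    moreover have "Om (e 1 + r *\<^sub>R e 2) (r *\<^sub>R e 3 - e 4) = 0" by (simp add: Om_simps Om algebra_simps)
    ultimately show ?thesis using lagrangian_span_pair[of "e 1 + r *\<^sub>R e 2" "r *\<^sub>R e 3 - e 4"] Some in_V d(2) by simp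
  qed
  then show ?thesis using c by (simp add: adapted_def)
qed

text \<open>Isotropy of the plane with parameter \<open>t\<close> is the vanishing of
  \<open>t\<^sup>2 Om e\<^sub>2 e\<^sub>3 + t (Om e\<^sub>1 e\<^sub>3 - Om e\<^sub>2 e\<^sub>4) - Om e\<^sub>1 e\<^sub>4\<close>. The values \<open>0\<close>, \<open>1\<close> and \<open>\<infinity>\<close> of \<open>t\<close> determine
  its coefficients.\<close>

lemma adaptedD:
  assumes "adapted B w e"
  shows "Om (e 1) (e 4) = 0" "Om (e 2) (e 3) = 0" "Om (e 1) (e 3) = Om (e 2) (e 4)"
proof -
  have *: "Om (e 1 + t *\<^sub>R e 2) (t *\<^sub>R e 3 - e 4) = 0" for t
  proof -
    have "lagrangian V Om (alpha_plane e (Some t))" using assms unfolding adapted_def by blast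
    then show ?thesis unfolding lagrangian_def alpha_plane.simps by (meson span_base insertCI)
  qed
  have "lagrangian V Om (alpha_plane e None)" using assms unfolding adapted_def by blast
  then show 23: "Om (e 2) (e 3) = 0" unfolding lagrangian_def alpha_plane.simps by (meson span_base insertCI)
  show 14: "Om (e 1) (e 4) = 0" using *[of 0] by (simp add: Om_simps)
  show "Om (e 1) (e 3) = Om (e 2) (e 4)" using *[of 1] 14 23 by (simp add: Om_simps)
qed

lemma adapted_form:
  assumes a: "adapted B w e" and uv: "u \<in> V" "v \<in> V"
  shows "Om u v = Om (e 1) (e 2) * wedge (w 1) (w 2) u v
    + Om (e 1) (e 3) * (wedge (w 1) (w 3) u v + wedge (w 2) (w 4) u v)
    + Om (e 3) (e 4) * wedge (w 3) (w 4) u v"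
proof -
  have c: "null_diagonal_coframe V B w e" using a by (simp add: adapted_def)
  note d = null_diagonal_coframeD[OF c]
  have "Om u v = Om (w 1 u *\<^sub>R e 1 + w 2 u *\<^sub>R e 2 + w 3 u *\<^sub>R e 3 + w 4 u *\<^sub>R e 4)
    (w 1 v *\<^sub>R e 1 + w 2 v *\<^sub>R e 2 + w 3 v *\<^sub>R e 3 + w 4 v *\<^sub>R e 4)"
    using d(5)[OF uv(1)] d(5)[OF uv(2)] by metis
  also have "\<dots> = Om (e 1) (e 2) * wedge (w 1) (w 2) u v
    + Om (e 1) (e 3) * (wedge (w 1) (w 3) u v + wedge (w 2) (w 4) u v)
    + Om (e 3) (e 4) * wedge (w 3) (w 4) u v"
    using adaptedD[OF a] skew[of "e 2" "e 1"] skew[of "e 3" "e 1"] skew[of "e 4" "e 1"]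
      skew[of "e 3" "e 2"] skew[of "e 4" "e 2"] skew[of "e 4" "e 3"]
    by (simp add: Om_simps alt wedge_def algebra_simps)
  finally show ?thesis .
qed

text \<open>In block form with respect to \<open>(e\<^sub>1, e\<^sub>2)\<close> and \<open>(e\<^sub>3, e\<^sub>4)\<close>, and with \<open>\<epsilon>\<close> the rotation by a right
  angle, raising an index of \<open>Om\<close> gives \<open>S = 2 ((- b, c \<epsilon>), (a \<epsilon>, b))\<close>. Since \<open>\<epsilon>\<^sup>2 = - 1\<close>, the off-diagonal
  blocks of \<open>S\<^sup>2\<close> cancel and the diagonal ones are \<open>4 (b\<^sup>2 - a c)\<close>.\<close>

lemma coframe_operator:
  assumes c: "null_diagonal_coframe V B w e"
    and Om: "\<And>u v. u \<in> V \<Longrightarrow> v \<in> V \<Longrightarrow> Om u v = a * wedge (w 1) (w 2) u v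
      + b * (wedge (w 1) (w 3) u v + wedge (w 2) (w 4) u v) + c * wedge (w 3) (w 4) u v"
  obtains S where "\<And>v. v \<in> V \<Longrightarrow> S v \<in> V" "linear_within V S"
    "\<And>u v. u \<in> V \<Longrightarrow> v \<in> V \<Longrightarrow> B u (S v) = Om u v"
    "\<And>v. v \<in> V \<Longrightarrow> S (S v) = (4 * (b\<^sup>2 - a * c)) *\<^sub>R v"
proof
  note d = null_diagonal_coframeD[OF c]
  note simps = linear_within_add[OF d(3)] linear_within_scale[OF d(3)] in_V d(2,4)
  define S where "S v = (2 * (c * w 4 v - b * w 1 v)) *\<^sub>R e 1 + (- 2 * (b * w 2 v + c * w 3 v)) *\<^sub>R e 2
    + (2 * (a * w 2 v + b * w 3 v)) *\<^sub>R e 3 + (2 * (b * w 4 v - a * w 1 v)) *\<^sub>R e 4" for v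
  show S_V: "S v \<in> V" if "v \<in> V" for v by (simp add: S_def simps)
  have wS: "w 1 (S v) = 2 * (c * w 4 v - b * w 1 v)" "w 2 (S v) = - 2 * (b * w 2 v + c * w 3 v)"
    "w 3 (S v) = 2 * (a * w 2 v + b * w 3 v)" "w 4 (S v) = 2 * (b * w 4 v - a * w 1 v)" for v
    by (simp_all add: S_def simps)
  show "linear_within V S"
    by (auto simp: linear_within_def S_def linear_within_add[OF d(3)] linear_within_scale[OF d(3)] algebra_simps)
  show "B u (S v) = Om u v" if uv: "u \<in> V" "v \<in> V" for u v
    using d(6)[OF uv(1) S_V[OF uv(2)]] Om[OF uv] wS[of v] by (simp add: wedge_def field_simps)
  show "S (S v) = (4 * (b\<^sup>2 - a * c)) *\<^sub>R v" if "v \<in> V" for v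
  proof -
    have "S (S v) = (4 * (b\<^sup>2 - a * c)) *\<^sub>R (w 1 v *\<^sub>R e 1 + w 2 v *\<^sub>R e 2 + w 3 v *\<^sub>R e 3 + w 4 v *\<^sub>R e 4)"
      unfolding S_def[of "S v"] wS scaleR_add_right scaleR_scaleR
      by (simp add: algebra_simps power2_eq_square)
    then show ?thesis using d(5)[OF that] by simp
  qed
qed

text \<open>The operator \<open>S\<close> of \<open>coframe_operator\<close> is inverse to \<open>h K\<close>, so \<open>1 = h\<^sup>2 K\<^sup>2 S\<^sup>2 = 4 h\<^sup>2 s (b\<^sup>2 - a c)\<close>.\<close>

lemma type_of_twisted:
  assumes K: "conformal_operator s K" and s: "s\<^sup>2 = 1" and h: "h > 0"
    and B: "\<And>u v. u \<in> V \<Longrightarrow> v \<in> V \<Longrightarrow> B u v = h * Om u (K v)"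
    and c: "null_diagonal_coframe V B w e"
    and Om: "\<And>u v. u \<in> V \<Longrightarrow> v \<in> V \<Longrightarrow> Om u v = a * wedge (w 1) (w 2) u v
      + b * (wedge (w 1) (w 3) u v + wedge (w 2) (w 4) u v) + c * wedge (w 3) (w 4) u v"
  shows "sgn (b\<^sup>2 - a * c) = s"
proof -
  note d = conformal_operatorD[OF K]
  obtain S where S: "\<And>v. v \<in> V \<Longrightarrow> S v \<in> V" "linear_within V S"
    "\<And>u v. u \<in> V \<Longrightarrow> v \<in> V \<Longrightarrow> B u (S v) = Om u v"
    "\<And>v. v \<in> V \<Longrightarrow> S (S v) = (4 * (b\<^sup>2 - a * c)) *\<^sub>R v"
    using coframe_operator[OF c Om] by blast
  obtain v where v: "v \<in> V" "v \<noteq> 0" using exists_nonzero_vector by blast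
  have inv: "h *\<^sub>R K (S v) = v" if v: "v \<in> V" for v
    by (rule nondegenerate_cancel) (use v d S in_V B in \<open>auto simp: Om_simps\<close>)
  have "v = (h * h) *\<^sub>R K (K (S (S v)))"
    using inv[OF S(1)[OF v(1)]] inv[OF v(1)] d(2,3) S(1) v(1) by (metis scaleR_scaleR)
  also have "K (K (S (S v))) = s *\<^sub>R S (S v)" using d(4) S(1) v by simp
  also have "(h * h) *\<^sub>R (s *\<^sub>R S (S v)) = (h * h * s * (4 * (b\<^sup>2 - a * c))) *\<^sub>R v" using S(4) v by simp
  finally have "h * h * s * (4 * (b\<^sup>2 - a * c)) = 1" using v by (metis scaleR_cancel_right scaleR_one)
  then have eq: "(4 * (h * h)) * (s * (b\<^sup>2 - a * c)) = 1" by (simp add: algebra_simps)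
  have "0 < (4 * (h * h)) * (s * (b\<^sup>2 - a * c))" unfolding eq by simp
  then have "s * (b\<^sup>2 - a * c) > 0" by (rule zero_less_mult_pos) (use h in simp)
  then show ?thesis using s by (auto simp: power2_eq_1_iff sgn_if)
qed

text \<open>Let \<open>S\<close> be the operator of \<open>coframe_operator\<close> and \<open>f = 2 \<surd>\<bar>b\<^sup>2 - a c\<bar>\<close>, so that \<open>S\<^sup>2 = s f\<^sup>2\<close>. Then
  \<open>K = s S / f\<close> has square \<open>s\<close>, and \<open>Om(u, K v) = B(u, S K v) = f B(u, v)\<close>.\<close>

lemma exists_twisting_operator:
  assumes a: "adapted B w e" and s: "s\<^sup>2 = 1" and B: "symmetric_bilinear_within V B"
    and Om: "\<And>u v. u \<in> V \<Longrightarrow> v \<in> V \<Longrightarrow> Om u v = a * wedge (w 1) (w 2) u v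
      + b * (wedge (w 1) (w 3) u v + wedge (w 2) (w 4) u v) + c * wedge (w 3) (w 4) u v"
    and sgn: "sgn (b\<^sup>2 - a * c) = s"
  shows "\<exists>f K. f > 0 \<and> conformal_operator s K \<and> (\<forall>u. u \<notin> V \<longrightarrow> K u = 0) \<and>
    (\<forall>u\<in>V. \<forall>v\<in>V. Om u (K v) = f * B u v)"
proof -
  have c: "null_diagonal_coframe V B w e" using a by (simp add: adapted_def)
  obtain S where S: "\<And>v. v \<in> V \<Longrightarrow> S v \<in> V" "linear_within V S"
    "\<And>u v. u \<in> V \<Longrightarrow> v \<in> V \<Longrightarrow> B u (S v) = Om u v"
    "\<And>v. v \<in> V \<Longrightarrow> S (S v) = (4 * (b\<^sup>2 - a * c)) *\<^sub>R v"
    using coframe_operator[OF c Om] by blast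
  define f where "f = 2 * sqrt \<bar>b\<^sup>2 - a * c\<bar>"
  define K where "K v = (if v \<in> V then (s / f) *\<^sub>R S v else 0)" for v
  have "b\<^sup>2 - a * c \<noteq> 0" using sgn s by auto
  then have f: "f > 0" by (simp add: f_def)
  have ff: "4 * (b\<^sup>2 - a * c) = s * f * f" 
    using sgn mult_sgn_abs[of "b\<^sup>2 - a * c"] by (simp add: f_def algebra_simps)
  have SS: "S (S v) = (s * f * f) *\<^sub>R v" if "v \<in> V" for v
    using S(4)[OF that] unfolding ff .
  have lin: "linear_within V K"
    using S(2) by (auto simp: linear_within_def K_def in_V algebra_simps)
  have KV: "K u \<in> V" if "u \<in> V" for u using that S(1) in_V by (simp add: K_def)
  have KK: "K (K u) = s *\<^sub>R u" if "u \<in> V" for u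
  proof -
    have "K (K u) = (s / f * (s / f) * (s * f * f)) *\<^sub>R u"
      using that S(1) SS linear_within_scale[OF S(2)] in_V by (simp add: K_def)
    also have "s / f * (s / f) * (s * f * f) = s" using s f by (simp add: field_simps power2_eq_square)
    finally show ?thesis .
  qed
  have OmK: "Om u (K v) = f * B u v" if "u \<in> V" "v \<in> V" for u v
  proof -
    have "Om u (K v) = (s / f) * B u (S (S v))" using that S(1,3) by (simp add: K_def Om_simps)
    also have "\<dots> = (s / f) * (s * f * f) * B u v"
      using that SS symmetric_bilinear_withinD[OF B] by simp
    also have "(s / f) * (s * f * f) = f" using s f by (simp add: field_simps power2_eq_square)
    finally show ?thesis .
  qed
  have "Om (K u) (K v) = - s * Om u v" if uv: "u \<in> V" "v \<in> V" for u v
  proof -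
    have "Om (K u) (K v) = f * B (K u) v" using OmK KV uv by simp
    also have "\<dots> = f * B v (K u)" using B KV uv by (simp add: symmetric_bilinear_within_def)
    also have "\<dots> = Om v (K (K u))" using OmK KV uv by simp
    also have "\<dots> = s * Om v u" using KK uv by (simp add: Om_simps)
    finally show ?thesis using skew[of v u] by simp
  qed
  then have "conformal_operator s K" unfolding conformal_operator_def using lin KV KK by blast
  then show ?thesis using f OmK by (auto simp: K_def intro!: exI[of _ f] exI[of _ K])
qed

subsection \<open>Splittings into Lagrangian planes\<close>

text \<open>\<open>Om\<close> pairs \<open>L\<close> with \<open>L'\<close> perfectly, and a Gram-Schmidt process produces dual bases.\<close>

lemma symplectic_basis:
  assumes L: "lagrangian V Om L" and L': "lagrangian V Om L'" and sum: "V = {x + y |x y. x \<in> L \<and> y \<in> L'}"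
  obtains l1 l2 m1 m2 where "l1 \<in> L" "l2 \<in> L" "m1 \<in> L'" "m2 \<in> L'"
    "Om l1 m1 = 1" "Om l1 m2 = 0" "Om l2 m1 = 0" "Om l2 m2 = 1"
proof -
  have sub: "subspace L" "subspace L'" "L \<subseteq> V" "L' \<subseteq> V" "dim L = 2"
    and iso: "\<And>u v. u \<in> L \<Longrightarrow> v \<in> L \<Longrightarrow> Om u v = 0"
    using L L' by (auto simp: lagrangian_def)
  have partner: "\<exists>m\<in>L'. Om l m = 1" if l: "l \<in> L" "l \<noteq> 0" for l
  proof -
    obtain v where v: "v \<in> V" "Om l v \<noteq> 0" using nondeg[of l] l sub by blast
    then obtain x y where xy: "v = x + y" "x \<in> L" "y \<in> L'" using sum by blast
    then have "Om l y \<noteq> 0" using v iso[OF l(1)] by (simp add: Om_simps)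
    then have "Om l ((1 / Om l y) *\<^sub>R y) = 1" by (simp add: Om_simps)
    then show ?thesis using subspace_scale[OF sub(2) xy(3)] by blast
  qed
  have "\<not> L \<subseteq> {0}" using sub(5) dim_eq_0[of L] by simp
  then obtain l1 where l1: "l1 \<in> L" "l1 \<noteq> 0" by blast
  obtain m1 where m1: "m1 \<in> L'" "Om l1 m1 = 1" using partner[OF l1] by blast
  have "\<not> L \<subseteq> span {l1}"
  proof
    assume "L \<subseteq> span {l1}"
    then have "dim L \<le> card {l1}" by (intro dim_le_card) auto
    then show False using sub(5) by simp
  qed
  then obtain y where y: "y \<in> L" "y \<notin> span {l1}" by blast
  define l2 where "l2 = y - Om y m1 *\<^sub>R l1"
  have l2: "l2 \<in> L" using y l1 by (simp add: l2_def subspace_diff[OF sub(1)] subspace_scale[OF sub(1)])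
  have "l2 \<noteq> 0"
  proof
    assume "l2 = 0"
    then have "y = Om y m1 *\<^sub>R l1" by (simp add: l2_def)
    then show False using y(2) span_base[of l1 "{l1}"] span_scale by (metis insertI1)
  qed
  then obtain z where z: "z \<in> L'" "Om l2 z = 1" using partner[OF l2] by blast
  define m2 where "m2 = z - Om l1 z *\<^sub>R m1"
  have m2: "m2 \<in> L'" using z m1 by (simp add: m2_def subspace_diff[OF sub(2)] subspace_scale[OF sub(2)])
  have l2m1: "Om l2 m1 = 0" using m1 by (simp add: l2_def Om_simps)
  have "Om l1 m2 = 0" "Om l2 m2 = 1" using m1 z l2m1 by (simp_all add: m2_def Om_simps)
  then show ?thesis using that[OF l1(1) l2 m1(1) m2 m1(2)] l2m1 by blast
qed

text \<open>If \<open>L\<close> is isotropic and \<open>V = L + L'\<close>, then \<open>Om\<close> embeds \<open>L\<close> into the dual of \<open>L'\<close>.\<close>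

lemma isotropic_dim_le:
  assumes sub: "subspace L" "subspace L'" "L \<subseteq> V"
    and iso: "\<And>u v. u \<in> L \<Longrightarrow> v \<in> L \<Longrightarrow> Om u v = 0"
    and sum: "\<And>v. v \<in> V \<Longrightarrow> \<exists>x\<in>L. \<exists>y\<in>L'. v = x + y"
  shows "dim L \<le> dim L'"
proof -
  obtain Bs where Bs: "Bs \<subseteq> L'" "independent Bs" "L' \<subseteq> span Bs" "finite Bs"
    using basis_exists[of L'] finiteI_independent by metis
  define \<phi> where "\<phi> u = (\<Sum>y\<in>Bs. Om u y *\<^sub>R y)" for u
  have lin: "linear \<phi>"
    by (rule linearI) (simp_all add: \<phi>_def Om_simps scaleR_add_left sum.distrib scaleR_sum_right)
  have "inj_on \<phi> (span L)"
    unfolding linear_inj_on_iff_eq_0[OF lin subspace_span]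
  proof (intro ballI impI)
    fix u assume "u \<in> span L" and 0: "\<phi> u = 0"
    then have u: "u \<in> L" using span_minimal[OF subset_refl sub(1)] by blast
    have "Om u y = 0" if "y \<in> Bs" for y
      using Bs(2,4) 0 that unfolding \<phi>_def independent_explicit by blast
    then have "Bs \<subseteq> {y. Om u y = 0}" by blast
    moreover have "subspace {y. Om u y = 0}" by (auto simp: subspace_def Om_simps)
    ultimately have *: "Om u y = 0" if "y \<in> L'" for y using that Bs(3) span_minimal[of Bs] by blast
    show "u = 0"
    proof (rule nondeg)
      show "u \<in> V" using u sub(3) by blast
      fix v assume "v \<in> V"
      then obtain x y where "v = x + y" "x \<in> L" "y \<in> L'" using sum by blast
      then show "Om u v = 0" using * iso[OF u] by (simp add: Om_simps)
    qed
  qed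
  then have "dim L = dim (\<phi> ` L)" using dim_image_eq[OF lin] by metis
  also have "\<phi> ` L \<subseteq> L'"
    using Bs(1) by (auto simp: \<phi>_def intro!: subspace_sum[OF sub(2)] subspace_scale[OF sub(2)])
  then have "dim (\<phi> ` L) \<le> dim L'" by (rule dim_subset)
  finally show ?thesis .
qed

text \<open>Both eigenspaces are isotropic because \<open>K\<close> reverses the sign of \<open>Om\<close>. Each embeds into the dual of
  the other, so their dimensions agree.\<close>

lemma eigenspaces:
  assumes K: "conformal_operator 1 K"
  defines "Lm \<equiv> {v \<in> V. K v = - v}" and "Lp \<equiv> {v \<in> V. K v = v}"
  shows "lagrangian V Om Lm" "lagrangian V Om Lp" "V = {x + y |x y. x \<in> Lm \<and> y \<in> Lp}" "Lm \<inter> Lp = {0}"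
proof -
  note d = conformal_operatorD[OF K]
  have sub: "subspace Lm" "subspace Lp"
    using d(1,2) in_V d(2)[of 0 0] by (auto simp: subspace_def Lm_def Lp_def)
  have LV: "Lm \<subseteq> V" "Lp \<subseteq> V" by (auto simp: Lm_def Lp_def)
  have iso: "Om u v = 0" if "u \<in> Lm \<and> v \<in> Lm \<or> u \<in> Lp \<and> v \<in> Lp" for u v
    using d(5)[of u v] that by (auto simp: Lm_def Lp_def Om_simps)
  have split: "\<exists>x\<in>Lm. \<exists>y\<in>Lp. v = x + y" if v: "v \<in> V" for v
  proof (intro bexI)
    show "v = (1/2) *\<^sub>R (v - K v) + (1/2) *\<^sub>R (v + K v)" by (simp add: algebra_simps flip: scaleR_add_left)
    show "(1/2) *\<^sub>R (v - K v) \<in> Lm" "(1/2) *\<^sub>R (v + K v) \<in> Lp"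
      using v d(1,2,3,4,6) in_V by (simp_all add: Lm_def Lp_def flip: scaleR_minus_right)
  qed
  then have split': "\<exists>x\<in>Lp. \<exists>y\<in>Lm. v = x + y" if "v \<in> V" for v using that by (metis add.commute)
  show sum: "V = {x + y |x y. x \<in> Lm \<and> y \<in> Lp}" using split LV in_V(2) by blast
  have "x = 0" if "x \<in> Lm" "x \<in> Lp" for x
  proof -
    have "x = - x" using that by (simp add: Lm_def Lp_def)
    then show ?thesis by (metis add.right_inverse scaleR_2 scaleR_eq_0_iff zero_neq_numeral)
  qed
  then show int: "Lm \<inter> Lp = {0}" using sub subspace_0 by blast
  have "dim Lm + dim Lp = 4"
    using dim_sums_Int[OF sub] int sum V(2) by simp
  moreover have "dim Lm \<le> dim Lp" using isotropic_dim_le[OF sub LV(1) _ split] iso by blast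
  moreover have "dim Lp \<le> dim Lm" using isotropic_dim_le[OF sub(2,1) LV(2) _ split'] iso by blast
  ultimately show "lagrangian V Om Lm" "lagrangian V Om Lp"
    unfolding lagrangian_def using sub LV iso by auto
qed

text \<open>For dual bases \<open>l\<^sub>1, l\<^sub>2\<close> and \<open>m\<^sub>1, m\<^sub>2\<close> of the eigenspaces the metric is null on both and \<open>h\<close> times the
  pairing between them, so the basis is null-diagonal after rescaling the \<open>m\<^sub>i\<close>.\<close>

lemma adapted_coframe_para:
  assumes K: "conformal_operator 1 K" and h: "h > 0"
    and B: "\<And>u v. u \<in> V \<Longrightarrow> v \<in> V \<Longrightarrow> B u v = h * Om u (K v)"
  shows "\<exists>w e. adapted B w e"
proof -
  note d = conformal_operatorD[OF K]
  have sym: "symmetric_bilinear_within V B" by (rule twisted_symmetric_bilinear[OF K _ B]) simp_all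
  note E = eigenspaces[OF K]
  obtain l1 l2 m1 m2 where mem: "l1 \<in> {v \<in> V. K v = - v}" "l2 \<in> {v \<in> V. K v = - v}"
      "m1 \<in> {v \<in> V. K v = v}" "m2 \<in> {v \<in> V. K v = v}"
    and Om: "Om l1 m1 = 1" "Om l1 m2 = 0" "Om l2 m1 = 0" "Om l2 m2 = 1"
    by (rule symplectic_basis[OF E(1-3)])
  have lm: "l1 \<in> V" "K l1 = - l1" "l2 \<in> V" "K l2 = - l2" "m1 \<in> V" "K m1 = m1" "m2 \<in> V" "K m2 = m2"
    using mem by auto
  have iso: "Om l1 l2 = 0" "Om m1 m2 = 0" "Om m2 m1 = 0" 
    using d(5)[of l1 l2] d(5)[of m1 m2] d(5)[of m2 m1] lm by (auto simp: Om_simps)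
  define e where "e = four_frame l1 l2 ((1 / (2 * h)) *\<^sub>R m1) ((1 / (2 * h)) *\<^sub>R m2)"
  have e: "e 1 = l1" "e 2 = l2" "e 3 = (1 / (2 * h)) *\<^sub>R m1" "e 4 = (1 / (2 * h)) *\<^sub>R m2"
    by (simp_all add: e_def four_frame_def)
  have eV: "e i \<in> V" for i using lm in_V by (simp add: e_def four_frame_def)
  have "null_diagonal_coframe V B (\<lambda>i v. 2 * B (e (i + 2)) v) e"
    by (rule null_diagonal_coframeI[OF V sym eV])
      (use h in \<open>simp_all add: B eV e lm in_V d(2) Om_simps Om iso alt\<close>)
  then have "adapted B (\<lambda>i v. 2 * B (e (i + 2)) v) e"
    by (rule adaptedI) (simp_all add: e Om_simps Om)
  then show ?thesis by blast
qed

subsection \<open>Hermitian structures of split signature\<close>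

text \<open>The metric is Hermitian with respect to \<open>K\<close>. Take orthogonal complex lines spanned by a vector \<open>u\<close> of
  square \<open>1\<close> and a vector \<open>x\<close> of square \<open>- 1\<close>. Then \<open>n = u + x\<close> and \<open>m = u - x\<close> span null complex lines,
  which are made the \<open>\<alpha>\<close>-planes with parameters \<open>0\<close> and \<open>\<infinity>\<close>: they are \<open>\<langle>e\<^sub>1, e\<^sub>4\<rangle>\<close> and \<open>\<langle>e\<^sub>2, e\<^sub>3\<rangle>\<close>.\<close>

lemma adapted_coframe_hermitian:
  assumes K: "conformal_operator (- 1) K" and h: "h > 0"
    and B: "\<And>u v. u \<in> V \<Longrightarrow> v \<in> V \<Longrightarrow> B u v = h * Om u (K v)"
    and sig: "has_signature V B 2 2"
  shows "\<exists>w e. adapted B w e"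
proof -
  note d = conformal_operatorD[OF K]
  have sym: "symmetric_bilinear_within V B" by (rule twisted_symmetric_bilinear[OF K _ B]) simp_all
  have B_sym: "B u v = B v u" if "u \<in> V" "v \<in> V" for u v
    using sym that by (simp add: symmetric_bilinear_within_def)
  have B_add: "B (x + y) z = B x z + B y z" "B (x - y) z = B x z - B y z"
    "B z (x + y) = B z x + B z y" "B z (x - y) = B z x - B z y"
    if "x \<in> V" "y \<in> V" "z \<in> V" for x y z
    using that by (simp_all add: B in_V d Om_simps algebra_simps)
  have B_scale: "B (a *\<^sub>R x) z = a * B x z" "B z (a *\<^sub>R x) = a * B z x"
    if "x \<in> V" "z \<in> V" for x z a
    using that by (simp_all add: B in_V d Om_simps)
  note B_lin = B_add B_scale
  have B_inv: "B (K u) (K v) = B u v" if "u \<in> V" "v \<in> V" for u v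
    using that d(5)[of u "K v"] d(3) by (simp add: B)
  have B_Om: "B u (K v) = - h * Om u v" if "u \<in> V" "v \<in> V" for u v
    using that by (simp add: B d Om_simps)
  have B_skew: "B (K u) v = - B u (K v)" if "u \<in> V" "v \<in> V" for u v
    using that B_sym[of "K u" v] d(3) B_Om skew[of u v] by simp
  obtain P N where PN: "subspace P" "subspace N" "dim P = 2" "dim N = 2" "V = {x + y |x y. x \<in> P \<and> y \<in> N}"
    "\<forall>x\<in>P. x \<noteq> 0 \<longrightarrow> B x x > 0" "\<forall>y\<in>N. y \<noteq> 0 \<longrightarrow> B y y < 0"
    using sig unfolding has_signature_def by blast
  have PNV: "x \<in> V" if "x \<in> P \<union> N" for x
    using that PN(5) subspace_0[OF PN(1)] subspace_0[OF PN(2)] by force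
  have "\<not> P \<subseteq> {0}" "\<not> N \<subseteq> {0}" using PN(3,4) dim_eq_0[of P] dim_eq_0[of N] by auto
  then obtain u0 y where u0: "u0 \<in> P" "u0 \<noteq> 0" and y: "y \<in> N" "y \<noteq> 0" by blast
  have u0V: "u0 \<in> V" "y \<in> V" and pos: "B u0 u0 > 0" "B y y < 0" using u0 y PNV PN(6,7) by auto
  define u where "u = (1 / sqrt (B u0 u0)) *\<^sub>R u0"
  have uV: "u \<in> V" using u0V in_V by (simp add: u_def)
  have uu: "B u u = 1" using u0V pos in_V by (simp add: u_def B_lin field_simps)
  \<comment> \<open>Projecting a negative vector off the positive definite complex line of \<open>u\<close> keeps it negative.\<close>
  define x0 where "x0 = y - (B y u *\<^sub>R u + B y (K u) *\<^sub>R K u)"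
  have x0V: "x0 \<in> V" using u0V uV d(3) in_V by (simp add: x0_def)
  have uKu: "B u (K u) = 0" "B (K u) u = 0" "B (K u) (K u) = 1"
    using B_Om[OF uV uV] B_skew[OF uV uV] B_inv[OF uV uV] uu alt by auto
  have x0u: "B x0 u = 0" "B x0 (K u) = 0"
    using u0V uV d(3) in_V by (simp_all add: x0_def B_lin uu uKu)
  define q where "q = B y u *\<^sub>R u + B y (K u) *\<^sub>R K u"
  have q: "q \<in> V" "B x0 q = 0" and x0q: "x0 = y - q"
    using u0V uV x0V d(3) in_V x0u by (simp_all add: q_def B_lin) (simp add: x0_def q_def)
  have "B x0 x0 = B x0 (y - q)" using x0q by simp
  also have "\<dots> = B x0 y" using B_add(4)[OF u0V(2) q(1) x0V] q(2) by simp
  also have "\<dots> = B y y - (B y u * B y u + B y (K u) * B y (K u))"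
    using u0V uV d(3) in_V B_sym by (simp add: x0_def B_lin)
  finally have neg: "B x0 x0 < 0" using pos(2) by (smt (verit) zero_le_square)
  define x where "x = (1 / sqrt (- B x0 x0)) *\<^sub>R x0"
  have xV: "x \<in> V" using x0V in_V by (simp add: x_def)
  have xx: "B x x = - 1" using x0V neg in_V by (simp add: x_def B_lin field_simps)
  have xu': "B x u = 0" "B x (K u) = 0"
    using x0u x0V uV d(3) by (simp_all add: x_def B_lin)
  have xu: "B x u = 0" "B u x = 0" "B x (K u) = 0" "B u (K x) = 0"
    using xu' B_sym[of u x] B_sym[of "K u" x] B_skew[of u x] uV xV d(3) by simp_all
  define n where "n = u + x"
  define m where "m = u - x"
  have nmV: "n \<in> V" "m \<in> V" using uV xV in_V by (simp_all add: n_def m_def)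
  have nm: "B n n = 0" "B m m = 0" "B n m = 2" "B n (K m) = 0"
    using uV xV in_V d(3) B_Om[of x x] alt
    by (simp_all add: n_def m_def B_lin d(1,6) uu xx xu uKu)
  have nm': "B m n = 2" "B m (K n) = 0" "B (K m) n = 0" "B (K m) m = 0" "B n (K n) = 0" "B m (K m) = 0"
    "B (K m) (K n) = 2" "B (K n) (K n) = 0" "B (K m) (K m) = 0"
    using nm nmV B_sym[of m n] B_inv[of m n] B_inv[of n n] B_inv[of m m] B_skew[of m n] B_skew[of n m] B_sym[of "K m" n] d(3)
      B_Om[of n n] B_Om[of m m] B_skew[of m m] alt by auto
  define e where "e = four_frame n ((1/2) *\<^sub>R K m) ((1/4) *\<^sub>R m) ((1/2) *\<^sub>R K n)"
  have e: "e 1 = n" "e 2 = (1/2) *\<^sub>R K m" "e 3 = (1/4) *\<^sub>R m" "e 4 = (1/2) *\<^sub>R K n"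
    by (simp_all add: e_def four_frame_def)
  have eV: "e i \<in> V" for i using nmV d(3) in_V by (simp add: e_def four_frame_def)
  have c: "null_diagonal_coframe V B (\<lambda>i v. 2 * B (e (i + 2)) v) e"
    by (rule null_diagonal_coframeI[OF V sym eV])
      (simp_all add: e B_lin nmV d(3) in_V nm nm')
  have Om: "Om n m = 0" "Om n (K n) = 0" "Om (K m) m = 0" "Om (K m) (K n) = 0"
    using B_Om[OF nmV] B[OF nmV(1,1)] B[OF nmV(2,2)] d(5)[OF nmV(2,1)] nm skew[of "K m" m] skew[of n m] h by auto
  have "adapted B (\<lambda>i v. 2 * B (e (i + 2)) v) e"
    by (rule adaptedI[OF c]) (simp_all add: e Om_simps Om)
  then show ?thesis by blast
qed

end

section \<open>Charts, smooth functions and smooth vector fields\<close>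

locale smooth_manifold =
  fixes A :: "('m::t2_space) chart set"
  assumes atlas: "smooth_atlas A"
begin

abbreviation jac :: "'m chart \<Rightarrow> 'm chart \<Rightarrow> real ^ 5 \<Rightarrow> real ^ 5 \<Rightarrow> real ^ 5" where
  "jac c d x \<equiv> frechet_derivative (transition c d) (at x)"

lemma chart_open: "c \<in> A \<Longrightarrow> open (fst c)"
  and chart_homeomorphism: "c \<in> A \<Longrightarrow> homeomorphism (fst c) (snd c ` fst c) (snd c) (chart_inv c)"
  and transition_smooth: "c \<in> A \<Longrightarrow> d \<in> A \<Longrightarrow> smooth_on (snd c ` (fst c \<inter> fst d)) (transition c d)"
  using atlas by (auto simp: smooth_atlas_def)

lemma chart_at: "chart_at A p \<in> A" "p \<in> fst (chart_at A p)"
proof -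
  have "p \<in> (\<Union>c\<in>A. fst c)" using atlas by (simp add: smooth_atlas_def)
  then have "\<exists>c. c \<in> A \<and> p \<in> fst c" by blast
  then have "chart_at A p \<in> A \<and> p \<in> fst (chart_at A p)" unfolding chart_at_def by (rule someI_ex)
  then show "chart_at A p \<in> A" "p \<in> fst (chart_at A p)" by auto
qed

lemma chart_inv_chart: "c \<in> A \<Longrightarrow> p \<in> fst c \<Longrightarrow> chart_inv c (snd c p) = p"
  using chart_homeomorphism homeomorphism_apply1 by blast

lemma chart_image_open:
  assumes c: "c \<in> A" and W: "open W"
  shows "open (snd c ` (fst c \<inter> W))"
proof -
  have "openin (top_of_set (fst c)) (fst c \<inter> W)" using W by (simp add: openin_open_Int)
  then have "openin (top_of_set (snd c ` fst c)) (snd c ` (fst c \<inter> W))"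
    using homeomorphism_imp_open_map[OF chart_homeomorphism[OF c]] by blast
  moreover have "open (snd c ` fst c)" using atlas c by (simp add: smooth_atlas_def)
  ultimately show ?thesis using openin_open_trans by blast
qed

lemma chart_range_open: "c \<in> A \<Longrightarrow> open (snd c ` fst c)"
  using atlas by (simp add: smooth_atlas_def)

lemma transition_chart: "c \<in> A \<Longrightarrow> p \<in> fst c \<Longrightarrow> transition c d (snd c p) = snd d p"
  by (simp add: transition_def chart_inv_chart)

lemma transition_has_derivative:
  assumes "c \<in> A" "d \<in> A" "p \<in> fst c" "p \<in> fst d"
  shows "(transition c d has_derivative jac c d (snd c p)) (at (snd c p))"
  by (rule smooth_on_has_derivative[OF transition_smooth]) (use assms in auto)

lemma jac_linear:
  assumes "c \<in> A" "d \<in> A" "p \<in> fst c" "p \<in> fst d"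
  shows "linear (jac c d (snd c p))"
  using transition_has_derivative[OF assms] has_derivative_linear by blast

text \<open>The transition rules for components of tangent vectors all come from this one, because
  \<^const>\<open>to_chart\<close> and \<^const>\<open>from_chart\<close> are Jacobians from and to the reference chart.\<close>

lemma jac_chain:
  assumes A: "c \<in> A" "d \<in> A" "e \<in> A" and p: "p \<in> fst c" "p \<in> fst d" "p \<in> fst e"
  shows "jac d e (snd d p) (jac c d (snd c p) u) = jac c e (snd c p) u"
proof -
  let ?S = "snd c ` (fst c \<inter> (fst d \<inter> fst e))"
  have S: "open ?S" "snd c p \<in> ?S"
    using chart_image_open[OF A(1) open_Int[OF chart_open[OF A(2)] chart_open[OF A(3)]]] p by simp_all
  have "((\<lambda>x. transition d e (transition c d x)) has_derivative
      (\<lambda>u. jac d e (snd d p) (jac c d (snd c p) u))) (at (snd c p))"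
    by (rule has_derivative_compose[OF transition_has_derivative[OF A(1,2) p(1,2)]])
      (use transition_has_derivative[OF A(2,3) p(2,3)] A p in \<open>simp add: transition_chart\<close>)
  then have "(transition c e has_derivative
      (\<lambda>u. jac d e (snd d p) (jac c d (snd c p) u))) (at (snd c p))"
    by (rule has_derivative_transform_within_open[OF _ S]) (use A in \<open>auto simp: transition_chart\<close>)
  then show ?thesis by (metis frechet_derivative_at)
qed

lemma jac_self:
  assumes c: "c \<in> A" "p \<in> fst c"
  shows "jac c c (snd c p) u = u"
proof -
  have "(transition c c has_derivative (\<lambda>x. x)) (at (snd c p))"
    by (rule has_derivative_transform_within_open[OF has_derivative_ident chart_range_open[OF c(1)]])
      (use c in \<open>auto simp: transition_chart\<close>)
  then show ?thesis by (metis frechet_derivative_at)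
qed

lemma to_chart_jac: "to_chart A c p = jac (chart_at A p) c (snd (chart_at A p) p)"
  by (simp add: to_chart_def)

lemma from_chart_jac: "from_chart A c p = jac c (chart_at A p) (snd c p)"
  by (simp add: from_chart_def)

lemma to_chart_linear: "c \<in> A \<Longrightarrow> p \<in> fst c \<Longrightarrow> linear (to_chart A c p)"
  unfolding to_chart_jac by (rule jac_linear) (auto simp: chart_at)

lemma from_chart_linear: "c \<in> A \<Longrightarrow> p \<in> fst c \<Longrightarrow> linear (from_chart A c p)"
  unfolding from_chart_jac by (rule jac_linear) (auto simp: chart_at)

lemma to_chart_from_chart:
  "c \<in> A \<Longrightarrow> d \<in> A \<Longrightarrow> p \<in> fst c \<Longrightarrow> p \<in> fst d \<Longrightarrow>
    to_chart A d p (from_chart A c p u) = jac c d (snd c p) u"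
  unfolding to_chart_jac from_chart_jac by (rule jac_chain) (auto simp: chart_at)

lemma from_chart_jac_chain:
  "c \<in> A \<Longrightarrow> d \<in> A \<Longrightarrow> p \<in> fst c \<Longrightarrow> p \<in> fst d \<Longrightarrow>
    from_chart A d p (jac c d (snd c p) u) = from_chart A c p u"
  unfolding from_chart_jac by (rule jac_chain) (auto simp: chart_at)

lemma from_chart_to_chart:
  assumes "c \<in> A" "p \<in> fst c"
  shows "from_chart A c p (to_chart A c p u) = u"
  unfolding to_chart_jac from_chart_jac
  using jac_chain[of "chart_at A p" c "chart_at A p" p u] jac_self[of "chart_at A p" p u] assms chart_at[of p]
  by simp

subsection \<open>Smooth functions\<close>

lemma smooth_function_onI:
  assumes "\<And>c. c \<in> A \<Longrightarrow> smooth_on (snd c ` (fst c \<inter> W)) (\<lambda>x. f (chart_inv c x))"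
  shows "smooth_function_on A W f"
  using assms by (simp add: smooth_function_on_def comp_def)

lemma smooth_function_onD:
  "smooth_function_on A W f \<Longrightarrow> c \<in> A \<Longrightarrow> smooth_on (snd c ` (fst c \<inter> W)) (\<lambda>x. f (chart_inv c x))"
  by (simp add: smooth_function_on_def comp_def)

lemma chart_inv_mem: "c \<in> A \<Longrightarrow> x \<in> snd c ` (fst c \<inter> W) \<Longrightarrow> chart_inv c x \<in> fst c \<inter> W"
  by (elim imageE) (simp add: chart_inv_chart)

lemma smooth_function_on_cong:
  assumes W: "open W" and eq: "\<And>p. p \<in> W \<Longrightarrow> f p = g p" and f: "smooth_function_on A W f"
  shows "smooth_function_on A W g"
proof (rule smooth_function_onI)
  fix c assume c: "c \<in> A"
  show "smooth_on (snd c ` (fst c \<inter> W)) (\<lambda>x. g (chart_inv c x))"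
    by (rule smooth_on_cong[OF chart_image_open[OF c W] _ smooth_function_onD[OF f c]])
      (use eq chart_inv_mem[OF c] in blast)
qed

lemma smooth_function_on_subset: "smooth_function_on A W f \<Longrightarrow> W' \<subseteq> W \<Longrightarrow> smooth_function_on A W' f"
  unfolding smooth_function_on_def by (meson Int_mono image_mono order_refl smooth_on_subset)

lemma smooth_function_on_const: "smooth_function_on A W (\<lambda>_. k)"
  by (rule smooth_function_onI) (rule smooth_on_const)

lemma smooth_function_on_local:
  assumes "\<And>p. p \<in> W \<Longrightarrow> \<exists>W'. open W' \<and> p \<in> W' \<and> smooth_function_on A W' f"
  shows "smooth_function_on A W f"
proof (rule smooth_function_onI)
  fix c assume c: "c \<in> A"
  show "smooth_on (snd c ` (fst c \<inter> W)) (\<lambda>x. f (chart_inv c x))"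
  proof (rule smooth_on_local)
    fix x assume "x \<in> snd c ` (fst c \<inter> W)"
    then obtain p where p: "x = snd c p" "p \<in> fst c" "p \<in> W" by blast
    then obtain W' where W': "open W'" "p \<in> W'" "smooth_function_on A W' f" using assms by blast
    then show "\<exists>T. open T \<and> x \<in> T \<and> smooth_on T (\<lambda>x. f (chart_inv c x))"
      using chart_image_open[OF c W'(1)] smooth_function_onD[OF W'(3) c] p by blast
  qed
qed

lemma smooth_function_on_mult:
  assumes W: "open W" and f: "smooth_function_on A W f" and g: "smooth_function_on A W g"
  shows "smooth_function_on A W (\<lambda>p. f p * g p)"
proof (rule smooth_function_onI)
  fix c assume c: "c \<in> A"
  show "smooth_on (snd c ` (fst c \<inter> W)) (\<lambda>x. f (chart_inv c x) * g (chart_inv c x))"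
    by (rule smooth_on_mult[OF chart_image_open[OF c W] smooth_function_onD[OF f c] smooth_function_onD[OF g c]])
qed

lemma smooth_function_on_inverse:
  assumes W: "open W" and 0: "\<And>p. p \<in> W \<Longrightarrow> f p \<noteq> 0" and f: "smooth_function_on A W f"
  shows "smooth_function_on A W (\<lambda>p. inverse (f p))"
proof (rule smooth_function_onI)
  fix c assume c: "c \<in> A"
  show "smooth_on (snd c ` (fst c \<inter> W)) (\<lambda>x. inverse (f (chart_inv c x)))"
    by (rule smooth_on_inverse[OF chart_image_open[OF c W] _ smooth_function_onD[OF f c]])
      (use 0 chart_inv_mem[OF c] in blast)
qed

lemma smooth_function_on_sqrt:
  assumes W: "open W" and pos: "\<And>p. p \<in> W \<Longrightarrow> f p > 0" and f: "smooth_function_on A W f"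
  shows "smooth_function_on A W (\<lambda>p. sqrt (f p))"
proof (rule smooth_function_onI)
  fix c assume c: "c \<in> A"
  show "smooth_on (snd c ` (fst c \<inter> W)) (\<lambda>x. sqrt (f (chart_inv c x)))"
    by (rule smooth_on_sqrt[OF chart_image_open[OF c W] _ smooth_function_onD[OF f c]])
      (use pos chart_inv_mem[OF c] in blast)
qed

lemma smooth_function_on_sum:
  assumes W: "open W" and f: "\<And>i. i \<in> I \<Longrightarrow> smooth_function_on A W (f i)"
  shows "smooth_function_on A W (\<lambda>p. \<Sum>i\<in>I. f i p)"
proof (rule smooth_function_onI)
  fix c assume c: "c \<in> A"
  show "smooth_on (snd c ` (fst c \<inter> W)) (\<lambda>x. \<Sum>i\<in>I. f i (chart_inv c x))"
    by (rule smooth_on_sum[OF chart_image_open[OF c W] smooth_function_onD[OF f c]])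
qed

lemma smooth_function_on_prod:
  assumes W: "open W" and f: "\<And>i. i \<in> I \<Longrightarrow> smooth_function_on A W (f i)"
  shows "smooth_function_on A W (\<lambda>p. \<Prod>i\<in>I. f i p)"
proof (rule smooth_function_onI)
  fix c assume c: "c \<in> A"
  show "smooth_on (snd c ` (fst c \<inter> W)) (\<lambda>x. \<Prod>i\<in>I. f i (chart_inv c x))"
    by (rule smooth_on_prod[OF chart_image_open[OF c W] smooth_function_onD[OF f c]])
qed

lemma smooth_function_on_det:
  fixes G :: "'n::finite \<Rightarrow> 'n \<Rightarrow> 'm \<Rightarrow> real"
  assumes "open W" "\<And>i j. smooth_function_on A W (G i j)"
  shows "smooth_function_on A W (\<lambda>p. det (\<chi> i j. G i j p))"
  unfolding det_def
  by (intro smooth_function_on_sum smooth_function_on_mult smooth_function_on_const smooth_function_on_prod assms(1))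
    (simp add: assms(2))

lemma smooth_function_on_continuous:
  assumes W: "open W" and f: "smooth_function_on A W f"
  shows "continuous_on W f"
proof (rule continuous_at_imp_continuous_on, rule)
  fix p assume p: "p \<in> W"
  let ?c = "chart_at A p"
  let ?U = "fst ?c \<inter> W"
  have c: "?c \<in> A" and pc: "p \<in> fst ?c" using chart_at by auto
  have "continuous_on ?U (\<lambda>q. f (chart_inv ?c (snd ?c q)))"
  proof (rule continuous_on_compose2[where g = "\<lambda>x. f (chart_inv ?c x)" and f = "snd ?c"])
    show "continuous_on (snd ?c ` ?U) (\<lambda>x. f (chart_inv ?c x))"
      by (rule smooth_on_imp_continuous_on[OF smooth_function_onD[OF f c]])
    show "continuous_on ?U (snd ?c)"
      using chart_homeomorphism[OF c] homeomorphism_cont1 continuous_on_subset by blast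
  qed simp
  then have "continuous_on ?U f"
    by (rule continuous_on_eq) (simp add: chart_inv_chart[OF c])
  moreover have "open ?U" using W chart_open[OF c] by blast
  ultimately show "isCont f p" using p pc by (simp add: continuous_on_eq_continuous_at)
qed

lemma smooth_function_on_nonzero_open:
  assumes W: "open W" and f: "smooth_function_on A W f"
  shows "open {p \<in> W. f p \<noteq> 0}"
proof -
  have "open (W \<inter> f -` (- {0}))"
    by (rule continuous_open_preimage[OF smooth_function_on_continuous[OF W f] W]) auto
  then show ?thesis by (simp add: vimage_def Int_def)
qed

subsection \<open>Smooth vector fields\<close>

lemma smooth_vector_field_onI:
  assumes "\<And>c. c \<in> A \<Longrightarrow> smooth_on (snd c ` (fst c \<inter> W)) (\<lambda>x. to_chart A c (chart_inv c x) (X (chart_inv c x)))"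
  shows "smooth_vector_field_on A W X"
  using assms by (simp add: smooth_vector_field_on_def)

lemma smooth_vector_field_onD:
  "smooth_vector_field_on A W X \<Longrightarrow> c \<in> A \<Longrightarrow>
    smooth_on (snd c ` (fst c \<inter> W)) (\<lambda>x. to_chart A c (chart_inv c x) (X (chart_inv c x)))"
  by (simp add: smooth_vector_field_on_def)

lemma smooth_vector_field_on_cong:
  assumes W: "open W" and eq: "\<And>p. p \<in> W \<Longrightarrow> X p = Y p" and X: "smooth_vector_field_on A W X"
  shows "smooth_vector_field_on A W Y"
proof (rule smooth_vector_field_onI)
  fix c assume c: "c \<in> A"
  have eq': "X (chart_inv c x) = Y (chart_inv c x)" if "x \<in> snd c ` (fst c \<inter> W)" for x
    using eq chart_inv_mem[OF c that] by blast
  show "smooth_on (snd c ` (fst c \<inter> W)) (\<lambda>x. to_chart A c (chart_inv c x) (Y (chart_inv c x)))"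
    by (rule smooth_on_cong[OF chart_image_open[OF c W] _ smooth_vector_field_onD[OF X c]]) (simp add: eq')
qed

lemma smooth_vector_field_on_subset:
  "smooth_vector_field_on A W X \<Longrightarrow> W' \<subseteq> W \<Longrightarrow> smooth_vector_field_on A W' X"
  unfolding smooth_vector_field_on_def by (meson Int_mono image_mono order_refl smooth_on_subset)

lemma smooth_vector_field_on_local:
  assumes "\<And>p. p \<in> W \<Longrightarrow> \<exists>W'. open W' \<and> p \<in> W' \<and> smooth_vector_field_on A W' X"
  shows "smooth_vector_field_on A W X"
proof (rule smooth_vector_field_onI)
  fix c assume c: "c \<in> A"
  show "smooth_on (snd c ` (fst c \<inter> W)) (\<lambda>x. to_chart A c (chart_inv c x) (X (chart_inv c x)))"
  proof (rule smooth_on_local)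
    fix x assume "x \<in> snd c ` (fst c \<inter> W)"
    then obtain p where p: "x = snd c p" "p \<in> fst c" "p \<in> W" by blast
    then obtain W' where W': "open W'" "p \<in> W'" "smooth_vector_field_on A W' X" using assms by blast
    then show "\<exists>T. open T \<and> x \<in> T \<and> smooth_on T (\<lambda>x. to_chart A c (chart_inv c x) (X (chart_inv c x)))"
      using chart_image_open[OF c W'(1)] smooth_vector_field_onD[OF W'(3) c] p by blast
  qed
qed

lemma smooth_vector_field_on_linear_combination:
  assumes W: "open W" and k: "\<And>i. i \<in> I \<Longrightarrow> smooth_function_on A W (k i)"
    and X: "\<And>i. i \<in> I \<Longrightarrow> smooth_vector_field_on A W (X i)"
  shows "smooth_vector_field_on A W (\<lambda>p. \<Sum>i\<in>I. k i p *\<^sub>R X i p)"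
proof (rule smooth_vector_field_onI)
  fix c assume c: "c \<in> A"
  let ?S = "snd c ` (fst c \<inter> W)"
  have S: "open ?S" by (rule chart_image_open[OF c W])
  have "smooth_on ?S (\<lambda>x. \<Sum>i\<in>I. k i (chart_inv c x) *\<^sub>R to_chart A c (chart_inv c x) (X i (chart_inv c x)))"
    by (intro smooth_on_sum smooth_on_scaleR S smooth_function_onD[OF k c] smooth_vector_field_onD[OF X c])
  then show "smooth_on ?S (\<lambda>x. to_chart A c (chart_inv c x) (\<Sum>i\<in>I. k i (chart_inv c x) *\<^sub>R X i (chart_inv c x)))"
  proof (rule smooth_on_cong[OF S, rotated])
    fix x assume "x \<in> ?S"
    then have l: "linear (to_chart A c (chart_inv c x))" using to_chart_linear[OF c] chart_inv_mem[OF c] by blast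
    show "(\<Sum>i\<in>I. k i (chart_inv c x) *\<^sub>R to_chart A c (chart_inv c x) (X i (chart_inv c x)))
      = to_chart A c (chart_inv c x) (\<Sum>i\<in>I. k i (chart_inv c x) *\<^sub>R X i (chart_inv c x))"
      by (simp add: linear_sum[OF l] linear_scale[OF l])
  qed
qed

lemma smooth_vector_field_on_scale:
  "open W \<Longrightarrow> smooth_function_on A W k \<Longrightarrow> smooth_vector_field_on A W X \<Longrightarrow>
    smooth_vector_field_on A W (\<lambda>p. k p *\<^sub>R X p)"
  using smooth_vector_field_on_linear_combination[of W "{()}" "\<lambda>_. k" "\<lambda>_. X"] by simp

lemma smooth_vector_field_on_add:
  assumes W: "open W" and X: "smooth_vector_field_on A W X" and Y: "smooth_vector_field_on A W Y"
  shows "smooth_vector_field_on A W (\<lambda>p. X p + Y p)"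
proof -
  have "smooth_vector_field_on A W (\<lambda>p. \<Sum>b\<in>UNIV. (\<lambda>_. 1) p *\<^sub>R (if b then X else Y) p)"
    by (rule smooth_vector_field_on_linear_combination[OF W smooth_function_on_const]) (simp add: X Y)
  then show ?thesis by (simp add: UNIV_bool add.commute)
qed

text \<open>A vector field that is smooth in one chart is smooth in all others, because its components
  transform with the Jacobian of a smooth transition map.\<close>

lemma smooth_vector_field_on_chart:
  assumes c: "c \<in> A" and W: "open W" "W \<subseteq> fst c" and \<xi>: "smooth_on (snd c ` W) \<xi>"
  shows "smooth_vector_field_on A W (\<lambda>q. from_chart A c q (\<xi> (snd c q)))"
proof (rule smooth_vector_field_onI)
  fix d assume d: "d \<in> A"
  let ?S = "snd d ` (fst d \<inter> W)"
  let ?\<tau> = "transition d c"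
  let ?T = "snd c ` (fst c \<inter> (fst d \<inter> W))"
  have S: "open ?S" by (rule chart_image_open[OF d W(1)])
  have T: "open ?T" using chart_image_open[OF c] chart_open[OF d] W(1) by blast
  have ST: "?\<tau> ` ?S \<subseteq> ?T" 
  proof (rule image_subsetI, elim imageE IntE)
    fix x q assume "x = snd d q" "q \<in> fst d" "q \<in> W"
    then show "?\<tau> x \<in> ?T" using W(2) by (intro image_eqI[of _ _ q]) (auto simp: transition_chart[OF d])
  qed
  have \<tau>: "smooth_on ?S ?\<tau>" by (rule smooth_on_subset[OF transition_smooth[OF d c]]) (use W(2) in auto)
  have "smooth_on ?T (\<lambda>y. \<Sum>i\<in>Basis. (\<xi> y \<bullet> i) *\<^sub>R jac c d y i)"
  proof (intro smooth_on_sum smooth_on_scaleR T)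
    fix i :: "real ^ 5"
    show "smooth_on ?T (\<lambda>y. \<xi> y \<bullet> i)"
      by (rule smooth_on_bounded_linear[OF T bounded_linear_inner_left smooth_on_subset[OF \<xi>]]) auto
    show "smooth_on ?T (\<lambda>y. jac c d y i)"
      by (rule smooth_on_subset[OF smooth_on_frechet_derivative[OF transition_smooth[OF c d]]]) auto
  qed
  then have "smooth_on ?S (\<lambda>x. \<Sum>i\<in>Basis. (\<xi> (?\<tau> x) \<bullet> i) *\<^sub>R jac c d (?\<tau> x) i)"
    by (rule smooth_on_compose[OF S T ST \<tau>])
  then show "smooth_on ?S (\<lambda>x. to_chart A d (chart_inv d x)
      (from_chart A c (chart_inv d x) (\<xi> (snd c (chart_inv d x)))))"
  proof (rule smooth_on_cong[OF S, rotated])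
    fix x assume "x \<in> ?S"
    then obtain q where q: "x = snd d q" "q \<in> fst d" "q \<in> W" by blast
    then have qc: "q \<in> fst c" using W(2) by blast
    show "(\<Sum>i\<in>Basis. (\<xi> (?\<tau> x) \<bullet> i) *\<^sub>R jac c d (?\<tau> x) i)
      = to_chart A d (chart_inv d x) (from_chart A c (chart_inv d x) (\<xi> (snd c (chart_inv d x))))"
      using linear_expansion[OF jac_linear[OF c d qc q(2)], of "\<xi> (snd c q)"]
      by (simp add: q chart_inv_chart[OF d] transition_chart[OF d] to_chart_from_chart[OF c d qc])
  qed
qed

end

section \<open>The exterior derivative in charts\<close>

locale contact_manifold = smooth_manifold A for A :: "('m::t2_space) chart set" +
  fixes \<omega> :: "'m \<Rightarrow> real ^ 5 \<Rightarrow> real"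
  assumes contact: "contact_form A \<omega>"
begin

abbreviation \<Delta> :: "'m \<Rightarrow> (real ^ 5) set" where "\<Delta> \<equiv> contact_distribution \<omega>"
abbreviation \<Omega> :: "'m \<Rightarrow> real ^ 5 \<Rightarrow> real ^ 5 \<Rightarrow> real" where "\<Omega> \<equiv> ext_deriv A \<omega>"

abbreviation component :: "'m chart \<Rightarrow> real ^ 5 \<Rightarrow> real ^ 5 \<Rightarrow> real" where
  "component c a \<equiv> form_component A c \<omega> a"

text \<open>The components of the exterior derivative in an arbitrary chart, whereas \<^const>\<open>ext_deriv\<close> uses
  the reference chart of the point, which may jump from point to point.\<close>

definition chart_ext_deriv :: "'m chart \<Rightarrow> real ^ 5 \<Rightarrow> real ^ 5 \<Rightarrow> real ^ 5 \<Rightarrow> real" where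
  "chart_ext_deriv c x a b =
     frechet_derivative (component c b) (at x) a - frechet_derivative (component c a) (at x) b"

lemma form_linear: "linear (\<omega> p)"
  and comp_smooth: "c \<in> A \<Longrightarrow> smooth_on (snd c ` fst c) (component c a)"
  using contact by (auto simp: contact_form_def smooth_one_form_def)

lemma form_nonzero: "\<exists>v. \<omega> p v \<noteq> 0"
proof -
  have "\<omega> p \<noteq> (\<lambda>_. 0)" using contact by (simp add: contact_form_def)
  then show ?thesis by (simp add: fun_eq_iff)
qed

lemma comp_chart: "c \<in> A \<Longrightarrow> p \<in> fst c \<Longrightarrow> component c a (snd c p) = \<omega> p (from_chart A c p a)"
  by (simp add: form_component_def chart_inv_chart)

lemma comp_linear:
  assumes "c \<in> A" "x \<in> snd c ` fst c"
  shows "linear (\<lambda>a. component c a x)"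
proof -
  obtain p where p: "x = snd c p" "p \<in> fst c" using assms by blast
  have "linear (\<omega> p \<circ> from_chart A c p)"
    using linear_compose[OF from_chart_linear[OF assms(1) p(2)] form_linear] .
  then show ?thesis using p by (simp add: comp_chart[OF assms(1)] comp_def)
qed

lemma comp_has_derivative:
  assumes "c \<in> A" "x \<in> snd c ` fst c"
  shows "(component c a has_derivative frechet_derivative (component c a) (at x)) (at x)"
  by (rule smooth_on_has_derivative[OF comp_smooth]) (use assms in auto)

lemma comp_derivative_linear:
  assumes c: "c \<in> A" and x: "x \<in> snd c ` fst c"
  shows "linear (frechet_derivative (component c a) (at x))" "linear (\<lambda>a. frechet_derivative (component c a) (at x) b)"
proof -
  show "linear (frechet_derivative (component c a) (at x))"
    using comp_has_derivative[OF assms] has_derivative_linear by blast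
  note S = chart_range_open[OF c]
  show "linear (\<lambda>a. frechet_derivative (component c a) (at x) b)"
  proof (rule linearI)
    fix a a' :: "real ^ 5" and k :: real
    have "(component c (a + a') has_derivative
        (\<lambda>b. frechet_derivative (component c a) (at x) b + frechet_derivative (component c a') (at x) b)) (at x)"
      by (rule has_derivative_transform_within_open[OF has_derivative_add[OF
          comp_has_derivative[OF assms, of a] comp_has_derivative[OF assms, of a']] S x])
        (simp add: linear_add[OF comp_linear[OF c]])
    from frechet_derivative_at[OF this]
    show "frechet_derivative (component c (a + a')) (at x) b =
        frechet_derivative (component c a) (at x) b + frechet_derivative (component c a') (at x) b"
      by metis
    have "(component c (k *\<^sub>R a) has_derivative (\<lambda>b. k *\<^sub>R frechet_derivative (component c a) (at x) b)) (at x)"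
      by (rule has_derivative_transform_within_open[OF has_derivative_scaleR_right[OF
          comp_has_derivative[OF assms, of a]] S x])
        (simp add: linear_scale[OF comp_linear[OF c]])
    from frechet_derivative_at[OF this]
    show "frechet_derivative (component c (k *\<^sub>R a)) (at x) b = k *\<^sub>R frechet_derivative (component c a) (at x) b"
      by metis
  qed
qed

lemma chart_ext_deriv_bilinear:
  assumes "c \<in> A" "x \<in> snd c ` fst c"
  shows "bilinear (chart_ext_deriv c x)"
  unfolding bilinear_def chart_ext_deriv_def
  using comp_derivative_linear[OF assms] by (auto intro!: linear_compose_sub)

lemma comp_change_of_chart:
  assumes c: "c \<in> A" "d \<in> A" and p: "p \<in> fst c" "p \<in> fst d"
  shows "component c a (snd c p) = component d (jac c d (snd c p) a) (snd d p)"
  using c p by (simp add: comp_chart from_chart_jac_chain)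

text \<open>Under a change of chart \<open>\<tau>\<close> the derivative of the component \<open>\<omega>(v)\<close> in direction \<open>u\<close> acquires the
  extra term \<open>\<omega>(D\<^sup>2\<tau>(u, v))\<close>. It is symmetric in \<open>u\<close> and \<open>v\<close> and cancels in the exterior derivative.\<close>

lemma chart_ext_deriv_change_of_chart:
  assumes c: "c \<in> A" "d \<in> A" and p: "p \<in> fst c" "p \<in> fst d"
  shows "chart_ext_deriv c (snd c p) u v =
    chart_ext_deriv d (snd d p) (jac c d (snd c p) u) (jac c d (snd c p) v)"
proof -
  let ?\<tau> = "transition c d"
  let ?S = "snd c ` (fst c \<inter> fst d)"
  let ?x = "snd c p" and ?y = "snd d p"
  let ?J = "jac c d ?x"
  define H where "H a b = frechet_derivative (\<lambda>x. jac c d x a) (at ?x) b" for a b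
  have S: "open ?S" "?x \<in> ?S" using chart_image_open[OF c(1) chart_open[OF c(2)]] p by auto
  have \<tau>: "smooth_on ?S ?\<tau>" by (rule transition_smooth[OF c])
  have H_sym: "H a b = H b a" for a b
    unfolding H_def by (rule symmetric_second_derivative[OF S \<tau>])
  have y: "?y \<in> snd d ` fst d" using p by blast
  have D: "frechet_derivative (component c a) (at ?x) b =
      frechet_derivative (component d (?J a)) (at ?y) (?J b) + component d (H a b) ?y" for a b
  proof -
    have \<tau>': "(?\<tau> has_derivative ?J) (at ?x)" by (rule transition_has_derivative[OF c p])
    have comp_i: "((\<lambda>x. component d i (?\<tau> x)) has_derivative (\<lambda>b. frechet_derivative (component d i) (at ?y) (?J b))) (at ?x)" for i
      by (rule has_derivative_compose[OF \<tau>']) 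
        (use comp_has_derivative[OF c(2) y] in \<open>simp add: transition_chart[OF c(1) p(1)]\<close>)
    have J_i: "((\<lambda>x. jac c d x a \<bullet> i) has_derivative (\<lambda>b. H a b \<bullet> i)) (at ?x)" for i
      unfolding H_def
      by (rule bounded_linear.has_derivative[OF bounded_linear_inner_left
          smooth_on_has_derivative[OF smooth_on_frechet_derivative[OF \<tau>] S(2)]])
    have "((\<lambda>x. \<Sum>i\<in>Basis. (jac c d x a \<bullet> i) * component d i (?\<tau> x)) has_derivative
        (\<lambda>b. \<Sum>i\<in>Basis. (?J a \<bullet> i) * frechet_derivative (component d i) (at ?y) (?J b) + (H a b \<bullet> i) * component d i (?\<tau> ?x))) (at ?x)"
      by (intro has_derivative_sum has_derivative_mult J_i comp_i)
    then have "(component c a has_derivative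
        (\<lambda>b. \<Sum>i\<in>Basis. (?J a \<bullet> i) * frechet_derivative (component d i) (at ?y) (?J b) + (H a b \<bullet> i) * component d i (?\<tau> ?x))) (at ?x)"
    proof (rule has_derivative_transform_within_open[OF _ S])
      fix x assume "x \<in> ?S"
      then obtain q where q: "x = snd c q" "q \<in> fst c" "q \<in> fst d" by blast
      have "component d (jac c d x a) (snd d q) = (\<Sum>i\<in>Basis. (jac c d x a \<bullet> i) * component d i (snd d q))"
        using linear_expansion[OF comp_linear[OF c(2)], of "snd d q" "jac c d x a"] q by simp
      then show "(\<Sum>i\<in>Basis. (jac c d x a \<bullet> i) * component d i (?\<tau> x)) = component c a x"
        using q comp_change_of_chart[OF c q(2,3)] by (simp add: transition_chart[OF c(1)])
    qed
    from fun_cong[OF frechet_derivative_at[OF this], of b]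
    have "frechet_derivative (component c a) (at ?x) b =
      (\<Sum>i\<in>Basis. (?J a \<bullet> i) * frechet_derivative (component d i) (at ?y) (?J b)) + (\<Sum>i\<in>Basis. (H a b \<bullet> i) * component d i ?y)"
      by (simp add: sum.distrib transition_chart[OF c(1) p(1)])
    then show ?thesis
      using linear_expansion[OF comp_derivative_linear(2)[OF c(2) y], of "?J a" "?J b"]
        linear_expansion[OF comp_linear[OF c(2) y], of "H a b"] by simp
  qed
  show ?thesis unfolding chart_ext_deriv_def D H_sym[of v u] by simp
qed

lemma ext_deriv_chart:
  assumes c: "c \<in> A" "p \<in> fst c"
  shows "\<Omega> p u v = chart_ext_deriv c (snd c p) (to_chart A c p u) (to_chart A c p v)"
proof -
  have "\<Omega> p u v = chart_ext_deriv (chart_at A p) (snd (chart_at A p) p) u v"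
    by (simp add: ext_deriv_def chart_ext_deriv_def Let_def)
  then show ?thesis
    using chart_ext_deriv_change_of_chart[OF chart_at(1) c(1) chart_at(2) c(2)] by (simp add: to_chart_jac)
qed

lemma ext_deriv_bilinear: "bilinear (\<Omega> p)"
proof -
  have "bilinear (chart_ext_deriv (chart_at A p) (snd (chart_at A p) p))"
    by (rule chart_ext_deriv_bilinear) (auto simp: chart_at)
  moreover have "\<Omega> p = chart_ext_deriv (chart_at A p) (snd (chart_at A p) p)"
    by (auto simp: fun_eq_iff ext_deriv_def chart_ext_deriv_def Let_def)
  ultimately show ?thesis by simp
qed

lemma smooth_ext_deriv:
  assumes W: "open W" and X: "smooth_vector_field_on A W X" and Y: "smooth_vector_field_on A W Y"
  shows "smooth_function_on A W (\<lambda>p. \<Omega> p (X p) (Y p))"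
proof (rule smooth_function_onI)
  fix c assume c: "c \<in> A"
  let ?S = "snd c ` (fst c \<inter> W)"
  let ?X = "\<lambda>x. to_chart A c (chart_inv c x) (X (chart_inv c x))"
  let ?Y = "\<lambda>x. to_chart A c (chart_inv c x) (Y (chart_inv c x))"
  have S: "open ?S" by (rule chart_image_open[OF c W])
  have comp_i: "smooth_on ?S (\<lambda>x. Z x \<bullet> i)" if "smooth_on ?S Z" for Z :: "real ^ 5 \<Rightarrow> real ^ 5" and i
    by (rule smooth_on_bounded_linear[OF S bounded_linear_inner_left that])
  have d: "smooth_on ?S (\<lambda>x. chart_ext_deriv c x i j)" for i j
    unfolding chart_ext_deriv_def
    by (intro smooth_on_diff S smooth_on_subset[OF smooth_on_frechet_derivative[OF comp_smooth[OF c]]]) auto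
  have "smooth_on ?S (\<lambda>x. \<Sum>i\<in>Basis. \<Sum>j\<in>Basis. (?X x \<bullet> i) * ((?Y x \<bullet> j) * chart_ext_deriv c x i j))"
    by (intro smooth_on_sum smooth_on_mult S comp_i d smooth_vector_field_onD[OF X c] smooth_vector_field_onD[OF Y c])
  then show "smooth_on ?S (\<lambda>x. \<Omega> (chart_inv c x) (X (chart_inv c x)) (Y (chart_inv c x)))"
  proof (rule smooth_on_cong[OF S, rotated])
    fix x assume "x \<in> ?S"
    then obtain p where p: "x = snd c p" "p \<in> fst c" "p \<in> W" by blast
    have b: "bilinear (chart_ext_deriv c x)" by (rule chart_ext_deriv_bilinear[OF c]) (use p in blast)
    have l: "linear (\<lambda>a. chart_ext_deriv c x a b)" "linear (chart_ext_deriv c x a)" for a b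
      using b by (auto simp: bilinear_def)
    have "\<Omega> p (X p) (Y p) = chart_ext_deriv c x (?X x) (?Y x)"
      using p by (simp add: ext_deriv_chart[OF c] chart_inv_chart[OF c])
    also have "\<dots> = (\<Sum>i\<in>Basis. (?X x \<bullet> i) * chart_ext_deriv c x i (?Y x))"
      using linear_expansion[OF l(1)[of "?Y x"], of "?X x"] by simp
    also have "\<dots> = (\<Sum>i\<in>Basis. \<Sum>j\<in>Basis. (?X x \<bullet> i) * ((?Y x \<bullet> j) * chart_ext_deriv c x i j))"
      by (simp only: linear_expansion[OF l(2), of _ "?Y x"] sum_distrib_left real_scaleR_def)
    finally show "(\<Sum>i\<in>Basis. \<Sum>j\<in>Basis. (?X x \<bullet> i) * ((?Y x \<bullet> j) * chart_ext_deriv c x i j))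
      = \<Omega> (chart_inv c x) (X (chart_inv c x)) (Y (chart_inv c x))"
      using p by (simp add: chart_inv_chart[OF c])
  qed
qed

section \<open>The contact distribution\<close>

lemma distribution_dim: "dim (\<Delta> p) = 4"
proof -
  define a where "a = adjoint (\<omega> p) 1"
  have lin: "\<omega> p v = a \<bullet> v" for v
    using adjoint_works[OF form_linear[of p], of v 1] by (simp add: a_def inner_commute)
  have "a \<noteq> 0"
  proof
    assume "a = 0"
    then show False using lin form_nonzero[of p] by simp
  qed
  moreover have "\<Delta> p = {v. a \<bullet> v = 0}" using lin by (simp add: contact_distribution_def)
  ultimately show ?thesis using dim_hyperplane[of a] by simp
qed

sublocale symplectic: symplectic_space "\<Delta> p" "\<Omega> p" for p
proof
  show "subspace (\<Delta> p)"
    unfolding contact_distribution_def using linear_subspace_kernel[OF form_linear] .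
  show "dim (\<Delta> p) = 4" by (rule distribution_dim)
  show "bilinear (\<Omega> p)" by (rule ext_deriv_bilinear)
  show "\<Omega> p u u = 0" for u by (simp add: ext_deriv_def Let_def)
  show "u = 0" if "u \<in> \<Delta> p" "\<And>v. v \<in> \<Delta> p \<Longrightarrow> \<Omega> p u v = 0" for u
    using contact that unfolding contact_form_def by blast
qed

definition frame_on :: "'m set \<Rightarrow> (4 \<Rightarrow> 'm \<Rightarrow> real ^ 5) \<Rightarrow> bool" where
  "frame_on W F \<longleftrightarrow> open W \<and> (\<forall>i. smooth_vector_field_on A W (F i)) \<and>
     (\<forall>q\<in>W. span (range (\<lambda>i. F i q)) = \<Delta> q)"

lemma frame_onD:
  assumes "frame_on W F"
  shows "open W" "smooth_vector_field_on A W (F i)" "q \<in> W \<Longrightarrow> span (range (\<lambda>i. F i q)) = \<Delta> q"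
    "q \<in> W \<Longrightarrow> F i q \<in> \<Delta> q"
proof -
  show "open W" "smooth_vector_field_on A W (F i)" "q \<in> W \<Longrightarrow> span (range (\<lambda>i. F i q)) = \<Delta> q"
    using assms by (auto simp: frame_on_def)
  then show "q \<in> W \<Longrightarrow> F i q \<in> \<Delta> q" using span_base[of "F i q" "range (\<lambda>i. F i q)"] by blast
qed

text \<open>If \<open>\<omega> = \<Sum>\<^sub>i f\<^sub>i dx\<^sup>i\<close> in a chart and \<open>f\<^sub>k\<close> does not vanish, then the fields \<open>f\<^sub>k \<partial>\<^sub>i - f\<^sub>i \<partial>\<^sub>k\<close> with \<open>i \<noteq> k\<close>
  form a frame of the kernel.\<close>

lemma local_frame: "\<exists>W F. p \<in> W \<and> frame_on W F"
proof -
  define c where "c = chart_at A p"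
  have c: "c \<in> A" "p \<in> fst c" unfolding c_def by (simp_all add: chart_at)
  define f where "f i x = component c (axis i 1) x" for i :: 5 and x
  have f_smooth: "smooth_on (snd c ` fst c) (f i)" for i
    unfolding f_def by (rule comp_smooth[OF c(1)])
  have "\<exists>k. f k (snd c p) \<noteq> 0"
  proof (rule ccontr)
    assume "\<nexists>k. f k (snd c p) \<noteq> 0"
    then have z: "component c i (snd c p) = 0" if "i \<in> Basis" for i
      using that by (auto simp: f_def Basis_vec_def)
    have "\<omega> p v = 0" for v
    proof -
      have "\<omega> p v = component c (to_chart A c p v) (snd c p)"
        using c by (simp add: comp_chart from_chart_to_chart)
      also have "\<dots> = 0"
        using linear_expansion[OF comp_linear[OF c(1)], of "snd c p" "to_chart A c p v"] c(2) z by simp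
      finally show ?thesis .
    qed
    then show False using form_nonzero[of p] by simp
  qed
  then obtain k where k: "f k (snd c p) \<noteq> 0" by blast
  define W where "W = {q \<in> fst c. component c (axis k 1) (snd c q) \<noteq> 0}"
  have W: "W \<subseteq> fst c" "p \<in> W" using c k by (auto simp: W_def f_def)
  have W_open: "open W"
  proof -
    have "continuous_on (fst c) (\<lambda>q. f k (snd c q))"
      using continuous_on_compose2[OF smooth_on_imp_continuous_on[OF f_smooth]
          homeomorphism_cont1[OF chart_homeomorphism[OF c(1)]]] by simp
    then have "open (fst c \<inter> (\<lambda>q. f k (snd c q)) -` (- {0}))"
      by (rule continuous_open_preimage[OF _ chart_open[OF c(1)]]) auto
    then show ?thesis by (simp add: W_def f_def vimage_def Int_def)
  qed
  have "card (UNIV :: 4 set) = card (UNIV - {k})" by simp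
  then obtain \<beta> where \<beta>: "bij_betw \<beta> (UNIV :: 4 set) (UNIV - {k})"
    using finite_same_card_bij[of "UNIV :: 4 set" "UNIV - {k}"] by auto
  then have \<beta>': "\<beta> i \<noteq> k" "\<beta> i = \<beta> j \<longleftrightarrow> i = j" for i j
    by (auto simp: bij_betw_def inj_on_def)
  define \<xi> where "\<xi> j x = f k x *\<^sub>R axis (\<beta> j) 1 - f (\<beta> j) x *\<^sub>R (axis k 1 :: real ^ 5)" for j x
  define F where "F j q = from_chart A c q (\<xi> j (snd c q))" for j q
  have "smooth_vector_field_on A W (F j)" for j
    unfolding F_def \<xi>_def
  proof (rule smooth_vector_field_on_chart[OF c(1) W_open W(1)])
    have S: "open (snd c ` W)" using chart_image_open[OF c(1) W_open] W(1) by (simp add: Int_absorb1)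
    have "smooth_on (snd c ` W) (f i)" for i
      by (rule smooth_on_subset[OF f_smooth]) (use W(1) in blast)
    then show "smooth_on (snd c ` W) (\<lambda>x. f k x *\<^sub>R axis (\<beta> j) 1 - f (\<beta> j) x *\<^sub>R (axis k 1 :: real ^ 5))"
      by (intro smooth_on_diff smooth_on_scaleR S smooth_on_const)
  qed
  moreover have "span (range (\<lambda>i. F i q)) = \<Delta> q" if q: "q \<in> W" for q
  proof (rule dual_family_span)
    let ?w = "\<lambda>i v. to_chart A c q v $ \<beta> i / f k (snd c q)"
    have qc: "q \<in> fst c" and fk: "f k (snd c q) \<noteq> 0" using q by (auto simp: W_def f_def)
    show "subspace (\<Delta> q)" "dim (\<Delta> q) = 4" by (rule symplectic.V)+
    show "linear_within (\<Delta> q) (?w i)" for i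
      using to_chart_linear[OF c(1) qc]
      by (simp add: linear_within_def linear_add linear_scale add_divide_distrib)
    have "to_chart A c q (F j q) = \<xi> j (snd c q)" for j
      using to_chart_from_chart[OF c(1) c(1) qc qc] jac_self[OF c(1) qc] by (simp add: F_def)
    then show "?w i (F j q) = (if i = j then 1 else 0)" for i j
      using \<beta>' fk by (simp add: \<xi>_def axis_def)
    show "F j q \<in> \<Delta> q" for j
    proof -
      have l: "linear (\<lambda>a. component c a (snd c q))" by (rule comp_linear[OF c(1)]) (use qc in blast)
      have "\<omega> q (F j q) = component c (\<xi> j (snd c q)) (snd c q)" using qc by (simp add: F_def comp_chart[OF c(1)])
      also have "\<dots> = 0" by (simp add: \<xi>_def linear_diff[OF l] linear_scale[OF l] f_def)
      finally show ?thesis by (simp add: contact_distribution_def)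
    qed
  qed
  ultimately have "frame_on W F" using W_open by (simp add: frame_on_def)
  then show ?thesis using W(2) by blast
qed

text \<open>A vector in the kernel of the Gram matrix gives a combination of the frame that pairs to zero with
  all of the distribution.\<close>

lemma frame_gram_det:
  assumes F: "frame_on W F" and q: "q \<in> W"
  shows "det (\<chi> i j. \<Omega> q (F i q) (F j q)) \<noteq> 0"
proof -
  let ?G = "\<chi> i j. \<Omega> q (F i q) (F j q)"
  let ?F = "\<lambda>i. F i q"
  note d = frame_onD[OF F]
  have span: "span (range ?F) = \<Delta> q" by (rule d(3)[OF q])
  have card: "card (range ?F) \<le> 4" using card_image_le[of "UNIV :: 4 set" ?F] by simp
  have ind: "independent (range ?F)"
    by (rule card_le_dim_spanning[of _ "\<Delta> q"]) (use d(4)[OF q] span card distribution_dim in auto)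
  have "card (range ?F) = 4"
    using ind dim_span_eq_card_independent span distribution_dim by metis
  then have inj: "inj ?F" using eq_card_imp_inj_on[of "UNIV :: 4 set" ?F] by simp
  have "x = 0" if "?G *v x = 0" for x
  proof -
    define z where "z = (\<Sum>j\<in>UNIV. x $ j *\<^sub>R F j q)"
    have zV: "z \<in> \<Delta> q" unfolding z_def
      by (intro subspace_sum subspace_scale symplectic.V(1) d(4)[OF q])
    have l: "linear (\<Omega> q u)" "linear (\<lambda>u. \<Omega> q u v)" for u v
      using ext_deriv_bilinear by (auto simp: bilinear_def)
    have "\<Omega> q (F i q) z = (?G *v x) $ i" for i
      by (simp add: z_def linear_sum[OF l(1)] linear_scale[OF l(1)] matrix_vector_mult_def mult.commute)
    then have "range ?F \<subseteq> {u. \<Omega> q u z = 0}" using that by auto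
    then have "\<Delta> q \<subseteq> {u. \<Omega> q u z = 0}"
      using span_minimal[OF _ linear_subspace_kernel[OF l(2)]] span by metis
    then have "z = 0" using symplectic.nondegenerate_right[OF zV] by blast
    then have "(\<Sum>b\<in>range ?F. x $ (inv ?F b) *\<^sub>R b) = 0"
      by (simp add: z_def sum.reindex[OF inj] inv_f_f[OF inj])
    moreover have "\<forall>c. (\<Sum>b\<in>range ?F. c b *\<^sub>R b) = 0 \<longrightarrow> (\<forall>b\<in>range ?F. c b = 0)"
      using ind unfolding independent_explicit by simp
    ultimately have "x $ (inv ?F b) = 0" if "b \<in> range ?F" for b
      using that by (metis (no_types))
    then have "x $ i = 0" for i using inv_f_f[OF inj, of i] by (metis rangeI)
    then show ?thesis by (simp add: vec_eq_iff)
  qed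
  then have "invertible ?G" 
    unfolding invertible_left_inverse matrix_left_invertible_ker by blast
  then show ?thesis by (simp add: invertible_det_nz)
qed

text \<open>Smoothness of a section of the contact distribution can be tested by pairing with a frame:
  by Cramer's rule its coefficients are rational expressions in these pairings and in the Gram
  matrix of the frame.\<close>

lemma smooth_section_test:
  assumes F: "frame_on W F" and Z: "\<And>q. q \<in> W \<Longrightarrow> Z q \<in> \<Delta> q"
    and b: "\<And>i. smooth_function_on A W (\<lambda>q. \<Omega> q (F i q) (Z q))"
  shows "smooth_vector_field_on A W Z"
proof -
  note d = frame_onD[OF F]
  define G where "G q = (\<chi> i j. \<Omega> q (F i q) (F j q))" for q
  define k where "k j q = det (\<chi> i l. if l = j then \<Omega> q (F i q) (Z q) else \<Omega> q (F i q) (F l q))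
      * inverse (det (G q))" for j q
  have "smooth_function_on A W (k j)" for j
    unfolding k_def
  proof (intro smooth_function_on_mult smooth_function_on_inverse smooth_function_on_det d(1))
    show "smooth_function_on A W (\<lambda>q. if l = j then \<Omega> q (F i q) (Z q) else \<Omega> q (F i q) (F l q))" for i l
      using b smooth_ext_deriv[OF d(1,2,2)] by (cases "l = j") simp_all
    show "smooth_function_on A W (\<lambda>q. det (G q))"
      unfolding G_def by (intro smooth_function_on_det d(1) smooth_ext_deriv d(2))
    show "det (G q) \<noteq> 0" if "q \<in> W" for q using frame_gram_det[OF F that] by (simp add: G_def)
  qed
  then have "smooth_vector_field_on A W (\<lambda>q. \<Sum>j\<in>UNIV. k j q *\<^sub>R F j q)"
    by (intro smooth_vector_field_on_linear_combination d(1,2))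
  then show ?thesis
  proof (rule smooth_vector_field_on_cong[OF d(1), rotated])
    fix q assume q: "q \<in> W"
    have l: "linear (\<Omega> q u)" for u using ext_deriv_bilinear by (auto simp: bilinear_def)
    have "Z q \<in> span (range (\<lambda>i. F i q))" using Z[OF q] d(3)[OF q] by blast
    then obtain x where x: "Z q = (\<Sum>i\<in>UNIV. x i *\<^sub>R F i q)"
      using span_range_sum by blast
    have "(G q *v (\<chi> i. x i)) $ i = \<Omega> q (F i q) (Z q)" for i
      by (simp add: G_def x linear_sum[OF l] linear_scale[OF l] matrix_vector_mult_def mult.commute)
    then have "det (\<chi> i l. if l = j then \<Omega> q (F i q) (Z q) else G q $ i $ l) = x j * det (G q)" for j
      using cramer_lemma[of j "G q" "\<chi> i. x i"] by (simp cong: if_cong)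
    moreover have "det (G q) \<noteq> 0" using frame_gram_det[OF F q] by (simp add: G_def)
    ultimately have "x j = k j q" for j
      by (simp add: k_def G_def cong: if_cong)
    then show "(\<Sum>j\<in>UNIV. k j q *\<^sub>R F j q) = Z q" using x by simp
  qed
qed

end

section \<open>Metrics and endomorphism fields\<close>

context contact_manifold
begin

abbreviation conformal_operator_at :: "'m \<Rightarrow> real \<Rightarrow> (real ^ 5 \<Rightarrow> real ^ 5) \<Rightarrow> bool" where
  "conformal_operator_at p \<equiv> symplectic_space.conformal_operator (\<Delta> p) (\<Omega> p)"

text \<open>As for metrics, values off the distribution are fixed to be zero, so that equality of functions is
  equality of fields of endomorphisms of the distribution.\<close>

definition twisting_field :: "real \<Rightarrow> ('m \<Rightarrow> real ^ 5 \<Rightarrow> real ^ 5) \<Rightarrow> bool" where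
  "twisting_field s J \<longleftrightarrow> (\<forall>p. conformal_operator_at p s (J p) \<and> (\<forall>u. u \<notin> \<Delta> p \<longrightarrow> J p u = 0)) \<and>
     (\<forall>W X. open W \<and> smooth_section_on A \<Delta> W X \<longrightarrow> smooth_vector_field_on A W (\<lambda>p. J p (X p)))"

lemma twisting_fieldD:
  assumes "twisting_field s J"
  shows "conformal_operator_at p s (J p)" "u \<notin> \<Delta> p \<Longrightarrow> J p u = 0"
    "open W \<Longrightarrow> smooth_vector_field_on A W X \<Longrightarrow> (\<And>p. p \<in> W \<Longrightarrow> X p \<in> \<Delta> p) \<Longrightarrow>
      smooth_vector_field_on A W (\<lambda>p. J p (X p))"
  using assms by (auto simp: twisting_field_def smooth_section_on_def)

lemma almost_CR_iff:
  "almost_CR_structure_split A \<omega> J \<longleftrightarrow>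
    twisting_field (- 1) J \<and> (\<forall>p. has_signature (\<Delta> p) (twisted_form A \<omega> J p) 2 2)"
proof -
  have "conformal_operator_at p (- 1) (J p) \<longleftrightarrow> linear_within (\<Delta> p) (J p) \<and>
      (\<forall>u\<in>\<Delta> p. J p u \<in> \<Delta> p \<and> J p (J p u) = - u) \<and>
      (\<forall>u\<in>\<Delta> p. \<forall>v\<in>\<Delta> p. \<Omega> p (J p u) (J p v) = \<Omega> p u v)" for p
    by (simp add: symplectic.conformal_operator_def)
  then show ?thesis
    unfolding almost_CR_structure_split_def twisting_field_def by (simp only: all_conj_distrib conj_ac)
qed

lemma adapted_coframe_iff: "adapted_coframe A \<omega> g p w e \<longleftrightarrow> symplectic_space.adapted (\<Delta> p) (\<Omega> p) (g p) w e"
  unfolding adapted_coframe_def symplectic.adapted_def ..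

lemma conformal_class_self: "g \<in> conformal_class A g"
  unfolding conformal_class_def by (auto intro!: exI[of _ "\<lambda>_. 1"] smooth_function_on_const)

lemma conformal_class_scale:
  assumes f: "smooth_function_on A UNIV f" "\<And>p. f p > 0" and g: "\<And>p u v. g' p u v = f p * g p u v"
  shows "conformal_class A g' = conformal_class A g"
proof (intro equalityI subsetI)
  fix h assume "h \<in> conformal_class A g'"
  then obtain k where "smooth_function_on A UNIV k" "\<And>p. k p > 0" "\<And>p u v. h p u v = k p * g' p u v"
    by (auto simp: conformal_class_def)
  then show "h \<in> conformal_class A g"
    using f g unfolding conformal_class_def
    by (intro CollectI exI[of _ "\<lambda>p. k p * f p"]) (simp add: smooth_function_on_mult)
next
  fix h assume "h \<in> conformal_class A g"
  then obtain k where k: "smooth_function_on A UNIV k" "\<And>p. k p > 0" "\<And>p u v. h p u v = k p * g p u v"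
    by (auto simp: conformal_class_def)
  have "f p \<noteq> 0" for p using f(2)[of p] by simp
  then show "h \<in> conformal_class A g'"
    using k f g smooth_function_on_inverse[OF open_UNIV _ f(1)] unfolding conformal_class_def
    by (intro CollectI exI[of _ "\<lambda>p. k p * inverse (f p)"]) (simp add: smooth_function_on_mult)
qed

lemma twisted_form_in: "u \<in> \<Delta> p \<Longrightarrow> v \<in> \<Delta> p \<Longrightarrow> twisted_form A \<omega> J p u v = \<Omega> p u (J p v)"
  by (simp add: twisted_form_def)

lemma twisted_subconformal_metric:
  assumes J: "twisting_field s J" and s: "s\<^sup>2 = 1"
    and sig: "\<And>p. has_signature (\<Delta> p) (twisted_form A \<omega> J p) 2 2"
  shows "subconformal_metric A \<omega> (twisted_form A \<omega> J)"
  unfolding subconformal_metric_def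
proof (intro conjI allI impI)
  show "symmetric_bilinear_within (\<Delta> p) (twisted_form A \<omega> J p)" for p
    by (rule symplectic.twisted_symmetric_bilinear[OF twisting_fieldD(1)[OF J] s, where h = 1])
      (simp add: twisted_form_def)
  show "has_signature (\<Delta> p) (twisted_form A \<omega> J p) 2 2" for p by (rule sig)
  show "twisted_form A \<omega> J p u v = 0" if "u \<notin> \<Delta> p \<or> v \<notin> \<Delta> p" for p u v
    using that by (auto simp: twisted_form_def)
  fix W X Y
  assume XY: "open W \<and> smooth_section_on A \<Delta> W X \<and> smooth_section_on A \<Delta> W Y"
  then have W: "open W" and X: "smooth_vector_field_on A W X" "\<And>p. p \<in> W \<Longrightarrow> X p \<in> \<Delta> p"
    and Y: "smooth_vector_field_on A W Y" "\<And>p. p \<in> W \<Longrightarrow> Y p \<in> \<Delta> p"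
    by (auto simp: smooth_section_on_def)
  show "smooth_function_on A W (\<lambda>p. twisted_form A \<omega> J p (X p) (Y p))"
    by (rule smooth_function_on_cong[OF W _ smooth_ext_deriv[OF W X(1) twisting_fieldD(3)[OF J W Y]]])
      (simp add: X Y twisted_form_in)
qed

text \<open>At a point every metric of the class is a positive multiple of \<open>\<Omega>(\<cdot>, J \<cdot>)\<close>, so the pointwise results
  apply to all of them alike.\<close>

lemma twisted_structure:
  assumes J: "twisting_field s J" and s: "s\<^sup>2 = 1"
    and sig: "\<And>p. has_signature (\<Delta> p) (twisted_form A \<omega> J p) 2 2"
  defines "C \<equiv> conformal_class A (twisted_form A \<omega> J)"
  shows "subconformal_structure A \<omega> C" "compatible A \<omega> C" "of_type A \<omega> C s"
proof -
  show "subconformal_structure A \<omega> C"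
    unfolding subconformal_structure_def C_def using twisted_subconformal_metric[OF J s sig] by blast
  have C: "\<exists>k>0. (\<forall>u v. g p u v = k * twisted_form A \<omega> J p u v) \<and>
      (\<forall>u\<in>\<Delta> p. \<forall>v\<in>\<Delta> p. g p u v = k * \<Omega> p u (J p v))" if g: "g \<in> C" for g p
  proof -
    obtain k where "\<And>p. k p > 0" "\<And>p u v. g p u v = k p * twisted_form A \<omega> J p u v"
      using g by (auto simp: C_def conformal_class_def)
    then show ?thesis by (intro exI[of _ "k p"]) (simp add: twisted_form_in)
  qed
  have "\<exists>w e. adapted_coframe A \<omega> g p w e" if g: "g \<in> C" for g p
  proof -
    obtain k where k: "k > 0" "\<And>u v. g p u v = k * twisted_form A \<omega> J p u v"
      "\<And>u v. u \<in> \<Delta> p \<Longrightarrow> v \<in> \<Delta> p \<Longrightarrow> g p u v = k * \<Omega> p u (J p v)" using C[OF g, of p] by blast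
    have sig': "has_signature (\<Delta> p) (g p) 2 2" by (rule has_signature_scale[OF sig k(1,2)])
    have "s = 1 \<or> s = - 1" using s by (simp add: power2_eq_1_iff)
    then show ?thesis
      unfolding adapted_coframe_iff
      using symplectic.adapted_coframe_para[of p "J p" k "g p"] symplectic.adapted_coframe_hermitian[of p "J p" k "g p"]
        twisting_fieldD(1)[OF J] k(1,3) sig' by metis
  qed
  then show "compatible A \<omega> C" by (simp add: compatible_def)
  show "of_type A \<omega> C s"
    unfolding of_type_def
  proof (intro ballI allI impI)
    fix g p w e assume g: "g \<in> C" and "adapted_coframe A \<omega> g p w e"
    then have a: "symplectic_space.adapted (\<Delta> p) (\<Omega> p) (g p) w e" by (simp add: adapted_coframe_iff)
    obtain k where k: "k > 0" "\<And>u v. u \<in> \<Delta> p \<Longrightarrow> v \<in> \<Delta> p \<Longrightarrow> g p u v = k * \<Omega> p u (J p v)"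
      using C[OF g, of p] by blast
    have c: "null_diagonal_coframe (\<Delta> p) (g p) w e" using a by (simp add: symplectic.adapted_def)
    note form = symplectic.adapted_form[OF a]
    have "sgn ((\<Omega> p (e 1) (e 3))\<^sup>2 - \<Omega> p (e 1) (e 2) * \<Omega> p (e 3) (e 4)) = s"
      by (rule symplectic.type_of_twisted[OF twisting_fieldD(1)[OF J] s k c form])
    then show "\<exists>a b c. (\<forall>u\<in>\<Delta> p. \<forall>v\<in>\<Delta> p. \<Omega> p u v = a * wedge (w 1) (w 2) u v
        + b * (wedge (w 1) (w 3) u v + wedge (w 2) (w 4) u v) + c * wedge (w 3) (w 4) u v) \<and>
        sgn (b\<^sup>2 - a * c) = s"
      using form by blast
  qed
qed

lemma twisting_field_unique:
  assumes J: "twisting_field s J" and J': "twisting_field s J'" and s: "s\<^sup>2 = 1"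
    and eq: "conformal_class A (twisted_form A \<omega> J) = conformal_class A (twisted_form A \<omega> J')"
  shows "J = J'"
proof (intro ext)
  fix p v
  have "twisted_form A \<omega> J' \<in> conformal_class A (twisted_form A \<omega> J)" using conformal_class_self eq by simp
  then obtain f where "\<forall>p. f p > 0" "\<forall>p u v. twisted_form A \<omega> J' p u v = f p * twisted_form A \<omega> J p u v"
    unfolding conformal_class_def by blast
  then have f: "f p > 0" "\<And>u v. twisted_form A \<omega> J' p u v = f p * twisted_form A \<omega> J p u v" by auto
  show "J p v = J' p v"
  proof (cases "v \<in> \<Delta> p")
    case True
    have "\<Omega> p x (J' p y) = f p * \<Omega> p x (J p y)" if "x \<in> \<Delta> p" "y \<in> \<Delta> p" for x y
      using f(2)[of x y] that by (simp add: twisted_form_in)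
    from symplectic.conformal_operator_unique[OF twisting_fieldD(1)[OF J] twisting_fieldD(1)[OF J'] s f(1) this True]
    show ?thesis by simp
  next
    case False
    then show ?thesis using twisting_fieldD(2)[OF J] twisting_fieldD(2)[OF J'] by simp
  qed
qed

lemma frame_on_subset: "frame_on W F \<Longrightarrow> open W' \<Longrightarrow> W' \<subseteq> W \<Longrightarrow> frame_on W' F"
  unfolding frame_on_def by (meson smooth_vector_field_on_subset subsetD)

text \<open>The pointwise operators come with factors \<open>f\<close> that a priori are arbitrary functions of the point.
  Dividing by \<open>f\<close> gives the operator \<open>T\<close> determined by the smooth data \<open>g\<close> and \<open>\<Omega>\<close>; smoothness
  of \<open>f\<close> itself is recovered from \<open>T\<^sup>2 = s / f\<^sup>2\<close>.\<close>

lemma twisting_field_exists: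
  assumes C: "subconformal_structure A \<omega> C" "compatible A \<omega> C" "of_type A \<omega> C s" and s: "s\<^sup>2 = 1"
  shows "\<exists>J. twisting_field s J \<and> (\<forall>p. has_signature (\<Delta> p) (twisted_form A \<omega> J p) 2 2) \<and>
    conformal_class A (twisted_form A \<omega> J) = C"
proof -
  obtain g where g: "subconformal_metric A \<omega> g" and Cg: "C = conformal_class A g"
    using C(1) unfolding subconformal_structure_def by blast
  have gC: "g \<in> C" unfolding Cg by (rule conformal_class_self)
  have g_sym: "symmetric_bilinear_within (\<Delta> p) (g p)" and g_sig: "has_signature (\<Delta> p) (g p) 2 2"
    and g_off: "u \<notin> \<Delta> p \<or> v \<notin> \<Delta> p \<Longrightarrow> g p u v = 0" for p u v
    using g by (auto simp: subconformal_metric_def)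
  have g_smooth: "smooth_function_on A W (\<lambda>p. g p (X p) (Y p))"
    if "open W" "smooth_vector_field_on A W X" "\<And>p. p \<in> W \<Longrightarrow> X p \<in> \<Delta> p"
      "smooth_vector_field_on A W Y" "\<And>p. p \<in> W \<Longrightarrow> Y p \<in> \<Delta> p" for W X Y
    using g that by (simp add: subconformal_metric_def smooth_section_on_def)
  have "\<exists>f K. f > 0 \<and> conformal_operator_at p s K \<and> (\<forall>u. u \<notin> \<Delta> p \<longrightarrow> K u = 0) \<and>
    (\<forall>u\<in>\<Delta> p. \<forall>v\<in>\<Delta> p. \<Omega> p u (K v) = f * g p u v)" for p
  proof -
    obtain w e where we: "adapted_coframe A \<omega> g p w e"
      using C(2) gC unfolding compatible_def by blast
    then obtain a b c where "\<And>u v. u \<in> \<Delta> p \<Longrightarrow> v \<in> \<Delta> p \<Longrightarrow> \<Omega> p u v = a * wedge (w 1) (w 2) u v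
        + b * (wedge (w 1) (w 3) u v + wedge (w 2) (w 4) u v) + c * wedge (w 3) (w 4) u v"
      "sgn (b\<^sup>2 - a * c) = s"
      using C(3) gC unfolding of_type_def by blast
    then show ?thesis
      by (rule symplectic.exists_twisting_operator[OF we[unfolded adapted_coframe_iff] s g_sym])
  qed
  then obtain f J where f: "\<And>p. f p > 0" and J: "\<And>p. conformal_operator_at p s (J p)"
    and J_off: "\<And>p u. u \<notin> \<Delta> p \<Longrightarrow> J p u = 0"
    and fg: "\<And>p u v. u \<in> \<Delta> p \<Longrightarrow> v \<in> \<Delta> p \<Longrightarrow> \<Omega> p u (J p v) = f p * g p u v"
    by metis
  note JD = symplectic.conformal_operatorD[OF J]
  note Om_scale = bilinear_rmul[OF ext_deriv_bilinear]
  define T where "T p v = inverse (f p) *\<^sub>R J p v" for p v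
  have f0: "f p \<noteq> 0" for p using f[of p] by simp
  have T_in: "T p v \<in> \<Delta> p" if "v \<in> \<Delta> p" for p v
    using that JD(3) symplectic.in_V(3) by (simp add: T_def)
  have OmT: "\<Omega> p u (T p v) = g p u v" if "u \<in> \<Delta> p" "v \<in> \<Delta> p" for p u v
    using that fg f0 by (simp add: T_def Om_scale)
  have TT: "T p (T p v) = (s * inverse (f p * f p)) *\<^sub>R v" if "v \<in> \<Delta> p" for p v
    using that JD(2,3,4) by (simp add: T_def)
  have T_smooth: "smooth_vector_field_on A W (\<lambda>p. T p (X p))"
    if W: "open W" and X: "smooth_vector_field_on A W X" "\<And>p. p \<in> W \<Longrightarrow> X p \<in> \<Delta> p" for W X
  proof (rule smooth_vector_field_on_local)
    fix p assume p: "p \<in> W"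
    obtain W1 F where W1: "p \<in> W1" "frame_on W1 F" using local_frame by blast
    let ?W = "W \<inter> W1"
    have W': "open ?W" using W frame_onD(1)[OF W1(2)] by blast
    have F: "frame_on ?W F" by (rule frame_on_subset[OF W1(2) W']) simp
    have X': "smooth_vector_field_on A ?W X" "\<And>q. q \<in> ?W \<Longrightarrow> X q \<in> \<Delta> q"
      using X smooth_vector_field_on_subset by auto
    have "smooth_vector_field_on A ?W (\<lambda>p. T p (X p))"
    proof (rule smooth_section_test[OF F])
      show "T q (X q) \<in> \<Delta> q" if "q \<in> ?W" for q using T_in X' that by blast
      show "smooth_function_on A ?W (\<lambda>q. \<Omega> q (F i q) (T q (X q)))" for i
        by (rule smooth_function_on_cong[OF W' _ g_smooth[OF W' frame_onD(2,4)[OF F] X']])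
          (use X'(2) frame_onD(4)[OF F] in \<open>simp_all add: OmT\<close>)
    qed
    then show "\<exists>W'. open W' \<and> p \<in> W' \<and> smooth_vector_field_on A W' (\<lambda>p. T p (X p))"
      using W' p W1(1) by blast
  qed
  have f_smooth: "smooth_function_on A UNIV f"
  proof (rule smooth_function_on_local)
    fix p
    obtain W F where W: "p \<in> W" and F: "frame_on W F" using local_frame by blast
    note FD = frame_onD[OF F]
    have "\<exists>i j. \<Omega> p (F i p) (F j p) \<noteq> 0"
    proof (rule ccontr)
      assume "\<not> ?thesis"
      then have "(\<chi> i j. \<Omega> p (F i p) (F j p)) = (0 :: real ^ 4 ^ 4)" by (simp add: vec_eq_iff)
      then show False using frame_gram_det[OF F W] det_zero_row(1)[of 1 "0 :: real ^ 4 ^ 4"] by (simp add: row_def zero_vec_def)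
    qed
    then obtain i j where ij: "\<Omega> p (F i p) (F j p) \<noteq> 0" by blast
    let ?o = "\<lambda>q. \<Omega> q (F i q) (F j q)"
    let ?g = "\<lambda>q. g q (F i q) (T q (F j q))"
    let ?W = "{q \<in> W. ?o q \<noteq> 0}"
    have o: "smooth_function_on A W ?o" by (rule smooth_ext_deriv[OF FD(1,2,2)])
    have W': "open ?W" by (rule smooth_function_on_nonzero_open[OF FD(1) o])
    have sm: "smooth_function_on A W ?g"
      by (rule g_smooth[OF FD(1,2,4) T_smooth[OF FD(1,2,4)]]) (use T_in FD(4) in auto)
    have go: "?g q = s * inverse (f q * f q) * ?o q" if "q \<in> W" for q
      using OmT[OF FD(4)[OF that] T_in[OF FD(4)[OF that]], of i j] TT[OF FD(4)[OF that]] by (simp add: Om_scale)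
    have g0: "?g q \<noteq> 0" if "q \<in> ?W" for q using that go f0 s by auto
    have ff: "s * ?o q * inverse (?g q) = f q * f q" if "q \<in> ?W" for q
    proof -
      have "s * ?o q = (f q * f q) * ?g q" using go[of q] f0[of q] that by (simp add: field_simps)
      then show ?thesis using g0[OF that] by simp
    qed
    have "smooth_function_on A ?W (\<lambda>q. sqrt (s * ?o q * inverse (?g q)))"
    proof (intro smooth_function_on_sqrt smooth_function_on_mult smooth_function_on_inverse
        smooth_function_on_const W' g0)
      show "smooth_function_on A ?W ?o" "smooth_function_on A ?W ?g"
        by (rule smooth_function_on_subset[OF o], blast, rule smooth_function_on_subset[OF sm], blast)
      show "0 < s * ?o q * inverse (?g q)" if "q \<in> ?W" for q unfolding ff[OF that] using f[of q] by simp
    qed simp_all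
    then have "smooth_function_on A ?W f"
      by (rule smooth_function_on_cong[OF W', rotated]) (use ff f in \<open>simp add: less_imp_le\<close>)
    then show "\<exists>W'. open W' \<and> p \<in> W' \<and> smooth_function_on A W' f" using W' W ij by blast
  qed
  have J_smooth: "smooth_vector_field_on A W (\<lambda>p. J p (X p))"
    if W: "open W" and X: "smooth_vector_field_on A W X" "\<And>p. p \<in> W \<Longrightarrow> X p \<in> \<Delta> p" for W X
  proof -
    have "smooth_vector_field_on A W (\<lambda>p. f p *\<^sub>R T p (X p))"
      by (rule smooth_vector_field_on_scale[OF W smooth_function_on_subset[OF f_smooth] T_smooth[OF W X]]) auto
    then show ?thesis by (simp add: T_def f0)
  qed
  have tw: "twisted_form A \<omega> J p u v = f p * g p u v" for p u v
    using fg[of u p v] g_off[of u p v] by (auto simp: twisted_form_def)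
  have "twisting_field s J"
    unfolding twisting_field_def using J J_off J_smooth by (auto simp: smooth_section_on_def)
  moreover have "has_signature (\<Delta> p) (twisted_form A \<omega> J p) 2 2" for p
    by (rule has_signature_scale[OF g_sig f tw])
  moreover have "conformal_class A (twisted_form A \<omega> J) = C"
    unfolding Cg by (rule conformal_class_scale[OF f_smooth f tw])
  ultimately show ?thesis by blast
qed

section \<open>Legendrian splittings\<close>

abbreviation eigenspace :: "('m \<Rightarrow> real ^ 5 \<Rightarrow> real ^ 5) \<Rightarrow> real \<Rightarrow> 'm \<Rightarrow> (real ^ 5) set" where
  "eigenspace J t p \<equiv> {v \<in> \<Delta> p. J p v = t *\<^sub>R v}"

lemma para_complex_add:
  assumes L: "subspace (Lm p)" "subspace (Lp p)" "Lm p \<inter> Lp p = {0}" and xy: "x \<in> Lm p" "y \<in> Lp p"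
  shows "para_complex Lm Lp p (x + y) = y - x"
proof -
  have "(THE z. \<exists>x'\<in>Lm p. \<exists>y'\<in>Lp p. x + y = x' + y' \<and> z = y' - x') = y - x"
  proof (rule the_equality)
    show "\<exists>x'\<in>Lm p. \<exists>y'\<in>Lp p. x + y = x' + y' \<and> y - x = y' - x'" using xy by blast
  next
    fix z assume "\<exists>x'\<in>Lm p. \<exists>y'\<in>Lp p. x + y = x' + y' \<and> z = y' - x'"
    then obtain x' y' where x'y': "x' \<in> Lm p" "y' \<in> Lp p" "x + y = x' + y'" "z = y' - x'" by blast
    have "x - x' = y' - y" using x'y'(3) by (simp add: algebra_simps)
    then have "x - x' \<in> Lm p \<inter> Lp p"
      using subspace_diff[OF L(1) xy(1) x'y'(1)] subspace_diff[OF L(2) x'y'(2) xy(2)] by simp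
    then have "x = x'" unfolding L(3) by simp
    then have "y = y'" using x'y'(3) by simp
    then show "z = y - x" using x'y'(4) \<open>x = x'\<close> by simp
  qed
  moreover have "\<exists>x'\<in>Lm p. \<exists>y'\<in>Lp p. x + y = x' + y'" using xy by blast
  ultimately show ?thesis by (simp add: para_complex_def)
qed

text \<open>To see that \<open>J\<close> preserves smooth sections, test with a frame \<open>F\<^sub>i\<close> consisting of frames of the two
  subbundles: there \<open>\<Omega>(F\<^sub>i, J X) = - \<Omega>(J F\<^sub>i, X) = \<plusminus> \<Omega>(F\<^sub>i, X)\<close>.\<close>

lemma para_complex_twisting:
  assumes L: "legendrian_contact_structure A \<omega> Lm Lp"
  defines "J \<equiv> para_complex Lm Lp"
  shows "twisting_field 1 J" "Lm = eigenspace J (- 1)" "Lp = eigenspace J 1"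
proof -
  have lag: "lagrangian (\<Delta> p) (\<Omega> p) (Lm p)" "lagrangian (\<Delta> p) (\<Omega> p) (Lp p)"
    and sum: "\<Delta> p = {x + y |x y. x \<in> Lm p \<and> y \<in> Lp p}" and int: "Lm p \<inter> Lp p = {0}" for p
    using L unfolding legendrian_contact_structure_def by blast+
  have sub: "subspace (Lm p)" "subspace (Lp p)" "Lm p \<subseteq> \<Delta> p" "Lp p \<subseteq> \<Delta> p"
    and iso: "\<And>u v. u \<in> Lm p \<Longrightarrow> v \<in> Lm p \<Longrightarrow> \<Omega> p u v = 0" "\<And>u v. u \<in> Lp p \<Longrightarrow> v \<in> Lp p \<Longrightarrow> \<Omega> p u v = 0" for p
    using lag[of p] by (simp_all add: lagrangian_def)
  have J: "J p (x + y) = y - x" if "x \<in> Lm p" "y \<in> Lp p" for p x y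
    unfolding J_def by (rule para_complex_add[of Lm p Lp x y, OF sub(1,2) int that])
  have split: "\<exists>x\<in>Lm p. \<exists>y\<in>Lp p. v = x + y" if "v \<in> \<Delta> p" for p v
    using that sum[of p] by blast
  have off: "J p v = 0" if "v \<notin> \<Delta> p" for p v
    using that sum[of p] by (auto simp: J_def para_complex_def)
  have op: "conformal_operator_at p 1 (J p)" for p
    unfolding symplectic.conformal_operator_def linear_within_def
  proof (intro conjI ballI allI)
    fix u a assume "u \<in> \<Delta> p"
    then obtain x y where u: "u = x + y" "x \<in> Lm p" "y \<in> Lp p" using split by blast
    have neg: "- x \<in> Lm p" using u sub subspace_neg by blast
    have Ju: "J p u = - x + y" using J[OF u(2,3)] u(1) by simp
    show "J p u \<in> \<Delta> p" unfolding Ju sum[of p] using neg u(3) by blast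
    show "J p (J p u) = 1 *\<^sub>R u" unfolding Ju using J[OF neg u(3)] u(1) by simp
    have "a *\<^sub>R x \<in> Lm p" "a *\<^sub>R y \<in> Lp p" using u sub subspace_scale by blast+
    from J[OF this] show "J p (a *\<^sub>R u) = a *\<^sub>R J p u"
      unfolding Ju unfolding u(1) by (simp add: scaleR_add_right scaleR_diff_right)
    fix v assume "v \<in> \<Delta> p"
    then obtain x' y' where v: "v = x' + y'" "x' \<in> Lm p" "y' \<in> Lp p" using split by blast
    have Jv: "J p v = - x' + y'" using J[OF v(2,3)] v(1) by simp
    have "x + x' \<in> Lm p" "y + y' \<in> Lp p" using u v sub subspace_add by blast+
    moreover have "u + v = (x + x') + (y + y')" by (simp add: u(1) v(1))
    ultimately show "J p (u + v) = J p u + J p v" using J[of "x + x'" p "y + y'"] by (simp add: Ju Jv)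
    show "\<Omega> p (J p u) (J p v) = - 1 * \<Omega> p u v"
      unfolding Ju Jv unfolding u(1) v(1) using iso[of _ p] u(2,3) v(2,3) by (simp add: symplectic.Om_simps)
  qed
  have Lm_eq: "Lm p = eigenspace J (- 1) p" and Lp_eq: "Lp p = eigenspace J 1 p" for p
  proof -
    have 0: "0 \<in> Lm p" "0 \<in> Lp p" using sub subspace_0 by blast+
    have "J p v = - v" if "v \<in> Lm p" for v using J[OF that 0(2)] by simp
    moreover have "J p v = v" if "v \<in> Lp p" for v using J[OF 0(1) that] by simp
    moreover have "v \<in> Lm p" if v: "v \<in> \<Delta> p" "J p v = - v" for v
    proof -
      obtain x y where xy: "v = x + y" "x \<in> Lm p" "y \<in> Lp p" using split v by blast
      then have eq: "y - x = - (x + y)" using J[OF xy(2,3)] v(2) by simp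
      have "y $ i = 0" for i using arg_cong[OF eq, of "\<lambda>v. v $ i"] by simp
      then have "y = 0" by (simp add: vec_eq_iff)
      then show ?thesis using xy by simp
    qed
    moreover have "v \<in> Lp p" if v: "v \<in> \<Delta> p" "J p v = v" for v
    proof -
      obtain x y where xy: "v = x + y" "x \<in> Lm p" "y \<in> Lp p" using split v by blast
      then have eq: "y - x = x + y" using J[OF xy(2,3)] v(2) by simp
      have "x $ i = 0" for i using arg_cong[OF eq, of "\<lambda>v. v $ i"] by simp
      then have "x = 0" by (simp add: vec_eq_iff)
      then show ?thesis using xy by simp
    qed
    ultimately show "Lm p = eigenspace J (- 1) p" "Lp p = eigenspace J 1 p"
      using sub(3)[of p] sub(4)[of p] by auto
  qed
  then show "Lm = eigenspace J (- 1)" "Lp = eigenspace J 1" by blast+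
  have "smooth_vector_field_on A W (\<lambda>p. J p (X p))"
    if W: "open W" and X: "smooth_vector_field_on A W X" "\<And>p. p \<in> W \<Longrightarrow> X p \<in> \<Delta> p" for W X
  proof (rule smooth_vector_field_on_local)
    fix p assume p: "p \<in> W"
    obtain W1 and Y :: "nat \<Rightarrow> 'm \<Rightarrow> real ^ 5" where W1: "open W1" "p \<in> W1" "\<forall>i<2. smooth_vector_field_on A W1 (Y i)"
      "\<forall>q\<in>W1. Lm q = span ((\<lambda>i. Y i q) ` {..<2})"
      using L unfolding legendrian_contact_structure_def smooth_subbundle_def by blast
    obtain W2 and Z :: "nat \<Rightarrow> 'm \<Rightarrow> real ^ 5" where W2: "open W2" "p \<in> W2" "\<forall>i<2. smooth_vector_field_on A W2 (Z i)"
      "\<forall>q\<in>W2. Lp q = span ((\<lambda>i. Z i q) ` {..<2})"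
      using L unfolding legendrian_contact_structure_def smooth_subbundle_def by blast
    let ?W = "W \<inter> W1 \<inter> W2"
    have W': "open ?W" using W W1 W2 by blast
    have X': "smooth_vector_field_on A ?W X" by (rule smooth_vector_field_on_subset[OF X(1)]) auto
    define F where "F i q = four_frame (Y 0 q) (Y 1 q) (Z 0 q) (Z 1 q) i" for i q
    have F: "frame_on ?W F"
      unfolding frame_on_def
    proof (intro conjI allI ballI W')
      have "smooth_vector_field_on A ?W (Y i)" "smooth_vector_field_on A ?W (Z i)" if "i < 2" for i
        using that W1(3) W2(3) smooth_vector_field_on_subset[of W1 "Y i" ?W]
          smooth_vector_field_on_subset[of W2 "Z i" ?W] by auto
      from this[of 0] this[of 1] show "smooth_vector_field_on A ?W (F i)" for i
        by (cases "i = 1"; cases "i = 2"; cases "i = 3") (simp_all add: F_def[abs_def] four_frame_def)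
      fix q assume "q \<in> ?W"
      then show "span (range (\<lambda>i. F i q)) = \<Delta> q"
        using span_four_frame[of "Y 0 q" "Y 1 q" "Z 0 q" "Z 1 q"] W1(4) W2(4) sum[of q]
        by (simp add: F_def lessThan_2_image)
    qed
    have "smooth_vector_field_on A ?W (\<lambda>p. J p (X p))"
    proof (rule smooth_section_test[OF F])
      show "J q (X q) \<in> \<Delta> q" if "q \<in> ?W" for q
        using symplectic.conformal_operatorD(3)[OF op] X(2) that by blast
      fix i
      have sm: "smooth_function_on A ?W (\<lambda>q. \<Omega> q (F i q) (X q))"
        by (rule smooth_ext_deriv[OF W' frame_onD(2)[OF F] X'])
      have "F i q \<in> (if i = 1 \<or> i = 2 then Lm q else Lp q)" if "q \<in> ?W" for q
        using that W1(4) W2(4) by (simp add: F_def four_frame_def lessThan_2_image span_base)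
      then have JF: "J q (F i q) = (if i = 1 \<or> i = 2 then - 1 else 1) *\<^sub>R F i q" if "q \<in> ?W" for q
        using that Lm_eq[of q] Lp_eq[of q] by (auto split: if_splits)
      have "\<Omega> q (F i q) (J q (X q)) = (if i = 1 \<or> i = 2 then 1 else - 1) * \<Omega> q (F i q) (X q)" if q: "q \<in> ?W" for q
      proof -
        have "\<Omega> q (J q (F i q)) (X q) = - \<Omega> q (F i q) (J q (X q))"
          by (rule symplectic.conformal_operator_skew[OF op _ frame_onD(4)[OF F q]]) (use q X(2) in simp_all)
        then show ?thesis unfolding JF[OF q] by (auto simp: symplectic.Om_simps)
      qed
      then show "smooth_function_on A ?W (\<lambda>q. \<Omega> q (F i q) (J q (X q)))"
        using smooth_function_on_cong[OF W' _ smooth_function_on_mult[OF W'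
            smooth_function_on_const[of _ "if i = 1 \<or> i = 2 then 1 else - 1"] sm]] by presburger
    qed
    then show "\<exists>W'. open W' \<and> p \<in> W' \<and> smooth_vector_field_on A W' (\<lambda>p. J p (X p))"
      using W' p W1(2) W2(2) by blast
  qed
  then show "twisting_field 1 J"
    unfolding twisting_field_def using op off by (auto simp: smooth_section_on_def)
qed

text \<open>Extend \<open>z\<close> to a local section of the distribution and project it with \<open>(1 + t J) / 2\<close>.\<close>

lemma eigenspace_section:
  assumes J: "twisting_field 1 J" and t: "t * t = 1" and z: "z \<in> eigenspace J t p"
  shows "\<exists>W Z. open W \<and> p \<in> W \<and> smooth_vector_field_on A W Z \<and> (\<forall>q\<in>W. Z q \<in> eigenspace J t q) \<and> Z p = z"
proof -
  obtain W F where W: "p \<in> W" and F: "frame_on W F" using local_frame by blast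
  note FD = frame_onD[OF F]
  note JD = symplectic.conformal_operatorD[OF twisting_fieldD(1)[OF J]]
  have "z \<in> span (range (\<lambda>i. F i p))" using z FD(3)[OF W] by simp
  then obtain x where x: "z = (\<Sum>i\<in>UNIV. x i *\<^sub>R F i p)" using span_range_sum by blast
  define Y where "Y q = (\<Sum>i\<in>UNIV. x i *\<^sub>R F i q)" for q
  have Y: "smooth_vector_field_on A W Y"
    unfolding Y_def by (intro smooth_vector_field_on_linear_combination FD(1,2) smooth_function_on_const)
  have YD: "Y q \<in> \<Delta> q" if "q \<in> W" for q
    unfolding Y_def using FD(4)[OF that] by (intro subspace_sum subspace_scale symplectic.V(1))
  define Z where "Z q = (1/2) *\<^sub>R (Y q + t *\<^sub>R J q (Y q))" for q
  have "smooth_vector_field_on A W Z"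
    unfolding Z_def
    by (intro smooth_vector_field_on_scale smooth_vector_field_on_add smooth_function_on_const FD(1) Y
        twisting_fieldD(3)[OF J] YD)
  moreover have "Z q \<in> eigenspace J t q" if "q \<in> W" for q
    using YD[OF that] JD(1-4) symplectic.in_V t by (simp add: Z_def algebra_simps)
  moreover have "Z p = z"
    using z t x by (simp add: Z_def Y_def flip: scaleR_add_left)
  ultimately show ?thesis using W FD(1) by blast
qed

text \<open>Dual bases of the two eigenspaces at \<open>p\<close> extend to local sections of them. The determinant of
  their pairing is \<open>1\<close> at \<open>p\<close>, and where it does not vanish the sections are independent and thus
  span the eigenspaces.\<close>

lemma eigenspace_subbundle:
  assumes J: "twisting_field 1 J" and t: "t = 1 \<or> t = - 1"
  shows "smooth_subbundle A 2 (eigenspace J t)"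
proof -
  note E = symplectic.eigenspaces[OF twisting_fieldD(1)[OF J]]
  have lag: "lagrangian (\<Delta> p) (\<Omega> p) (eigenspace J 1 p)" "lagrangian (\<Delta> p) (\<Omega> p) (eigenspace J (- 1) p)" for p
    using E(1,2)[of p] by simp_all
  have sum: "\<Delta> p = {x + y |x y. x \<in> eigenspace J t p \<and> y \<in> eigenspace J (- t) p}" for p
  proof -
    have "\<Delta> p = {x + y |x y. x \<in> eigenspace J (- 1) p \<and> y \<in> eigenspace J 1 p}"
      using E(3)[of p] by simp
    moreover have "{x + y |x y. x \<in> S \<and> y \<in> T} = {x + y |x y. x \<in> T \<and> y \<in> S}" for S T :: "(real ^ 5) set"
      by (intro Collect_cong) (metis add.commute)
    ultimately show ?thesis using t by (elim disjE) (simp_all only: minus_minus)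
  qed
  have lag_t: "lagrangian (\<Delta> p) (\<Omega> p) (eigenspace J t p)" "lagrangian (\<Delta> p) (\<Omega> p) (eigenspace J (- t) p)" for p
    using lag[of p] t by auto
  have tt: "t * t = 1" "(- t) * (- t) = 1" using t by auto
  show ?thesis
    unfolding smooth_subbundle_def
  proof (intro conjI allI)
    show "subspace (eigenspace J t p)" "dim (eigenspace J t p) = 2" for p
      using lag_t(1)[of p] unfolding lagrangian_def by blast+
    fix p
    obtain l1 l2 m1 m2 where l: "l1 \<in> eigenspace J t p" "l2 \<in> eigenspace J t p"
      and m: "m1 \<in> eigenspace J (- t) p" "m2 \<in> eigenspace J (- t) p"
      and lm: "\<Omega> p l1 m1 = 1" "\<Omega> p l1 m2 = 0" "\<Omega> p l2 m1 = 0" "\<Omega> p l2 m2 = 1"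
      by (rule symplectic.symplectic_basis[OF lag_t sum])
    obtain W1 Z1 where 1: "open W1" "p \<in> W1" "smooth_vector_field_on A W1 Z1" "\<forall>q\<in>W1. Z1 q \<in> eigenspace J t q" "Z1 p = l1"
      using eigenspace_section[OF J tt(1) l(1)] by blast
    obtain W2 Z2 where 2: "open W2" "p \<in> W2" "smooth_vector_field_on A W2 Z2" "\<forall>q\<in>W2. Z2 q \<in> eigenspace J t q" "Z2 p = l2"
      using eigenspace_section[OF J tt(1) l(2)] by blast
    obtain W3 Y1 where 3: "open W3" "p \<in> W3" "smooth_vector_field_on A W3 Y1" "Y1 p = m1"
      using eigenspace_section[OF J tt(2) m(1)] by blast
    obtain W4 Y2 where 4: "open W4" "p \<in> W4" "smooth_vector_field_on A W4 Y2" "Y2 p = m2"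
      using eigenspace_section[OF J tt(2) m(2)] by blast
    let ?W = "W1 \<inter> W2 \<inter> W3 \<inter> W4"
    have W: "open ?W" using 1(1) 2(1) 3(1) 4(1) by blast
    have sm: "smooth_vector_field_on A ?W Z1" "smooth_vector_field_on A ?W Z2"
      "smooth_vector_field_on A ?W Y1" "smooth_vector_field_on A ?W Y2"
      using smooth_vector_field_on_subset[OF 1(3), of ?W] smooth_vector_field_on_subset[OF 2(3), of ?W]
        smooth_vector_field_on_subset[OF 3(3), of ?W] smooth_vector_field_on_subset[OF 4(3), of ?W] by auto
    define D where "D q = \<Omega> q (Z1 q) (Y1 q) * \<Omega> q (Z2 q) (Y2 q)
      + (- 1) * (\<Omega> q (Z1 q) (Y2 q) * \<Omega> q (Z2 q) (Y1 q))" for q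
    have "smooth_function_on A ?W (\<lambda>q. \<Sum>b\<in>UNIV. if b then \<Omega> q (Z1 q) (Y1 q) * \<Omega> q (Z2 q) (Y2 q)
        else (- 1) * (\<Omega> q (Z1 q) (Y2 q) * \<Omega> q (Z2 q) (Y1 q)))"
    proof (rule smooth_function_on_sum[OF W])
      fix b :: bool
      show "smooth_function_on A ?W (\<lambda>q. if b then \<Omega> q (Z1 q) (Y1 q) * \<Omega> q (Z2 q) (Y2 q)
          else (- 1) * (\<Omega> q (Z1 q) (Y2 q) * \<Omega> q (Z2 q) (Y1 q)))"
        by (cases b) (simp_all only: if_True if_False smooth_function_on_mult[OF W] smooth_function_on_const smooth_ext_deriv[OF W] sm)
    qed
    then have "smooth_function_on A ?W D" by (simp add: UNIV_bool D_def[abs_def] add.commute)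
    then have W': "open {q \<in> ?W. D q \<noteq> 0}" by (rule smooth_function_on_nonzero_open[OF W])
    let ?X = "\<lambda>i::nat. if i = 0 then Z1 else Z2"
    have "smooth_vector_field_on A {q \<in> ?W. D q \<noteq> 0} (?X i)" for i
      using smooth_vector_field_on_subset[OF sm(1), of "{q \<in> ?W. D q \<noteq> 0}"]
        smooth_vector_field_on_subset[OF sm(2), of "{q \<in> ?W. D q \<noteq> 0}"] by auto
    moreover have "eigenspace J t q = span ((\<lambda>i. ?X i q) ` {..<2})" if q: "q \<in> {q \<in> ?W. D q \<noteq> 0}" for q
    proof -
      have Z: "Z1 q \<in> eigenspace J t q" "Z2 q \<in> eigenspace J t q" using 1(4) 2(4) q by blast+
      have sub: "subspace (eigenspace J t q)" "dim (eigenspace J t q) = 2"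
        using lag_t(1)[of q] unfolding lagrangian_def by blast+
      have "a = 0 \<and> b = 0" if ab: "a *\<^sub>R Z1 q + b *\<^sub>R Z2 q = 0" for a b
      proof -
        have Y: "a * \<Omega> q (Z1 q) y + b * \<Omega> q (Z2 q) y = 0" for y
        proof -
          have "a * \<Omega> q (Z1 q) y + b * \<Omega> q (Z2 q) y = \<Omega> q (a *\<^sub>R Z1 q + b *\<^sub>R Z2 q) y"
            by (simp add: symplectic.Om_simps)
          then show ?thesis unfolding ab by (simp add: symplectic.Om_simps)
        qed
        have "a * D q = (a * \<Omega> q (Z1 q) (Y1 q) + b * \<Omega> q (Z2 q) (Y1 q)) * \<Omega> q (Z2 q) (Y2 q)
            - (a * \<Omega> q (Z1 q) (Y2 q) + b * \<Omega> q (Z2 q) (Y2 q)) * \<Omega> q (Z2 q) (Y1 q)"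
          by (simp add: D_def algebra_simps)
        moreover have "b * D q = (a * \<Omega> q (Z1 q) (Y2 q) + b * \<Omega> q (Z2 q) (Y2 q)) * \<Omega> q (Z1 q) (Y1 q)
            - (a * \<Omega> q (Z1 q) (Y1 q) + b * \<Omega> q (Z2 q) (Y1 q)) * \<Omega> q (Z1 q) (Y2 q)"
          by (simp add: D_def algebra_simps)
        ultimately show ?thesis using q unfolding Y by simp
      qed
      then have "dim (span {Z1 q, Z2 q}) = 2" by (rule dim_span_pair)
      moreover have "span {Z1 q, Z2 q} \<subseteq> eigenspace J t q" using Z by (intro span_minimal sub) simp
      ultimately have "span {Z1 q, Z2 q} = eigenspace J t q"
        using sub by (intro subspace_dim_equal) auto
      then show ?thesis by (simp add: lessThan_2_image)
    qed
    moreover have "p \<in> {q \<in> ?W. D q \<noteq> 0}" using 1(2,5) 2(2,5) 3(2,4) 4(2,4) lm by (simp add: D_def)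
    ultimately show "\<exists>W (X :: nat \<Rightarrow> 'm \<Rightarrow> real ^ 5). open W \<and> p \<in> W \<and> (\<forall>i<2. smooth_vector_field_on A W (X i)) \<and>
        (\<forall>q\<in>W. eigenspace J t q = span ((\<lambda>i. X i q) ` {..<2}))"
      using W' by - (rule exI[of _ "{q \<in> ?W. D q \<noteq> 0}"], rule exI[of _ ?X], blast)
  qed
qed

lemma legendrian_of_twisting:
  assumes J: "twisting_field 1 J"
  shows "legendrian_contact_structure A \<omega> (eigenspace J (- 1)) (eigenspace J 1)"
    "para_complex (eigenspace J (- 1)) (eigenspace J 1) = J"
proof -
  note E = symplectic.eigenspaces[OF twisting_fieldD(1)[OF J]]
  note JD = symplectic.conformal_operatorD[OF twisting_fieldD(1)[OF J]]
  have eq: "eigenspace J (- 1) p = {v \<in> \<Delta> p. J p v = - v}" "eigenspace J 1 p = {v \<in> \<Delta> p. J p v = v}" for p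
    by simp_all
  show "legendrian_contact_structure A \<omega> (eigenspace J (- 1)) (eigenspace J 1)"
    unfolding legendrian_contact_structure_def
    using eigenspace_subbundle[OF J, of 1] eigenspace_subbundle[OF J, of "- 1"] E unfolding eq by simp
  show "para_complex (eigenspace J (- 1)) (eigenspace J 1) = J"
  proof (intro ext)
    fix p v
    show "para_complex (eigenspace J (- 1)) (eigenspace J 1) p v = J p v"
    proof (cases "v \<in> \<Delta> p")
      case True
      then have "v \<in> {x + y |x y. x \<in> eigenspace J (- 1) p \<and> y \<in> eigenspace J 1 p}"
        using E(3)[of p] unfolding eq by blast
      then obtain x y where xy: "v = x + y" "x \<in> eigenspace J (- 1) p" "y \<in> eigenspace J 1 p"
        by blast
      have sub: "subspace (eigenspace J (- 1) p)" "subspace (eigenspace J 1 p)"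
        using E(1,2)[of p] unfolding eq lagrangian_def by blast+
      have "eigenspace J (- 1) p \<inter> eigenspace J 1 p = {0}" using E(4)[of p] unfolding eq .
      from para_complex_add[of "eigenspace J (- 1)" p "eigenspace J 1" x y, OF sub this xy(2,3)]
      show ?thesis using JD(1)[of x p y] xy by simp
    next
      case False
      then have "\<not> (\<exists>x\<in>eigenspace J (- 1) p. \<exists>y\<in>eigenspace J 1 p. v = x + y)"
        using symplectic.in_V(2) by auto
      then show ?thesis using twisting_fieldD(2)[OF J False] by (simp add: para_complex_def)
    qed
  qed
qed

text \<open>The adapted coframe built from the eigenspaces exhibits the signature.\<close>

lemma para_signature:
  assumes J: "twisting_field 1 J"
  shows "has_signature (\<Delta> p) (twisted_form A \<omega> J p) 2 2"
proof -
  have "\<exists>w e. symplectic_space.adapted (\<Delta> p) (\<Omega> p) (twisted_form A \<omega> J p) w e"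
    by (rule symplectic.adapted_coframe_para[OF twisting_fieldD(1)[OF J], where h = 1])
      (simp_all add: twisted_form_in)
  then show ?thesis
    using null_diagonal_coframe_signature unfolding symplectic.adapted_def by blast
qed

section \<open>The correspondence\<close>

lemma legendrian_correspondence:
  "bij_betw (\<lambda>(Lm, Lp). subconformal_of_legendrian A \<omega> Lm Lp)
     {(Lm, Lp). legendrian_contact_structure A \<omega> Lm Lp}
     {C. subconformal_structure A \<omega> C \<and> compatible A \<omega> C \<and> of_type A \<omega> C 1}"
  unfolding bij_betw_def
proof (intro conjI inj_onI)
  fix L L' :: "('m \<Rightarrow> (real ^ 5) set) \<times> ('m \<Rightarrow> (real ^ 5) set)"
  assume L: "L \<in> {(Lm, Lp). legendrian_contact_structure A \<omega> Lm Lp}"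
    and L': "L' \<in> {(Lm, Lp). legendrian_contact_structure A \<omega> Lm Lp}"
    and eq: "(case L of (Lm, Lp) \<Rightarrow> subconformal_of_legendrian A \<omega> Lm Lp) =
      (case L' of (Lm, Lp) \<Rightarrow> subconformal_of_legendrian A \<omega> Lm Lp)"
  obtain Lm Lp Lm' Lp' where LL': "L = (Lm, Lp)" "L' = (Lm', Lp')" by (meson surj_pair)
  have leg: "legendrian_contact_structure A \<omega> Lm Lp" "legendrian_contact_structure A \<omega> Lm' Lp'"
    using L L' LL' by auto
  note P = para_complex_twisting[OF leg(1)] and P' = para_complex_twisting[OF leg(2)]
  have "para_complex Lm Lp = para_complex Lm' Lp'"
    by (rule twisting_field_unique[OF P(1) P'(1)]) (use eq LL' in \<open>simp_all add: subconformal_of_legendrian_def\<close>)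
  then have "Lm = Lm'" "Lp = Lp'" using P(2,3) P'(2,3) by metis+
  then show "L = L'" using LL' by simp
next
  show "(\<lambda>(Lm, Lp). subconformal_of_legendrian A \<omega> Lm Lp) ` {(Lm, Lp). legendrian_contact_structure A \<omega> Lm Lp} =
    {C. subconformal_structure A \<omega> C \<and> compatible A \<omega> C \<and> of_type A \<omega> C 1}"
  proof (intro equalityI subsetI)
    fix C assume "C \<in> (\<lambda>(Lm, Lp). subconformal_of_legendrian A \<omega> Lm Lp) ` {(Lm, Lp). legendrian_contact_structure A \<omega> Lm Lp}"
    then obtain Lm Lp where "legendrian_contact_structure A \<omega> Lm Lp"
      and C: "C = conformal_class A (twisted_form A \<omega> (para_complex Lm Lp))"
      by (auto simp: subconformal_of_legendrian_def)
    then have P: "twisting_field 1 (para_complex Lm Lp)" using para_complex_twisting(1) by blast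
    show "C \<in> {C. subconformal_structure A \<omega> C \<and> compatible A \<omega> C \<and> of_type A \<omega> C 1}"
      using twisted_structure[OF P _ para_signature[OF P]] C by simp
  next
    fix C assume "C \<in> {C. subconformal_structure A \<omega> C \<and> compatible A \<omega> C \<and> of_type A \<omega> C 1}"
    then obtain J where J: "twisting_field 1 J" and C: "conformal_class A (twisted_form A \<omega> J) = C"
      using twisting_field_exists[of C 1] by auto
    have "subconformal_of_legendrian A \<omega> (eigenspace J (- 1)) (eigenspace J 1) = C"
      unfolding subconformal_of_legendrian_def legendrian_of_twisting(2)[OF J] by (rule C)
    then show "C \<in> (\<lambda>(Lm, Lp). subconformal_of_legendrian A \<omega> Lm Lp) ` {(Lm, Lp). legendrian_contact_structure A \<omega> Lm Lp}"
      using legendrian_of_twisting(1)[OF J]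
      by (intro image_eqI[of _ _ "(eigenspace J (- 1), eigenspace J 1)"]) simp_all
  qed
qed

lemma almost_CR_correspondence:
  "bij_betw (subconformal_of_almost_CR A \<omega>) {J. almost_CR_structure_split A \<omega> J}
     {C. subconformal_structure A \<omega> C \<and> compatible A \<omega> C \<and> of_type A \<omega> C (- 1)}"
  unfolding bij_betw_def
proof (intro conjI inj_onI)
  fix J J' assume "J \<in> {J. almost_CR_structure_split A \<omega> J}" "J' \<in> {J. almost_CR_structure_split A \<omega> J}"
    "subconformal_of_almost_CR A \<omega> J = subconformal_of_almost_CR A \<omega> J'"
  then show "J = J'"
    by (intro twisting_field_unique[of "- 1" J J']) (simp_all add: almost_CR_iff subconformal_of_almost_CR_def)
next
  show "subconformal_of_almost_CR A \<omega> ` {J. almost_CR_structure_split A \<omega> J} =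
    {C. subconformal_structure A \<omega> C \<and> compatible A \<omega> C \<and> of_type A \<omega> C (- 1)}"
  proof (intro equalityI subsetI)
    fix C assume "C \<in> subconformal_of_almost_CR A \<omega> ` {J. almost_CR_structure_split A \<omega> J}"
    then obtain J where J: "twisting_field (- 1) J" "\<And>p. has_signature (\<Delta> p) (twisted_form A \<omega> J p) 2 2"
      and C: "C = conformal_class A (twisted_form A \<omega> J)"
      by (auto simp: almost_CR_iff subconformal_of_almost_CR_def)
    show "C \<in> {C. subconformal_structure A \<omega> C \<and> compatible A \<omega> C \<and> of_type A \<omega> C (- 1)}"
      using twisted_structure[OF J(1) _ J(2)] C by simp
  next
    fix C assume "C \<in> {C. subconformal_structure A \<omega> C \<and> compatible A \<omega> C \<and> of_type A \<omega> C (- 1)}"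
    then obtain J where "twisting_field (- 1) J" "\<forall>p. has_signature (\<Delta> p) (twisted_form A \<omega> J p) 2 2"
      "conformal_class A (twisted_form A \<omega> J) = C"
      using twisting_field_exists[of C "- 1"] by auto
    then show "C \<in> subconformal_of_almost_CR A \<omega> ` {J. almost_CR_structure_split A \<omega> J}"
      by (intro image_eqI[of _ _ J]) (simp_all add: almost_CR_iff subconformal_of_almost_CR_def)
  qed
qed

end

theorem proposition2p6:
  fixes A :: "('m :: {t2_space, second_countable_topology}) chart set"
    and \<omega> :: "'m \<Rightarrow> real ^ 5 \<Rightarrow> real"
  assumes "smooth_atlas A"
    and "contact_form A \<omega>"
  shows "bij_betw (\<lambda>(Lm, Lp). subconformal_of_legendrian A \<omega> Lm Lp)
           {(Lm, Lp). legendrian_contact_structure A \<omega> Lm Lp}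
           {C. subconformal_structure A \<omega> C \<and> compatible A \<omega> C \<and> of_type A \<omega> C 1} \<and>
         bij_betw (subconformal_of_almost_CR A \<omega>)
           {J. almost_CR_structure_split A \<omega> J}
           {C. subconformal_structure A \<omega> C \<and> compatible A \<omega> C \<and> of_type A \<omega> C (- 1)}"
proof -
  interpret contact_manifold A \<omega> by unfold_locales (rule assms)+
  show ?thesis using legendrian_correspondence almost_CR_correspondence by blast
qed

end
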